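(* Let $(M,J,g)$ be a compact almost Hermitian $2m$-manifold. For every $k$, the maps $$J\colon\mathcal H^k_{d+d^c}\to\mathcal H^k_{d^c+d},\quad *\colon\mathcal H^k_{d+d^c}\to\mathcal H^{2m-k}_{dd^c},\quad *\colon\mathcal H^k_{d^c+d}\to\mathcal H^{2m-k}_{d^cd},\quad J\colon\mathcal H^{2m-k}_{dd^c}\to\mathcal H^{2m-k}_{d^cd}$$ are well-defined isomorphisms, and the square they form commutes, i.e. $*\circ J=J\circ*$ as maps $\mathcal H^k_{d+d^c}\to\mathcal H^{2m-k}_{d^cd}$.
   Context: An almost Hermitian manifold $(M,J,g)$ is a smooth $2m$-manifold with an almost complex structure $J$ and a Riemannian metric $g$ with $g(J\cdot,J\cdot)=g(\cdot,\cdot)$, oriented by $J$; $*$ is the $\mathbb C$-linear Hodge operator. $A^k$ is the space of smooth complex $k$-forms; $J$ acts on forms by $J\alpha=i^{p-q}\alpha$ for $\alpha\in A^{p,q}$; $d^c:=J^{-1}dJ$. For an operator $P$ on forms put $P^*:=-*P*$; in particular $(dd^c)^*\alpha=0$ means $dd^c*\alpha=0$ and $(d^cd)^*\alpha=0$ means $d^cd*\alpha=0$. The spaces of harmonic forms are $$\mathcal H^k_{d+d^c}=\{\alpha\in A^k:d\alpha=0,\ d^c\alpha=0,\ (dd^c)^*\alpha=0\},$$ $$\mathcal H^k_{d^c+d}=\{\alpha\in A^k:d\alpha=0,\ d^c\alpha=0,\ (d^cd)^*\alpha=0\},$$ $$\mathcal H^k_{dd^c}=\{\alpha\in A^k:d^*\alpha=0,\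 (d^c)^*\alpha=0,\ dd^c\alpha=0\},$$ $$\mathcal H^k_{d^cd}=\{\alpha\in A^k:d^*\alpha=0,\ (d^c)^*\alpha=0,\ d^cd\alpha=0\}.$$ *)

theory Defs
  imports "HOL-Analysis.Analysis" "HOL-Library.Function_Algebras"
begin

section \<open>Smooth manifolds\<close>

fun Ck_on :: "nat \<Rightarrow> ('e::real_normed_vector \<Rightarrow> 'f::real_normed_vector) \<Rightarrow> 'e set \<Rightarrow> bool" where
  "Ck_on 0 f S \<longleftrightarrow> continuous_on S f"
| "Ck_on (Suc k) f S \<longleftrightarrow> (\<forall>x\<in>S. f differentiable (at x)) \<and>
     (\<forall>v. Ck_on k (\<lambda>x. frechet_derivative f (at x) v) S)"

text \<open>Meant for open sets \<open>S\<close> only.\<close>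

definition smooth_on :: "('e::real_normed_vector \<Rightarrow> 'f::real_normed_vector) \<Rightarrow> 'e set \<Rightarrow> bool" where
  "smooth_on f S \<longleftrightarrow> (\<forall>k. Ck_on k f S)"

text \<open>A chart is a pair of its domain and a map that is only relevant on that domain.\<close>

type_synonym ('a, 'e) chart = "'a set \<times> ('a \<Rightarrow> 'e)"

definition chart_image :: "('a, 'e) chart \<Rightarrow> 'e set" where
  "chart_image c = snd c ` fst c"

definition transition :: "('a, 'e) chart \<Rightarrow> ('a, 'e) chart \<Rightarrow> 'e \<Rightarrow> 'e" where
  "transition c c' = snd c' \<circ> inv_into (fst c) (snd c)"

definition overlap :: "('a, 'e) chart \<Rightarrow> ('a, 'e) chart \<Rightarrow> 'e set" where
  "overlap c c' = snd c ` (fst c \<inter> fst c')"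

definition smooth_atlas :: "'a topology \<Rightarrow> ('a, 'e::euclidean_space) chart set \<Rightarrow> bool" where
  "smooth_atlas X A \<longleftrightarrow>
     (\<forall>c\<in>A. openin X (fst c) \<and> open (chart_image c) \<and>
        homeomorphic_map (subtopology X (fst c)) (top_of_set (chart_image c)) (snd c)) \<and>
     (\<Union>c\<in>A. fst c) = topspace X \<and>
     (\<forall>c\<in>A. \<forall>c'\<in>A. smooth_on (transition c c') (overlap c c'))"

definition smooth_manifold :: "'a topology \<Rightarrow> ('a, 'e::euclidean_space) chart set \<Rightarrow> bool" where
  "smooth_manifold X A \<longleftrightarrow> Hausdorff_space X \<and> second_countable X \<and> smooth_atlas X A"


section \<open>Exterior algebra of a real vector space, with complex coefficients\<close>

text \<open>A complex form on the real vector space \<open>'e\<close> is a function on lists of vectors; its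
  restriction to lists of length \<open>k\<close> is its component of degree \<open>k\<close>. Thus \<open>alt_forms\<close> is the
  whole exterior algebra \<open>\<Lambda>\<^sup>*(V\<^sup>* \<otimes> \<complex>)\<close>, and \<open>alt_forms_deg k\<close> is its homogeneous part
  \<open>\<Lambda>\<^sup>k(V\<^sup>* \<otimes> \<complex>)\<close>.\<close>

type_synonym 'e alt = "'e list \<Rightarrow> complex"

definition alt_forms :: "'e::real_vector alt set" where
  "alt_forms = {\<omega>. (\<forall>us ws. linear (\<lambda>v. \<omega> (us @ v # ws))) \<and> (\<forall>vs. \<not> distinct vs \<longrightarrow> \<omega> vs = 0)}"

definition alt_forms_deg :: "nat \<Rightarrow> 'e::real_vector alt set" where
  "alt_forms_deg k = {\<omega> \<in> alt_forms. \<forall>vs. length vs \<noteq> k \<longrightarrow> \<omega> vs = 0}"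

text \<open>The sum over shuffles; the shuffle given by \<open>S\<close> moves the positions in \<open>S\<close> to the front.
  The normalisation is \<open>(\<eta>\<^sub>1 \<and> \<dots> \<and> \<eta>\<^sub>k)(v\<^sub>1,\<dots>,v\<^sub>k) = det (\<eta>\<^sub>i(v\<^sub>j))\<close>.\<close>

definition shuffle_sign :: "nat \<Rightarrow> nat set \<Rightarrow> complex" where
  "shuffle_sign n S = (-1) ^ card {(i, j). i \<in> S \<and> j \<in> {..<n} - S \<and> j < i}"

definition wedge :: "'e alt \<Rightarrow> 'e alt \<Rightarrow> 'e alt" where
  "wedge \<alpha> \<beta> = (\<lambda>vs. \<Sum>S\<in>Pow {..<length vs}.
     shuffle_sign (length vs) S * \<alpha> (nths vs S) * \<beta> (nths vs ({..<length vs} - S)))"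

definition covector_form :: "('e \<Rightarrow> complex) \<Rightarrow> 'e alt" where
  "covector_form \<eta> = (\<lambda>vs. case vs of [v] \<Rightarrow> \<eta> v | _ \<Rightarrow> 0)"

definition unit_form :: "'e alt" where
  "unit_form = (\<lambda>vs. if vs = [] then 1 else 0)"

definition wedge_covectors :: "('e \<Rightarrow> complex) list \<Rightarrow> 'e alt" where
  "wedge_covectors \<eta>s = foldr (\<lambda>\<eta> \<omega>. wedge (covector_form \<eta>) \<omega>) \<eta>s unit_form"


section \<open>Bidegree and the action of \<open>J\<close> on forms\<close>

definition covectors10 :: "('e::real_vector \<Rightarrow> 'e) \<Rightarrow> ('e \<Rightarrow> complex) set" where
  "covectors10 J = {\<eta>. linear \<eta> \<and> (\<forall>v. \<eta> (J v) = \<i> * \<eta> v)}"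

definition covectors01 :: "('e::real_vector \<Rightarrow> 'e) \<Rightarrow> ('e \<Rightarrow> complex) set" where
  "covectors01 J = {\<eta>. linear \<eta> \<and> (\<forall>v. \<eta> (J v) = - \<i> * \<eta> v)}"

text \<open>\<open>\<Lambda>\<^sup>p\<^sup>,\<^sup>q\<close>: the complex span of the wedge products of \<open>p\<close> covectors of type \<open>(1,0)\<close>
  and \<open>q\<close> covectors of type \<open>(0,1)\<close>.\<close>

inductive_set pq_forms :: "('e::real_vector \<Rightarrow> 'e) \<Rightarrow> nat \<Rightarrow> nat \<Rightarrow> 'e alt set" for J p q where
  zero: "0 \<in> pq_forms J p q"
| add: "\<lbrakk>\<alpha> \<in> pq_forms J p q; length \<eta>s = p; set \<eta>s \<subseteq> covectors10 J;
         length \<theta>s = q; set \<theta>s \<subseteq> covectors01 J\<rbrakk>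
        \<Longrightarrow> (\<lambda>vs. \<alpha> vs + z * wedge_covectors (\<eta>s @ \<theta>s) vs) \<in> pq_forms J p q"

text \<open>\<open>J\<close> on forms: \<open>\<i>\<^sup>p\<^sup>-\<^sup>q\<close> on \<open>\<Lambda>\<^sup>p\<^sup>,\<^sup>q\<close>, extended along the decomposition into bidegrees
  (which vanish for \<open>p\<close> or \<open>q\<close> above the dimension).\<close>

definition alt_J :: "('e::euclidean_space \<Rightarrow> 'e) \<Rightarrow> 'e alt \<Rightarrow> 'e alt" where
  "alt_J J \<omega> = (THE \<omega>'. \<exists>a. (\<forall>p q. a p q \<in> pq_forms J p q) \<and>
     \<omega> = (\<lambda>vs. \<Sum>p\<le>DIM('e). \<Sum>q\<le>DIM('e). a p q vs) \<and>
     \<omega>' = (\<lambda>vs. \<Sum>p\<le>DIM('e). \<Sum>q\<le>DIM('e). \<i> powi (int p - int q) * a p q vs))"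

definition alt_J_inv :: "('e::euclidean_space \<Rightarrow> 'e) \<Rightarrow> 'e alt \<Rightarrow> 'e alt" where
  "alt_J_inv J = inv_into alt_forms (alt_J J)"


section \<open>The Hodge operator\<close>

definition orthonormal_basis :: "('e::euclidean_space \<Rightarrow> 'e \<Rightarrow> real) \<Rightarrow> 'e list \<Rightarrow> bool" where
  "orthonormal_basis g es \<longleftrightarrow> length es = DIM('e) \<and>
     (\<forall>i<length es. \<forall>j<length es. g (es ! i) (es ! j) = (if i = j then 1 else 0))"

text \<open>The complex bilinear extension of the inner product that \<open>g\<close> induces on forms: the
  products of increasing subfamilies of the dual basis of an orthonormal basis are orthonormal.
  The value does not depend on the orthonormal basis. Different degrees are orthogonal.\<close>

definition alt_inner :: "('e::euclidean_space \<Rightarrow> 'e \<Rightarrow> real) \<Rightarrow> 'e alt \<Rightarrow> 'e alt \<Rightarrow> complex" where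
  "alt_inner g \<alpha> \<beta> = (let es = (SOME es. orthonormal_basis g es) in
     \<Sum>S\<in>Pow {..<DIM('e)}. \<alpha> (nths es S) * \<beta> (nths es S))"

text \<open>The Riemannian volume form for the orientation given by \<open>J\<close>, in which the bases
  \<open>v\<^sub>1, J v\<^sub>1, \<dots>, v\<^sub>m, J v\<^sub>m\<close> are positive.\<close>

definition volume_form ::
  "('e::euclidean_space \<Rightarrow> 'e \<Rightarrow> real) \<Rightarrow> ('e \<Rightarrow> 'e) \<Rightarrow> 'e alt" where
  "volume_form g J = (THE \<tau>. \<tau> \<in> alt_forms_deg DIM('e) \<and>
     (\<forall>vs. orthonormal_basis g (concat (map (\<lambda>v. [v, J v]) vs)) \<longrightarrow>
        \<tau> (concat (map (\<lambda>v. [v, J v]) vs)) = 1))"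

text \<open>\<open>\<alpha> \<and> *\<beta> = \<langle>\<alpha>, \<beta>\<rangle> vol\<close>. Since \<open>\<alpha>\<close> and \<open>\<beta>\<close> may have components in several degrees here,
  only the components of top degree are compared; for \<open>\<alpha>\<close> and \<open>\<beta>\<close> of degree \<open>k\<close> there are no
  others, because then \<open>*\<beta>\<close> has degree \<open>DIM('e) - k\<close>.\<close>

definition alt_hodge ::
  "('e::euclidean_space \<Rightarrow> 'e \<Rightarrow> real) \<Rightarrow> ('e \<Rightarrow> 'e) \<Rightarrow> 'e alt \<Rightarrow> 'e alt" where
  "alt_hodge g J \<beta> = (THE \<gamma>. \<gamma> \<in> alt_forms \<and>
     (\<forall>\<alpha>\<in>alt_forms. \<forall>vs. length vs = DIM('e) \<longrightarrow>
        wedge \<alpha> \<gamma> vs = alt_inner g \<alpha> \<beta> * volume_form g J vs))"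


section \<open>Almost Hermitian manifolds\<close>

text \<open>A tensor field is given by its local representations: for every chart \<open>c\<close> of the atlas a
  field on \<open>chart_image c\<close>, where tangent vectors are written in the coordinates of \<open>c\<close>. On
  overlaps these are related by the derivative of the transition map.\<close>

record ('a, 'e) almost_hermitian =
  mtop :: "'a topology"
  atlas :: "('a, 'e) chart set"
  acs :: "('a, 'e) chart \<Rightarrow> 'e \<Rightarrow> 'e \<Rightarrow> 'e"
  metric :: "('a, 'e) chart \<Rightarrow> 'e \<Rightarrow> 'e \<Rightarrow> 'e \<Rightarrow> real"

definition trans_deriv ::
  "('a, 'e::euclidean_space) chart \<Rightarrow> ('a, 'e) chart \<Rightarrow> 'e \<Rightarrow> 'e \<Rightarrow> 'e" where
  "trans_deriv c c' y = frechet_derivative (transition c c') (at y)"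

definition almost_complex_structure ::
  "('a, 'e::euclidean_space) chart set \<Rightarrow> (('a, 'e) chart \<Rightarrow> 'e \<Rightarrow> 'e \<Rightarrow> 'e) \<Rightarrow> bool" where
  "almost_complex_structure A J \<longleftrightarrow>
     (\<forall>c\<in>A. (\<forall>y\<in>chart_image c. linear (J c y) \<and> (\<forall>v. J c y (J c y v) = - v)) \<and>
        (\<forall>v. smooth_on (\<lambda>y. J c y v) (chart_image c))) \<and>
     (\<forall>c\<in>A. \<forall>c'\<in>A. \<forall>y\<in>overlap c c'. \<forall>v.
        J c' (transition c c' y) (trans_deriv c c' y v) = trans_deriv c c' y (J c y v))"

definition riemannian_metric ::
  "('a, 'e::euclidean_space) chart set \<Rightarrow> (('a, 'e) chart \<Rightarrow> 'e \<Rightarrow> 'e \<Rightarrow> 'e \<Rightarrow> real) \<Rightarrow> bool" where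
  "riemannian_metric A g \<longleftrightarrow>
     (\<forall>c\<in>A. (\<forall>y\<in>chart_image c. bilinear (g c y) \<and> (\<forall>v w. g c y v w = g c y w v) \<and>
           (\<forall>v. v \<noteq> 0 \<longrightarrow> g c y v v > 0)) \<and>
        (\<forall>v w. smooth_on (\<lambda>y. g c y v w) (chart_image c))) \<and>
     (\<forall>c\<in>A. \<forall>c'\<in>A. \<forall>y\<in>overlap c c'. \<forall>v w.
        g c' (transition c c' y) (trans_deriv c c' y v) (trans_deriv c c' y w) = g c y v w)"

definition almost_hermitian_manifold :: "('a, 'e::euclidean_space) almost_hermitian \<Rightarrow> bool" where
  "almost_hermitian_manifold M \<longleftrightarrow>
     smooth_manifold (mtop M) (atlas M) \<and>
     almost_complex_structure (atlas M) (acs M) \<and>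
     riemannian_metric (atlas M) (metric M) \<and>
     (\<forall>c\<in>atlas M. \<forall>y\<in>chart_image c. \<forall>v w.
        metric M c y (acs M c y v) (acs M c y w) = metric M c y v w)"


section \<open>Differential forms and operators\<close>

type_synonym ('a, 'e) form = "('a, 'e) chart \<Rightarrow> 'e \<Rightarrow> 'e alt"

text \<open>Local representations are normalised to be zero where they carry no information, so that
  equality of forms is equality of functions.\<close>

definition on_charts :: "('a, 'e) almost_hermitian \<Rightarrow> ('a, 'e) form \<Rightarrow> ('a, 'e) form" where
  "on_charts M \<alpha> = (\<lambda>c y. if c \<in> atlas M \<and> y \<in> chart_image c then \<alpha> c y else 0)"

text \<open>The space \<open>A\<^sup>k\<close> of smooth complex \<open>k\<close>-forms.\<close>

definition forms :: "('a, 'e::euclidean_space) almost_hermitian \<Rightarrow> nat \<Rightarrow> ('a, 'e) form set" where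
  "forms M k = {\<alpha>. on_charts M \<alpha> = \<alpha> \<and>
     (\<forall>c\<in>atlas M. (\<forall>y\<in>chart_image c. \<alpha> c y \<in> alt_forms_deg k) \<and>
        (\<forall>vs. smooth_on (\<lambda>y. \<alpha> c y vs) (chart_image c))) \<and>
     (\<forall>c\<in>atlas M. \<forall>c'\<in>atlas M. \<forall>y\<in>overlap c c'. \<forall>vs.
        \<alpha> c' (transition c c' y) (map (trans_deriv c c' y) vs) = \<alpha> c y vs)}"

text \<open>In coordinates, for constant \<open>v\<^sub>i\<close>: \<open>d\<alpha>(v\<^sub>0,\<dots>,v\<^sub>k) = \<Sum>\<^sub>i (-1)\<^sup>i v\<^sub>i(\<alpha>(v\<^sub>0,\<dots>,v\<^sub>i\<^sub>-\<^sub>1,v\<^sub>i\<^sub>+\<^sub>1,\<dots>,v\<^sub>k))\<close>.\<close>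

definition ext_d :: "('a, 'e::euclidean_space) almost_hermitian \<Rightarrow> ('a, 'e) form \<Rightarrow> ('a, 'e) form" where
  "ext_d M \<alpha> = on_charts M (\<lambda>c y vs. \<Sum>i<length vs. (-1) ^ i *
     frechet_derivative (\<lambda>z. \<alpha> c z (take i vs @ drop (Suc i) vs)) (at y) (vs ! i))"

definition J_form :: "('a, 'e::euclidean_space) almost_hermitian \<Rightarrow> ('a, 'e) form \<Rightarrow> ('a, 'e) form" where
  "J_form M \<alpha> = on_charts M (\<lambda>c y. alt_J (acs M c y) (\<alpha> c y))"

definition J_form_inv :: "('a, 'e::euclidean_space) almost_hermitian \<Rightarrow> ('a, 'e) form \<Rightarrow> ('a, 'e) form" where
  "J_form_inv M \<alpha> = on_charts M (\<lambda>c y. alt_J_inv (acs M c y) (\<alpha> c y))"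

definition hodge :: "('a, 'e::euclidean_space) almost_hermitian \<Rightarrow> ('a, 'e) form \<Rightarrow> ('a, 'e) form" where
  "hodge M \<alpha> = on_charts M (\<lambda>c y. alt_hodge (metric M c y) (acs M c y) (\<alpha> c y))"

definition d_c :: "('a, 'e::euclidean_space) almost_hermitian \<Rightarrow> ('a, 'e) form \<Rightarrow> ('a, 'e) form" where
  "d_c M = J_form_inv M \<circ> ext_d M \<circ> J_form M"

definition star_adjoint :: "('a, 'e::euclidean_space) almost_hermitian \<Rightarrow>
    (('a, 'e) form \<Rightarrow> ('a, 'e) form) \<Rightarrow> ('a, 'e) form \<Rightarrow> ('a, 'e) form" where
  "star_adjoint M P \<alpha> = - hodge M (P (hodge M \<alpha>))"


section \<open>Spaces of harmonic forms\<close>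

definition harmonic_d_plus_dc ::
  "('a, 'e::euclidean_space) almost_hermitian \<Rightarrow> nat \<Rightarrow> ('a, 'e) form set" where
  "harmonic_d_plus_dc M k = {\<alpha> \<in> forms M k. ext_d M \<alpha> = 0 \<and> d_c M \<alpha> = 0 \<and>
     star_adjoint M (ext_d M \<circ> d_c M) \<alpha> = 0}"

definition harmonic_dc_plus_d ::
  "('a, 'e::euclidean_space) almost_hermitian \<Rightarrow> nat \<Rightarrow> ('a, 'e) form set" where
  "harmonic_dc_plus_d M k = {\<alpha> \<in> forms M k. ext_d M \<alpha> = 0 \<and> d_c M \<alpha> = 0 \<and>
     star_adjoint M (d_c M \<circ> ext_d M) \<alpha> = 0}"

definition harmonic_d_dc ::
  "('a, 'e::euclidean_space) almost_hermitian \<Rightarrow> nat \<Rightarrow> ('a, 'e) form set" where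
  "harmonic_d_dc M k = {\<alpha> \<in> forms M k. star_adjoint M (ext_d M) \<alpha> = 0 \<and>
     star_adjoint M (d_c M) \<alpha> = 0 \<and> ext_d M (d_c M \<alpha>) = 0}"

definition harmonic_dc_d ::
  "('a, 'e::euclidean_space) almost_hermitian \<Rightarrow> nat \<Rightarrow> ('a, 'e) form set" where
  "harmonic_dc_d M k = {\<alpha> \<in> forms M k. star_adjoint M (ext_d M) \<alpha> = 0 \<and>
     star_adjoint M (d_c M) \<alpha> = 0 \<and> d_c M (ext_d M \<alpha>) = 0}"

definition cscale :: "complex \<Rightarrow> ('a, 'e) form \<Rightarrow> ('a, 'e) form" where
  "cscale z \<alpha> = (\<lambda>c y vs. z * \<alpha> c y vs)"

definition complex_subspace :: "('a, 'e) form set \<Rightarrow> bool" where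
  "complex_subspace V \<longleftrightarrow> 0 \<in> V \<and> (\<forall>\<alpha>\<in>V. \<forall>\<beta>\<in>V. \<alpha> + \<beta> \<in> V) \<and> (\<forall>z. \<forall>\<alpha>\<in>V. cscale z \<alpha> \<in> V)"

definition complex_linear_iso ::
  "('a, 'e) form set \<Rightarrow> ('a, 'e) form set \<Rightarrow> (('a, 'e) form \<Rightarrow> ('a, 'e) form) \<Rightarrow> bool" where
  "complex_linear_iso V W f \<longleftrightarrow> complex_subspace V \<and> complex_subspace W \<and> bij_betw f V W \<and>
     (\<forall>\<alpha>\<in>V. \<forall>\<beta>\<in>V. f (\<alpha> + \<beta>) = f \<alpha> + f \<beta>) \<and> (\<forall>z. \<forall>\<alpha>\<in>V. f (cscale z \<alpha>) = cscale z (f \<alpha>))"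

end

theory Submission
  imports Defs
begin

text \<open>On forms, \<open>J\<close> is the pullback \<open>\<alpha>(v\<^sub>1, \<dots>, v\<^sub>k) \<mapsto> \<alpha>(J v\<^sub>1, \<dots>, J v\<^sub>k)\<close>, so \<open>J\<^sup>2 = (-1)\<^sup>k\<close> in degree \<open>k\<close> and
  \<open>J\<^sup>-\<^sup>1 = \<plusminus> J\<close>. Since \<open>J\<close> is an isometry of every tangent space that preserves the orientation, it
  commutes with \<open>*\<close>, and \<open>*\<^sup>2 = (-1)\<^sup>k\<close> because the dimension is even. Up to signs and up to the
  injective operators \<open>J\<close> and \<open>*\<close>, all conditions that define the harmonic spaces say that one of
  \<open>d\<close>, \<open>d J\<close>, \<open>d J d\<close>, \<open>d J d J\<close> annihilates \<open>\<alpha>\<close> or \<open>*\<alpha>\<close>, and \<open>J\<close> and \<open>*\<close> permute these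
  conditions as claimed.\<close>

section \<open>Alternating forms and the wedge product\<close>

text \<open>The operators are given by descriptions: \<open>alt_J\<close>,
  \<open>volume_form\<close> and \<open>alt_hodge\<close> through \<open>THE\<close>, the inner
  product through a basis picked by \<open>SOME\<close>. Existence and uniqueness have to be settled
  before anything can be computed, and this is most of the work. For \<open>alt_J\<close> every form
  must be decomposed into bidegrees. For the Hodge operator the pairing must be shown independent of
  the orthonormal basis: the bases picked at different points need not vary continuously, so
  smoothness of the Hodge dual is visible only after they are exchanged for a smooth Gram-Schmidt
  frame; naturality under isometries rests on the same independence. The volume form is a polynomial
  expression in g and J, which takes care of its smoothness. Injectivity of the Hodge operator is
  needed even above the top degree, because d may be applied to a form of top degree; there all
  forms vanish.\<close>

definition contract :: "'e \<Rightarrow> 'e alt \<Rightarrow> 'e alt" where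
  "contract v \<omega> = (\<lambda>vs. \<omega> (v # vs))"

text \<open>The sign (-1)^k in a form that does not mention k, since elements of
  \<open>alt_forms\<close> may mix degrees. It is the parity automorphism that turns contraction
  into an antiderivation, and later the common value of J^2 and of the square of the Hodge
  operator.\<close>

definition grade :: "'e alt \<Rightarrow> 'e alt" where
  "grade \<omega> = (\<lambda>vs. (-1) ^ length vs * \<omega> vs)"

definition multilin :: "'e::real_vector alt \<Rightarrow> bool" where
  "multilin \<omega> \<longleftrightarrow> (\<forall>us ws. linear (\<lambda>v. \<omega> (us @ v # ws)))"

lemma multilinD: "multilin \<omega> \<Longrightarrow> linear (\<lambda>v. \<omega> (us @ v # ws))"
  by (simp add: multilin_def)

lemma multilin_add: "multilin \<omega> \<Longrightarrow> \<omega> (us @ (v + w) # ws) = \<omega> (us @ v # ws) + \<omega> (us @ w # ws)"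
  using linear_add[OF multilinD] by blast

lemma multilin_scale: "multilin \<omega> \<Longrightarrow> \<omega> (us @ (r *\<^sub>R v) # ws) = of_real r * \<omega> (us @ v # ws)"
  using linear_scale[OF multilinD, of \<omega>] by (simp add: scaleR_conv_of_real)

lemma multilin_sum:
  "multilin \<omega> \<Longrightarrow> \<omega> (us @ (\<Sum>i\<in>A. f i) # ws) = (\<Sum>i\<in>A. \<omega> (us @ f i # ws))"
  using linear_sum[OF multilinD, of \<omega>] by blast

text \<open>Polarisation: the value with v + w in both adjacent slots is zero, and so are the two
  diagonal terms of its expansion.\<close>

lemma alternating_swap:
  assumes "multilin \<omega>" "\<And>us v ws. \<omega> (us @ v # v # ws) = 0"
  shows "\<omega> (us @ v # w # ws) = - \<omega> (us @ w # v # ws)"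
proof -
  have "0 = \<omega> (us @ (v + w) # (v + w) # ws)" using assms(2) by simp
  also have "\<dots> = \<omega> (us @ v # (v + w) # ws) + \<omega> (us @ w # (v + w) # ws)"
    by (rule multilin_add[OF assms(1)])
  also have "\<dots> = \<omega> (us @ v # v # ws) + \<omega> (us @ v # w # ws) + (\<omega> (us @ w # v # ws) + \<omega> (us @ w # w # ws))"
    using multilin_add[OF assms(1), of "us @ [v]" v w ws] multilin_add[OF assms(1), of "us @ [w]" v w ws]
    by simp
  finally show ?thesis using assms(2) by (simp add: eq_neg_iff_add_eq_0)
qed

lemma alternating_move:
  assumes "multilin \<omega>" "\<And>us v ws. \<omega> (us @ v # v # ws) = 0"
  shows "\<omega> (us @ vs @ x # ws) = (-1) ^ length vs * \<omega> (us @ x # vs @ ws)"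
proof (induction vs arbitrary: us)
  case (Cons v vs)
  have "\<omega> (us @ (v # vs) @ x # ws) = (-1) ^ length vs * \<omega> (us @ v # x # vs @ ws)"
    using Cons[of "us @ [v]"] by simp
  then show ?case using alternating_swap[OF assms, of us v x "vs @ ws"] by simp
qed simp

text \<open>Two equal entries can be brought next to each other by \<open>alternating_move\<close>
  at the cost of a sign, so adjacent repetitions are the only ones that need to be checked.\<close>

lemma alt_formsI:
  assumes "multilin \<omega>" "\<And>us v ws. \<omega> (us @ v # v # ws) = 0"
  shows "\<omega> \<in> alt_forms"
proof -
  have "\<omega> vs = 0" if "\<not> distinct vs" for vs
  proof -
    obtain xs y ys zs where vs: "vs = xs @ [y] @ ys @ [y] @ zs"
      using not_distinct_decomp[OF \<open>\<not> distinct vs\<close>] by blast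
    then have "\<omega> vs = (-1) ^ length ys * \<omega> (xs @ y # y # ys @ zs)"
      using alternating_move[OF assms, of "xs @ [y]" ys y zs] by simp
    then show ?thesis using assms(2) by simp
  qed
  then show ?thesis using assms(1) by (simp add: alt_forms_def multilin_def)
qed

lemma alt_forms_multilin: "\<omega> \<in> alt_forms \<Longrightarrow> multilin \<omega>"
  by (simp add: alt_forms_def multilin_def)

lemma alt_forms_not_distinct: "\<omega> \<in> alt_forms \<Longrightarrow> \<not> distinct vs \<Longrightarrow> \<omega> vs = 0"
  by (simp add: alt_forms_def)

lemma alt_forms_adjacent: "\<omega> \<in> alt_forms \<Longrightarrow> \<omega> (us @ v # v # ws) = 0"
  by (rule alt_forms_not_distinct) auto

lemma alt_forms_swap: "\<omega> \<in> alt_forms \<Longrightarrow> \<omega> (us @ v # w # ws) = - \<omega> (us @ w # v # ws)"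
  by (rule alternating_swap) (simp_all add: alt_forms_multilin alt_forms_adjacent)

lemma alt_forms_move:
  "\<omega> \<in> alt_forms \<Longrightarrow> \<omega> (us @ vs @ x # ws) = (-1) ^ length vs * \<omega> (us @ x # vs @ ws)"
  by (rule alternating_move) (simp_all add: alt_forms_multilin alt_forms_adjacent)

text \<open>Each entry of bs passes all of as, which gives the product of the lengths. This sign
  decides the square of the Hodge operator.\<close>

lemma alt_forms_block_swap:
  assumes "\<omega> \<in> alt_forms"
  shows "\<omega> (as @ bs) = (-1) ^ (length as * length bs) * \<omega> (bs @ as)"
proof -
  have "\<omega> (us @ as @ bs) = (-1) ^ (length as * length bs) * \<omega> (us @ bs @ as)" for us
  proof (induction bs arbitrary: us)
    case (Cons b bs)
    have "\<omega> (us @ as @ b # bs) = (-1) ^ length as * \<omega> ((us @ [b]) @ as @ bs)"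
      using alt_forms_move[OF assms, of us as b bs] by simp
    also have "\<dots> = (-1) ^ (length as * length (b # bs)) * \<omega> (us @ (b # bs) @ as)"
      using Cons[of "us @ [b]"] by (simp add: power_add)
    finally show ?case .
  qed simp
  from this[of "[]"] show ?thesis by simp
qed

lemma alt_forms_scale: "\<omega> \<in> alt_forms \<Longrightarrow> (\<lambda>vs. z * \<omega> vs) \<in> alt_forms"
  by (auto simp: alt_forms_def linear_iff algebra_simps)

lemma alt_forms_add: "\<omega> \<in> alt_forms \<Longrightarrow> \<eta> \<in> alt_forms \<Longrightarrow> (\<lambda>vs. \<omega> vs + \<eta> vs) \<in> alt_forms"
  by (auto simp: alt_forms_def linear_iff algebra_simps)

lemma alt_forms_zero: "(\<lambda>vs. 0) \<in> alt_forms"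
  by (auto simp: alt_forms_def linear_iff)

lemma alt_forms_diff: "\<omega> \<in> alt_forms \<Longrightarrow> \<eta> \<in> alt_forms \<Longrightarrow> (\<lambda>vs. \<omega> vs - \<eta> vs) \<in> alt_forms"
  using alt_forms_add[OF _ alt_forms_scale[of \<eta> "-1"]] by simp

lemma alt_forms_sum: "(\<And>i. i \<in> A \<Longrightarrow> \<omega> i \<in> alt_forms) \<Longrightarrow> (\<lambda>vs. \<Sum>i\<in>A. \<omega> i vs) \<in> alt_forms"
  by (induction A rule: infinite_finite_induct) (auto intro!: alt_forms_zero alt_forms_add)

lemma alt_forms_append: "\<omega> \<in> alt_forms \<Longrightarrow> (\<lambda>us. \<omega> (us @ ws)) \<in> alt_forms"
  by (auto simp: alt_forms_def)

lemma multilin_prepend: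
  assumes "multilin \<omega>" shows "multilin (\<lambda>us. \<omega> (ws @ us))"
  using multilinD[OF assms, of "ws @ _"] by (simp add: multilin_def)

lemma alt_forms_prepend: "\<omega> \<in> alt_forms \<Longrightarrow> (\<lambda>us. \<omega> (ws @ us)) \<in> alt_forms"
  by (rule alt_formsI)
    (auto simp: multilin_prepend alt_forms_multilin alt_forms_adjacent simp flip: append_assoc)

lemma contract_multilin: "multilin \<omega> \<Longrightarrow> multilin (contract v \<omega>)"
  using multilin_prepend[of \<omega> "[v]"] by (simp add: contract_def)

lemma contract_alt_forms: "\<omega> \<in> alt_forms \<Longrightarrow> contract v \<omega> \<in> alt_forms"
  using alt_forms_prepend[of \<omega> "[v]"] by (simp add: contract_def)

lemma grade_multilin: "multilin \<omega> \<Longrightarrow> multilin (grade \<omega>)"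
  by (simp add: multilin_def grade_def linear_iff algebra_simps)

lemma grade_alt_forms: "\<omega> \<in> alt_forms \<Longrightarrow> grade \<omega> \<in> alt_forms"
  by (rule alt_formsI) (auto simp: grade_multilin alt_forms_multilin, simp add: grade_def alt_forms_adjacent)

lemma alt_forms_degree_part:
  "\<omega> \<in> alt_forms \<Longrightarrow> (\<lambda>vs. if length vs = n then \<omega> vs else 0) \<in> alt_forms_deg n"
  by (auto simp: alt_forms_deg_def alt_forms_def linear_iff)

lemma alt_forms_pullback:
  assumes "\<omega> \<in> alt_forms" "linear D" shows "(\<lambda>vs. \<omega> (map D vs)) \<in> alt_forms"
proof (rule alt_formsI)
  have "linear (\<lambda>v. \<omega> (map D us @ D v # map D ws))" for us ws
    using linear_compose[OF assms(2) multilinD[OF alt_forms_multilin[OF assms(1)], of "map D us" "map D ws"]]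
    by (simp add: o_def)
  then show "multilin (\<lambda>vs. \<omega> (map D vs))" by (simp add: multilin_def)
qed (simp add: alt_forms_adjacent[OF assms(1)])

section \<open>The wedge product as a recursion on the first argument vector\<close>

lemma sum_Pow_lessThan_Suc:
  "(\<Sum>S\<in>Pow {..<Suc n}. f S) = (\<Sum>T\<in>Pow {..<n}. f (insert 0 (Suc ` T)) + f (Suc ` T))"
  (is "?l = ?r")
proof -
  have "Pow {..<Suc n} = insert 0 ` Pow (Suc ` {..<n}) \<union> Pow (Suc ` {..<n})"
    by (simp add: lessThan_Suc_eq_insert_0 Pow_insert Un_commute)
  moreover have "insert 0 ` Pow (Suc ` {..<n}) \<inter> Pow (Suc ` {..<n}) = {}" by auto
  moreover have "inj_on (insert 0) (Pow (Suc ` {..<n}))"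
    by (auto simp: inj_on_def)
  moreover have "Pow (Suc ` {..<n}) = image Suc ` Pow {..<n}"
    by (rule image_Pow_surj[symmetric]) simp
  moreover have "inj_on (image Suc) (Pow {..<n})"
    by (simp add: inj_on_def inj_image_eq_iff)
  ultimately show ?thesis
    by (simp add: sum.union_disjoint sum.reindex sum.distrib)
qed

lemma nths_insert_0_Suc: "nths (v # vs) (insert 0 (Suc ` T)) = v # nths vs T"
  by (simp add: nths_Cons image_iff)

lemma nths_Suc: "nths (v # vs) (Suc ` T) = nths vs T"
  by (simp add: nths_Cons image_iff)

lemma lessThan_diff_insert_0_Suc: "{..<Suc n} - insert 0 (Suc ` T) = Suc ` ({..<n} - T)"
  by (auto simp: lessThan_Suc_eq_insert_0)

lemma lessThan_diff_Suc: "{..<Suc n} - Suc ` T = insert 0 (Suc ` ({..<n} - T))"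
  by (auto simp: lessThan_Suc_eq_insert_0)

lemma shuffle_sign_insert_0_Suc: 
  "shuffle_sign (Suc n) (insert 0 (Suc ` T)) = shuffle_sign n T"
proof -
  let ?A = "{(i, j). i \<in> T \<and> j \<in> {..<n} - T \<and> j < i}"
  have "{(i, j). i \<in> insert 0 (Suc ` T) \<and> j \<in> {..<Suc n} - insert 0 (Suc ` T) \<and> j < i} = map_prod Suc Suc ` ?A"
    unfolding lessThan_diff_insert_0_Suc by (auto simp: image_iff)
  moreover have "inj_on (map_prod Suc Suc) ?A" by (auto simp: inj_on_def)
  ultimately show ?thesis by (simp add: shuffle_sign_def card_image)
qed

lemma shuffle_sign_Suc:
  assumes "T \<subseteq> {..<n}"
  shows "shuffle_sign (Suc n) (Suc ` T) = (-1) ^ card T * shuffle_sign n T"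
proof -
  let ?A = "{(i, j). i \<in> T \<and> j \<in> {..<n} - T \<and> j < i}"
  have f: "finite T" using assms finite_subset by blast
  have fA: "finite ?A"
    by (rule finite_subset[of _ "T \<times> {..<n}"]) (use f in auto)
  have "{(i, j). i \<in> Suc ` T \<and> j \<in> {..<Suc n} - Suc ` T \<and> j < i}
     = (\<lambda>i. (Suc i, 0)) ` T \<union> map_prod Suc Suc ` ?A"
    unfolding lessThan_diff_Suc by (auto simp: image_iff)
  moreover have "card ((\<lambda>i. (Suc i, 0 :: nat)) ` T \<union> map_prod Suc Suc ` ?A) = card T + card ?A"
    by (subst card_Un_disjoint) (use f fA in \<open>auto simp: card_image inj_on_def\<close>)
  ultimately show ?thesis by (simp add: shuffle_sign_def power_add)
qed

lemma length_nths_lessThan: "T \<subseteq> {..<length vs} \<Longrightarrow> length (nths vs T) = card T"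
  by (auto simp: length_nths intro!: arg_cong[where f = card])

lemma wedge_Nil [simp]: "wedge \<alpha> \<beta> [] = \<alpha> [] * \<beta> []"
  by (simp add: wedge_def shuffle_sign_def)

text \<open>The antiderivation rule for contraction by v, with the sign (-1)^deg \<alpha> expressed
  by \<open>grade\<close>. It replaces sums over shuffles by induction on the argument list in most
  of what follows.\<close>

lemma wedge_Cons:
  "wedge \<alpha> \<beta> (v # vs) = wedge (contract v \<alpha>) \<beta> vs + wedge (grade \<alpha>) (contract v \<beta>) vs"
proof -
  let ?n = "length vs"
  let ?f = "\<lambda>S. shuffle_sign (Suc ?n) S * \<alpha> (nths (v # vs) S) * \<beta> (nths (v # vs) ({..<Suc ?n} - S))"
  have "wedge \<alpha> \<beta> (v # vs) = (\<Sum>T\<in>Pow {..<?n}. ?f (insert 0 (Suc ` T)) + ?f (Suc ` T))"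
    by (simp add: wedge_def sum_Pow_lessThan_Suc)
  also have "\<dots> = (\<Sum>T\<in>Pow {..<?n}.
      shuffle_sign ?n T * contract v \<alpha> (nths vs T) * \<beta> (nths vs ({..<?n} - T)) +
      shuffle_sign ?n T * grade \<alpha> (nths vs T) * contract v \<beta> (nths vs ({..<?n} - T)))"
  proof (rule sum.cong[OF refl])
    fix T assume "T \<in> Pow {..<?n}"
    then have T: "T \<subseteq> {..<?n}" by simp
    show "?f (insert 0 (Suc ` T)) + ?f (Suc ` T) =
      shuffle_sign ?n T * contract v \<alpha> (nths vs T) * \<beta> (nths vs ({..<?n} - T)) +
      shuffle_sign ?n T * grade \<alpha> (nths vs T) * contract v \<beta> (nths vs ({..<?n} - T))"
      unfolding lessThan_diff_insert_0_Suc lessThan_diff_Suc nths_insert_0_Suc nths_Suc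
        shuffle_sign_insert_0_Suc shuffle_sign_Suc[OF T] contract_def grade_def length_nths_lessThan[OF T]
      by simp
  qed
  finally show ?thesis by (simp add: wedge_def sum.distrib)
qed

lemma contract_apply: "contract v \<omega> vs = \<omega> (v # vs)"
  by (simp add: contract_def)

lemma wedge_scale_left: "wedge (\<lambda>us. z * \<alpha> us) \<beta> vs = z * wedge \<alpha> \<beta> vs"
  by (simp add: wedge_def sum_distrib_left mult.assoc mult.left_commute)

lemma wedge_scale_right: "wedge \<alpha> (\<lambda>us. z * \<beta> us) vs = z * wedge \<alpha> \<beta> vs"
  by (simp add: wedge_def sum_distrib_left mult.assoc mult.left_commute)

lemma wedge_add_left: "wedge (\<lambda>us. \<alpha> us + \<alpha>' us) \<beta> vs = wedge \<alpha> \<beta> vs + wedge \<alpha>' \<beta> vs"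
  by (simp add: wedge_def distrib_left distrib_right sum.distrib)

lemma wedge_add_right: "wedge \<alpha> (\<lambda>us. \<beta> us + \<beta>' us) vs = wedge \<alpha> \<beta> vs + wedge \<alpha> \<beta>' vs"
  by (simp add: wedge_def distrib_left sum.distrib)

lemma wedge_minus_left: "wedge (\<lambda>us. - \<alpha> us) \<beta> vs = - wedge \<alpha> \<beta> vs"
  by (simp add: wedge_def sum_negf)

lemma wedge_diff_right: "wedge \<alpha> (\<lambda>us. \<beta> us - \<beta>' us) vs = wedge \<alpha> \<beta> vs - wedge \<alpha> \<beta>' vs"
  by (simp add: wedge_def right_diff_distrib sum_subtractf)

lemma wedge_zero_left [simp]: "wedge (\<lambda>us. 0) \<beta> vs = 0"
  by (simp add: wedge_def)

lemma wedge_zero_right [simp]: "wedge \<alpha> (\<lambda>us. 0) vs = 0"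
  by (simp add: wedge_def)

lemma contract_add: "multilin \<omega> \<Longrightarrow> contract (v + w) \<omega> = (\<lambda>us. contract v \<omega> us + contract w \<omega> us)"
  using multilin_add[of \<omega> "[]"] by (simp add: contract_def)

lemma contract_scaleR: "multilin \<omega> \<Longrightarrow> contract (r *\<^sub>R v) \<omega> = (\<lambda>us. of_real r * contract v \<omega> us)"
  using multilin_scale[of \<omega> "[]"] by (simp add: contract_def)

lemma contract_grade: "contract v (grade \<omega>) = (\<lambda>us. - grade (contract v \<omega>) us)"
  by (simp add: contract_def grade_def)

text \<open>Induction on the entries before the varying slot; \<alpha> and \<beta> are generalised
  because each step contracts or regrades them.\<close>

lemma wedge_multilin:
  assumes "multilin \<alpha>" "multilin \<beta>"
  shows "multilin (wedge \<alpha> \<beta>)"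
proof -
  have "linear (\<lambda>v. wedge \<alpha> \<beta> (us @ v # ws))" for us ws
    using assms
  proof (induction us arbitrary: \<alpha> \<beta>)
    case Nil
    show ?case
      by (rule linearI)
        (simp_all add: wedge_Cons contract_add contract_scaleR Nil wedge_add_left wedge_add_right
          wedge_scale_left wedge_scale_right scaleR_conv_of_real algebra_simps)
  next
    case (Cons u us)
    show ?case
      by (simp add: wedge_Cons)
        (intro linear_compose_add Cons contract_multilin grade_multilin)
  qed
  then show ?thesis by (simp add: multilin_def)
qed

text \<open>Contracting twice by v leaves two mixed terms, in which one v goes into each factor.
  They differ by the sign of \<open>contract_grade\<close> and cancel; the other two contain a
  double contraction of one factor.\<close>

lemma wedge_adjacent:
  assumes "\<alpha> \<in> alt_forms" "\<beta> \<in> alt_forms"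
  shows "wedge \<alpha> \<beta> (us @ v # v # ws) = 0"
  using assms
proof (induction us arbitrary: \<alpha> \<beta>)
  case Nil
  have "contract v (contract v \<omega>) = (\<lambda>us. 0)" if "\<omega> \<in> alt_forms" for \<omega>
    using alt_forms_adjacent[OF that, of "[]"] by (simp add: contract_def)
  then show ?case
    by (simp add: wedge_Cons Nil contract_grade wedge_minus_left)
next
  case (Cons u us)
  show ?case
    by (simp add: wedge_Cons Cons.IH Cons.prems contract_alt_forms grade_alt_forms)
qed

lemma wedge_alt_forms: "\<alpha> \<in> alt_forms \<Longrightarrow> \<beta> \<in> alt_forms \<Longrightarrow> wedge \<alpha> \<beta> \<in> alt_forms"
  by (rule alt_formsI) (simp_all add: wedge_multilin alt_forms_multilin wedge_adjacent)

lemma wedge_pullback: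
  "wedge (\<lambda>us. \<alpha> (map D us)) (\<lambda>us. \<beta> (map D us)) vs = wedge \<alpha> \<beta> (map D vs)"
  by (simp add: wedge_def nths_map)

section \<open>Products with covectors and detection of forms on a spanning list\<close>

lemma grade_unit_form: "grade unit_form = unit_form"
  by (auto simp: grade_def unit_form_def)

lemma contract_unit_form: "contract v unit_form = (\<lambda>us. 0)"
  by (auto simp: contract_def unit_form_def)

lemma unit_form_alt_forms: "unit_form \<in> alt_forms"
  by (rule alt_formsI) (auto simp: multilin_def unit_form_def linear_iff)

lemma wedge_unit_left: "wedge unit_form \<beta> vs = \<beta> vs"
proof (induction vs arbitrary: \<beta>)
  case (Cons v vs)
  then show ?case by (simp add: wedge_Cons grade_unit_form contract_unit_form contract_apply)
qed (simp add: unit_form_def)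

lemma contract_covector: "contract v (covector_form \<xi>) = (\<lambda>us. \<xi> v * unit_form us)"
  by (auto simp: contract_def covector_form_def unit_form_def split: list.split)

lemma grade_covector: "grade (covector_form \<xi>) = (\<lambda>us. - covector_form \<xi> us)"
  by (auto simp: grade_def covector_form_def split: list.split)

lemma wedge_covector_Cons:
  "wedge (covector_form \<xi>) \<beta> (v # vs) = \<xi> v * \<beta> vs - wedge (covector_form \<xi>) (contract v \<beta>) vs"
  by (simp add: wedge_Cons contract_covector grade_covector wedge_scale_left wedge_minus_left wedge_unit_left)

lemma covector_form_Nil [simp]: "covector_form \<xi> [] = 0"
  by (simp add: covector_form_def)

lemma contract_wedge_covector:
  "contract v (wedge (covector_form \<xi>) \<beta>) = (\<lambda>us. \<xi> v * \<beta> us - wedge (covector_form \<xi>) (contract v \<beta>) us)"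
  by (simp add: contract_def wedge_covector_Cons) 

lemma wedge_covector_anticommute:
  "wedge (covector_form \<eta>) (wedge (covector_form \<theta>) \<omega>) vs =
   - wedge (covector_form \<theta>) (wedge (covector_form \<eta>) \<omega>) vs"
proof (induction vs arbitrary: \<omega>)
  case (Cons v vs)
  show ?case
    by (simp add: wedge_covector_Cons contract_wedge_covector wedge_diff_right wedge_scale_right
          Cons[of "contract v \<omega>"])
qed simp

text \<open>Expansion along the first row. The right-hand side has the shape of the formula for
  \<open>ext_d\<close>, which is how the exterior derivative is later recognised as a sum of wedge
  products.\<close>

lemma wedge_covector_sum:
  "wedge (covector_form \<xi>) \<beta> vs =
     (\<Sum>i<length vs. (-1) ^ i * \<xi> (vs ! i) * \<beta> (take i vs @ drop (Suc i) vs))"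
proof (induction vs arbitrary: \<beta>)
  case (Cons v vs)
  then show ?case
    by (simp add: wedge_covector_Cons sum.lessThan_Suc_shift sum_negf contract_apply del: sum.lessThan_Suc)
qed simp

lemma covector_alt_forms: "linear \<xi> \<Longrightarrow> covector_form \<xi> \<in> alt_forms"
proof (rule alt_formsI)
  assume "linear \<xi>"
  have "linear (\<lambda>v. covector_form \<xi> (us @ v # ws))" for us ws
  proof -
    have "covector_form \<xi> (us @ v # ws) = (if us = [] \<and> ws = [] then \<xi> v else 0)" for v
      by (auto simp: covector_form_def split: list.split) (auto simp: append_eq_Cons_conv)
    then show ?thesis
      using \<open>linear \<xi>\<close> by (cases "us = [] \<and> ws = []") (auto simp: linear_iff)
  qed
  then show "multilin (covector_form \<xi>)" by (simp add: multilin_def)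
qed (auto simp: covector_form_def split: list.split)

text \<open>Multilinearity reduces the arguments to entries of es, and alternation sorts them into
  increasing order. The induction on es treats entries equal to x through
  \<open>contract x \<omega>\<close> and the remaining ones through the list xs.\<close>

lemma alt_forms_eq_0I:
  assumes "\<omega> \<in> alt_forms" "\<And>S. S \<subseteq> {..<length es} \<Longrightarrow> \<omega> (nths es S) = 0" "set vs \<subseteq> span (set es)"
  shows "\<omega> vs = 0"
  using assms
proof (induction es arbitrary: \<omega> vs)
  case Nil
  then show ?case
  proof (cases vs)
    case (Cons v us)
    then have "v = 0 *\<^sub>R 0" using Nil(3) by simp
    then show ?thesis 
      using Cons multilin_scale[OF alt_forms_multilin[OF Nil(1)], of "[]" 0 0 us] by simp
  qed (use Nil in force)
next
  case (Cons x xs)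
  have vanish_xs: "\<omega> us = 0" if "set us \<subseteq> span (set xs)" for us
  proof (rule Cons.IH[OF Cons.prems(1) _ that])
    fix S assume "S \<subseteq> {..<length xs}"
    then show "\<omega> (nths xs S) = 0"
      using Cons.prems(2)[of "Suc ` S"] by (auto simp: nths_Suc)
  qed
  have vanish_x: "\<omega> (x # us) = 0" if "set us \<subseteq> span (set xs)" for us
  proof -
    have "contract x \<omega> us = 0"
    proof (rule Cons.IH[OF contract_alt_forms[OF Cons.prems(1)] _ that])
      fix S assume "S \<subseteq> {..<length xs}"
      then show "contract x \<omega> (nths xs S) = 0"
        unfolding contract_apply using Cons.prems(2)[of "insert 0 (Suc ` S)"] by (auto simp: nths_insert_0_Suc)
    qed
    then show ?thesis by (simp add: contract_apply)
  qed
  have split: "\<exists>a w. v = a *\<^sub>R x + w \<and> w \<in> span (set xs)" if "v \<in> span (set (x # xs))" for v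
    using that by (auto simp: span_insert) (metis diff_add_cancel add.commute)
  \<comment> \<open>The arguments in ws have already been reduced to the span of xs. The x-component
    of the next one is moved to the front, where the third premise disposes of it; the rest of it
    joins ws.\<close>
  have *: "\<eta> (ws @ us) = 0"
    if "\<eta> \<in> alt_forms" "\<And>us. set us \<subseteq> span (set xs) \<Longrightarrow> \<eta> us = 0"
      "\<And>us. set us \<subseteq> span (set (x # xs)) \<Longrightarrow> \<eta> (x # us) = 0"
      "set ws \<subseteq> span (set xs)" "set us \<subseteq> span (set (x # xs))" for \<eta> ws us
    using that(4,5)
  proof (induction us arbitrary: ws)
    case (Cons v us)
    obtain a w where v: "v = a *\<^sub>R x + w" "w \<in> span (set xs)" using split[of v] Cons.prems(2) by auto
    have "\<eta> (ws @ v # us) = of_real a * \<eta> (ws @ x # us) + \<eta> ((ws @ [w]) @ us)"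
      by (simp add: v multilin_add multilin_scale alt_forms_multilin that(1))
    moreover have "\<eta> ((ws @ [w]) @ us) = 0"
      by (rule Cons.IH) (use Cons.prems v in auto)
    moreover have "set (ws @ us) \<subseteq> span (set (x # xs))"
      using Cons.prems span_mono[of "set xs" "set (x # xs)"] by auto
    then have "\<eta> (ws @ x # us) = 0"
      using alt_forms_move[OF that(1), of "[]" ws x us] that(3) by simp
    ultimately show ?case by simp
  qed (use that(2) in simp)
  have x: "x \<in> span (set (x # xs))" by (simp add: span_base)
  \<comment> \<open>Two rounds: for the contracted form a further x in front is a repetition and
    gives zero; the result is then the third premise for \<omega> itself.\<close>
  have "contract x \<omega> ([] @ us) = 0" if "set us \<subseteq> span (set (x # xs))" for us
    by (rule *[OF contract_alt_forms[OF Cons.prems(1)]])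
      (use that vanish_x alt_forms_adjacent[OF Cons.prems(1), of "[]"] in \<open>auto simp: contract_apply\<close>)
  then have "\<omega> ([] @ vs) = 0"
    by (intro *[OF Cons.prems(1)]) (use Cons.prems(3) vanish_xs in \<open>simp_all add: contract_apply\<close>)
  then show ?case by simp
qed

lemma alt_forms_eqI:
  assumes "\<omega> \<in> alt_forms" "\<eta> \<in> alt_forms" "span (set es) = UNIV"
    and "\<And>S. S \<subseteq> {..<length es} \<Longrightarrow> \<omega> (nths es S) = \<eta> (nths es S)"
  shows "\<omega> = \<eta>"
proof
  fix vs
  have "\<omega> vs - \<eta> vs = 0"
    using alt_forms_eq_0I[OF alt_forms_diff[OF assms(1,2)], of es vs] assms(3,4) by simp
  then show "\<omega> vs = \<eta> vs" by simp
qed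

section \<open>The action of an almost complex structure on forms\<close>

lemma wedge_covectors_Nil: "wedge_covectors [] = unit_form"
  by (simp add: wedge_covectors_def)

lemma wedge_covectors_Cons:
  "wedge_covectors (\<eta> # \<eta>s) = wedge (covector_form \<eta>) (wedge_covectors \<eta>s)"
  by (simp add: wedge_covectors_def)

text \<open>One eigenvalue z and an arbitrary remaining block \<theta>s, so that the same statement
  serves for the (0,1) factors alone and then for the (1,0) factors in front of them.\<close>

lemma wedge_covectors_eigen:
  assumes "\<And>\<eta>. \<eta> \<in> set \<eta>s \<Longrightarrow> (\<And>v. \<eta> (J v) = z * \<eta> v)"
  shows "wedge_covectors (\<eta>s @ \<theta>s) (map J vs) = z ^ length \<eta>s *
     foldr (\<lambda>\<eta>. wedge (covector_form \<eta>)) \<eta>s (\<lambda>us. wedge_covectors \<theta>s (map J us)) vs"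
  using assms
proof (induction \<eta>s arbitrary: vs)
  case (Cons \<eta> \<eta>s)
  have "covector_form \<eta> (map J us) = z * covector_form \<eta> us" for us
    using Cons.prems[of \<eta>] by (auto simp: covector_form_def split: list.split)
  moreover have "wedge_covectors (\<eta>s @ \<theta>s) (map J us) = z ^ length \<eta>s *
     foldr (\<lambda>\<eta>. wedge (covector_form \<eta>)) \<eta>s (\<lambda>us. wedge_covectors \<theta>s (map J us)) us" for us
    by (rule Cons.IH) (use Cons.prems in auto)
  ultimately show ?case
    by (simp add: wedge_covectors_Cons wedge_scale_left wedge_scale_right flip: wedge_pullback)
qed simp

text \<open>Every (1,0) factor contributes \<i> and every (0,1) factor -\<i>, its inverse. Since the
  left side makes no reference to p and q, this is also the source of uniqueness in
  \<open>alt_J\<close>.\<close>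

lemma pq_forms_pullback:
  assumes "\<alpha> \<in> pq_forms J p q"
  shows "\<alpha> (map J vs) = \<i> powi (int p - int q) * \<alpha> vs"
proof -
  have powi: "\<i> powi (int p - int q) = \<i> ^ p * (- \<i>) ^ q"
    by (simp add: power_int_diff divide_inverse flip: power_inverse)
  from assms show ?thesis
  proof induction
    case (add \<alpha> \<eta>s \<theta>s z)
    have 01: "wedge_covectors \<theta>s (map J us) = (- \<i>) ^ q * wedge_covectors \<theta>s us" for us
      using wedge_covectors_eigen[of \<theta>s J "- \<i>" "[]" us] add
      by (auto simp: covectors01_def wedge_covectors_Nil wedge_covectors_def unit_form_def)
    have scale: "foldr (\<lambda>\<eta>. wedge (covector_form \<eta>)) \<eta>s (\<lambda>us. c * wedge_covectors \<theta>s us) us =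
        c * wedge_covectors (\<eta>s @ \<theta>s) us" for c us
    proof (induction \<eta>s arbitrary: us)
      case (Cons \<eta> \<eta>s)
      then have "foldr (\<lambda>\<eta>. wedge (covector_form \<eta>)) \<eta>s (\<lambda>us. c * wedge_covectors \<theta>s us) =
        (\<lambda>us. c * wedge_covectors (\<eta>s @ \<theta>s) us)" by auto
      then show ?case by (simp add: wedge_covectors_Cons wedge_scale_right)
    qed simp
    have "wedge_covectors (\<eta>s @ \<theta>s) (map J vs) = \<i> ^ p * ((- \<i>) ^ q * wedge_covectors (\<eta>s @ \<theta>s) vs)"
      using wedge_covectors_eigen[of \<eta>s J "\<i>" \<theta>s vs] add
      by (auto simp: covectors10_def 01 scale)
    then show ?case using add.IH by (simp add: powi algebra_simps)
  qed simp
qed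

text \<open>The sum of all bidegrees with p + q at most k. The bound is tracked because
  \<open>alt_J\<close> sums only over p and q up to the dimension.\<close>

inductive_set mixed_forms :: "('e::real_vector \<Rightarrow> 'e) \<Rightarrow> nat \<Rightarrow> 'e alt set" for J k where
  zero: "(\<lambda>vs. 0) \<in> mixed_forms J k"
| add: "\<lbrakk>\<alpha> \<in> mixed_forms J k; set \<eta>s \<subseteq> covectors10 J; set \<theta>s \<subseteq> covectors01 J; length \<eta>s + length \<theta>s \<le> k\<rbrakk>
        \<Longrightarrow> (\<lambda>vs. \<alpha> vs + z * wedge_covectors (\<eta>s @ \<theta>s) vs) \<in> mixed_forms J k"

lemma mixed_forms_mono: "\<alpha> \<in> mixed_forms J k \<Longrightarrow> k \<le> l \<Longrightarrow> \<alpha> \<in> mixed_forms J l"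
  by (induction rule: mixed_forms.induct) (auto intro: mixed_forms.intros)

lemma mixed_forms_add:
  assumes "\<beta> \<in> mixed_forms J k" "\<alpha> \<in> mixed_forms J k"
  shows "(\<lambda>vs. \<alpha> vs + \<beta> vs) \<in> mixed_forms J k"
  using assms
proof induction
  case (add \<beta> \<eta>s \<theta>s z)
  then have "(\<lambda>vs. (\<alpha> vs + \<beta> vs) + z * wedge_covectors (\<eta>s @ \<theta>s) vs) \<in> mixed_forms J k"
    by (intro mixed_forms.add) auto
  then show ?case by (simp add: add.assoc)
qed simp

lemma mixed_forms_wedge10:
  assumes "\<omega> \<in> mixed_forms J k" "\<eta> \<in> covectors10 J"
  shows "wedge (covector_form \<eta>) \<omega> \<in> mixed_forms J (Suc k)"
  using assms
proof induction
  case zero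
  have "wedge (covector_form \<eta>) (\<lambda>vs. 0) = (\<lambda>vs. 0)" by auto
  then show ?case by (simp add: mixed_forms.zero)
next
  case (add \<alpha> \<eta>s \<theta>s z)
  have "wedge (covector_form \<eta>) (\<lambda>vs. \<alpha> vs + z * wedge_covectors (\<eta>s @ \<theta>s) vs) =
    (\<lambda>vs. wedge (covector_form \<eta>) \<alpha> vs + z * wedge_covectors ((\<eta> # \<eta>s) @ \<theta>s) vs)"
    by (auto simp: wedge_add_right wedge_scale_right wedge_covectors_Cons)
  also have "\<dots> \<in> mixed_forms J (Suc k)"
    by (rule mixed_forms.add) (use add in auto)
  finally show ?case .
qed

text \<open>Products in \<open>pq_forms\<close> are in normal order, (1,0) factors first. A new
  (0,1) factor has to pass all of them, and the resulting sign is absorbed into the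
  coefficient.\<close>

lemma wedge_covectors_move:
  "wedge (covector_form \<theta>) (wedge_covectors (\<eta>s @ \<theta>s)) vs =
     (-1) ^ length \<eta>s * wedge_covectors (\<eta>s @ \<theta> # \<theta>s) vs"
proof (induction \<eta>s arbitrary: vs)
  case (Cons \<eta> \<eta>s)
  have "wedge (covector_form \<theta>) (wedge_covectors (\<eta>s @ \<theta>s)) =
    (\<lambda>vs. (-1) ^ length \<eta>s * wedge_covectors (\<eta>s @ \<theta> # \<theta>s) vs)" using Cons by auto
  then show ?case
    by (simp add: wedge_covectors_Cons wedge_covector_anticommute[of \<theta>] wedge_scale_right)
qed (simp add: wedge_covectors_Cons)

lemma mixed_forms_wedge01:
  assumes "\<omega> \<in> mixed_forms J k" "\<theta> \<in> covectors01 J"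
  shows "wedge (covector_form \<theta>) \<omega> \<in> mixed_forms J (Suc k)"
  using assms
proof induction
  case zero
  have "wedge (covector_form \<theta>) (\<lambda>vs. 0) = (\<lambda>vs. 0)" by auto
  then show ?case by (simp add: mixed_forms.zero)
next
  case (add \<alpha> \<eta>s \<theta>s z)
  have "wedge (covector_form \<theta>) (\<lambda>vs. \<alpha> vs + z * wedge_covectors (\<eta>s @ \<theta>s) vs) =
    (\<lambda>vs. wedge (covector_form \<theta>) \<alpha> vs + (z * (-1) ^ length \<eta>s) * wedge_covectors (\<eta>s @ \<theta> # \<theta>s) vs)"
    by (auto simp: wedge_add_right wedge_scale_right wedge_covectors_move)
  also have "\<dots> \<in> mixed_forms J (Suc k)"
    by (rule mixed_forms.add) (use add in auto)
  finally show ?case .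
qed

lemma mixed_forms_wedge:
  assumes "\<omega> \<in> mixed_forms J k" "linear \<xi>" "linear J" "\<And>v. J (J v) = - v"
  shows "wedge (covector_form \<xi>) \<omega> \<in> mixed_forms J (Suc k)"
proof -
  have lin: "linear (\<lambda>v. c * \<xi> v + d * \<xi> (J v))" for c d
    by (rule linearI) (simp_all add: linear_add[OF assms(2)] linear_scale[OF assms(2)]
        linear_add[OF assms(3)] linear_scale[OF assms(3)] distrib_left scaleR_conv_of_real)
  \<comment> \<open>The projections of \<xi> to the eigenspaces of composition with J for the
    eigenvalues \<i> and -\<i>; they add up to \<xi>.\<close>
  define \<eta> where "\<eta> v = 1 / 2 * \<xi> v + - \<i> / 2 * \<xi> (J v)" for v
  define \<theta> where "\<theta> v = 1 / 2 * \<xi> v + \<i> / 2 * \<xi> (J v)" for v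
  have "linear \<eta>" "linear \<theta>" unfolding \<eta>_def \<theta>_def by (rule lin)+
  moreover have "\<eta> (J v) = \<i> * \<eta> v" "\<theta> (J v) = - \<i> * \<theta> v" for v
    by (simp_all add: \<eta>_def \<theta>_def assms(4) linear_neg[OF assms(2)] algebra_simps)
  ultimately have "\<eta> \<in> covectors10 J" "\<theta> \<in> covectors01 J"
    by (simp_all add: covectors10_def covectors01_def)
  then have "(\<lambda>vs. wedge (covector_form \<eta>) \<omega> vs + wedge (covector_form \<theta>) \<omega> vs) \<in> mixed_forms J (Suc k)"
    by (intro mixed_forms_add mixed_forms_wedge10 mixed_forms_wedge01 assms(1))
  moreover have "wedge (covector_form \<xi>) \<omega> = (\<lambda>vs. wedge (covector_form \<eta>) \<omega> vs + wedge (covector_form \<theta>) \<omega> vs)"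
    unfolding wedge_add_left[symmetric]
    by (rule arg_cong[of _ _ "\<lambda>\<alpha>. wedge \<alpha> \<omega>"])
      (auto simp: covector_form_def \<eta>_def \<theta>_def field_simps split: list.split)
  ultimately show ?thesis by simp
qed

text \<open>The basis covectors are split off one after the other: if \<open>\<xi> x = 1\<close>, then \<open>\<iota>\<^sub>x\<close> annihilates
  \<open>\<omega> - \<xi> \<and> \<iota>\<^sub>x \<omega>\<close>.\<close>

lemma alt_forms_mixed:
  fixes \<omega> :: "'e::euclidean_space alt"
  assumes "linear J" "\<And>v. J (J v) = - v" "X \<subseteq> Basis"
    and "\<omega> \<in> alt_forms" "\<And>e. e \<in> Basis - X \<Longrightarrow> contract e \<omega> = (\<lambda>vs. 0)"
  shows "\<omega> \<in> mixed_forms J (card X)"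
proof -
  have "finite X" using finite_subset[OF assms(3)] by simp
  then show ?thesis using assms(3-5)
  proof (induction X arbitrary: \<omega>)
    \<comment> \<open>Every basis vector annihilates \<omega>, so only the value at the empty list
      survives and \<omega> is a multiple of \<open>unit_form\<close>.\<close>
    case empty
    have "\<omega> (v # us) = 0" for v us
    proof -
      have "\<omega> (v # us) = \<omega> ([] @ (\<Sum>e\<in>Basis. (v \<bullet> e) *\<^sub>R e) # us)"
        by (simp add: euclidean_representation)
      also have "\<dots> = (\<Sum>e\<in>Basis. \<omega> ([] @ (v \<bullet> e) *\<^sub>R e # us))"
        by (rule multilin_sum[OF alt_forms_multilin[OF empty(2)]])
      also have "\<dots> = (\<Sum>e\<in>Basis. of_real (v \<bullet> e) * contract e \<omega> us)"
        using multilin_scale[OF alt_forms_multilin[OF empty(2)], of "[]"] by (simp add: contract_apply)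
      also have "\<dots> = 0" using empty(3) by simp
      finally show ?thesis .
    qed
    then have "\<omega> vs = 0 + \<omega> [] * wedge_covectors ([] @ []) vs" for vs
      by (cases vs) (auto simp: wedge_covectors_Nil unit_form_def)
    then have eq: "(\<lambda>vs. 0 + \<omega> [] * wedge_covectors ([] @ []) vs) = \<omega>" by (rule ext[OF sym])
    have "(\<lambda>vs. 0 + \<omega> [] * wedge_covectors ([] @ []) vs) \<in> mixed_forms J (card {})"
      by (rule mixed_forms.add[OF mixed_forms.zero]) auto
    then show ?case by (simp only: eq)
  next
    case (insert x X)
    define \<xi> where "\<xi> v = complex_of_real (v \<bullet> x)" for v :: 'e
    have \<xi>: "linear \<xi>" by (auto simp: \<xi>_def linear_iff inner_left_distrib scaleR_conv_of_real)
    have \<xi>_Basis: "\<xi> e = (if e = x then 1 else 0)" if "e \<in> Basis" for e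
      using that insert.prems by (auto simp: \<xi>_def inner_Basis)
    define \<omega>' where "\<omega>' vs = \<omega> vs - wedge (covector_form \<xi>) (contract x \<omega>) vs" for vs
    have alt_x: "contract x \<omega> \<in> alt_forms" by (rule contract_alt_forms[OF insert.prems(2)])
    have alt': "\<omega>' \<in> alt_forms"
      unfolding \<omega>'_def by (intro alt_forms_diff insert.prems wedge_alt_forms covector_alt_forms \<xi> alt_x)
    have swap: "contract e (contract f \<omega>) vs = - contract f (contract e \<omega>) vs" for e f vs
      using alt_forms_swap[OF insert.prems(2), of "[]" f e vs] by (simp add: contract_apply)
    have xx: "contract x (contract x \<omega>) = (\<lambda>vs. 0)"
      using alt_forms_adjacent[OF insert.prems(2), of "[]"] by (simp add: contract_def)
    have 1: "contract e (contract x \<omega>) = (\<lambda>vs. 0)" if "e \<in> Basis - X" for e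
    proof (cases "e = x")
      case False
      then have "contract e \<omega> = (\<lambda>vs. 0)" using that insert.prems(3) by auto
      then show ?thesis using swap[of e x] by (auto simp: contract_def)
    qed (use xx in simp)
    have 2: "contract e \<omega>' = (\<lambda>vs. 0)" if "e \<in> Basis - X" for e
    proof -
      have "contract e \<omega>' vs = contract e \<omega> vs - \<xi> e * contract x \<omega> vs" for vs
        unfolding contract_apply[of e \<omega>'] \<omega>'_def wedge_covector_Cons 1[OF that] by (simp add: contract_apply)
      then show ?thesis
        using that insert.prems(3) \<xi>_Basis[of e] by (cases "e = x") auto
    qed
    have "(\<lambda>vs. \<omega>' vs + wedge (covector_form \<xi>) (contract x \<omega>) vs) \<in> mixed_forms J (Suc (card X))"
    proof (intro mixed_forms_add mixed_forms_wedge assms(1,2) \<xi>)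
      show "contract x \<omega> \<in> mixed_forms J (card X)"
        by (rule insert.IH[OF _ alt_x 1]) (use insert.prems(1) in auto)
      show "\<omega>' \<in> mixed_forms J (Suc (card X))"
        by (rule mixed_forms_mono[OF insert.IH[OF _ alt' 2]]) (use insert.prems(1) in auto)
    qed
    then show ?case using insert.hyps by (simp add: \<omega>'_def)
  qed
qed

lemma mixed_forms_decomposition:
  assumes "\<omega> \<in> mixed_forms J k" "k \<le> N"
  shows "\<exists>a. (\<forall>p q. a p q \<in> pq_forms J p q) \<and> \<omega> = (\<lambda>vs. \<Sum>p\<le>N. \<Sum>q\<le>N. a p q vs)"
  using assms
proof induction
  case zero
  then show ?case by (intro exI[of _ "\<lambda>p q. 0"]) (use pq_forms.zero in \<open>auto simp: zero_fun_def\<close>)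
next
  case (add \<alpha> \<eta>s \<theta>s z)
  then obtain a where a: "\<And>p q. a p q \<in> pq_forms J p q" "\<alpha> = (\<lambda>vs. \<Sum>p\<le>N. \<Sum>q\<le>N. a p q vs)" by blast
  define W where "W vs = z * wedge_covectors (\<eta>s @ \<theta>s) vs" for vs
  \<comment> \<open>The new product is added to the one component whose bidegree is given by its
    numbers of factors; both are at most N, so it occurs in the sum.\<close>
  define b where "b p q = (\<lambda>vs. a p q vs + (if q = length \<theta>s then if p = length \<eta>s then W vs else 0 else 0))" for p q
  have "b p q \<in> pq_forms J p q" for p q
  proof (cases "q = length \<theta>s \<and> p = length \<eta>s")
    case True
    then have "(\<lambda>vs. a p q vs + z * wedge_covectors (\<eta>s @ \<theta>s) vs) \<in> pq_forms J p q"
      by (intro pq_forms.add[OF a(1)]) (use add.hyps in auto)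
    then show ?thesis using True by (simp add: b_def W_def)
  next
    case False
    then have "b p q = a p q" by (auto simp: b_def)
    then show ?thesis using a(1) by simp
  qed
  moreover have "(\<Sum>p\<le>N. \<Sum>q\<le>N. b p q vs) = \<alpha> vs + W vs" for vs
    using add.hyps add.prems by (simp add: b_def sum.distrib a(2))
  ultimately show ?case unfolding W_def by (intro exI[of _ b]) auto
qed

text \<open>A decomposition exists by \<open>alt_forms_mixed\<close>, and for every decomposition
  the weighted sum is the pullback by \<open>pq_forms_pullback\<close>. Directness of the sum of the
  bidegrees never has to be stated.\<close>

lemma alt_J_eq:
  fixes \<omega> :: "'e::euclidean_space alt"
  assumes "linear J" "\<And>v. J (J v) = - v" "\<omega> \<in> alt_forms"
  shows "alt_J J \<omega> = (\<lambda>vs. \<omega> (map J vs))"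
  unfolding alt_J_def
proof (rule the_equality)
  have "\<omega> \<in> mixed_forms J DIM('e)"
    by (rule alt_forms_mixed) (use assms in auto)
  then obtain a where a: "\<And>p q. a p q \<in> pq_forms J p q"
      "\<omega> = (\<lambda>vs. \<Sum>p\<le>DIM('e). \<Sum>q\<le>DIM('e). a p q vs)"
    using mixed_forms_decomposition by blast
  show "\<exists>a. (\<forall>p q. a p q \<in> pq_forms J p q) \<and> \<omega> = (\<lambda>vs. \<Sum>p\<le>DIM('e). \<Sum>q\<le>DIM('e). a p q vs) \<and>
      (\<lambda>vs. \<omega> (map J vs)) = (\<lambda>vs. \<Sum>p\<le>DIM('e). \<Sum>q\<le>DIM('e). \<i> powi (int p - int q) * a p q vs)"
    by (intro exI[of _ a] conjI allI a(1) a(2)) (simp only: a(2) pq_forms_pullback[OF a(1)])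
next
  fix \<omega>'
  assume "\<exists>a. (\<forall>p q. a p q \<in> pq_forms J p q) \<and> \<omega> = (\<lambda>vs. \<Sum>p\<le>DIM('e). \<Sum>q\<le>DIM('e). a p q vs) \<and>
      \<omega>' = (\<lambda>vs. \<Sum>p\<le>DIM('e). \<Sum>q\<le>DIM('e). \<i> powi (int p - int q) * a p q vs)"
  then obtain a where a: "\<And>p q. a p q \<in> pq_forms J p q"
      "\<omega> = (\<lambda>vs. \<Sum>p\<le>DIM('e). \<Sum>q\<le>DIM('e). a p q vs)"
      "\<omega>' = (\<lambda>vs. \<Sum>p\<le>DIM('e). \<Sum>q\<le>DIM('e). \<i> powi (int p - int q) * a p q vs)"
    by blast
  show "\<omega>' = (\<lambda>vs. \<omega> (map J vs))"
    by (simp only: a(2,3) pq_forms_pullback[OF a(1)])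
qed

lemma alt_J_alt_forms:
  fixes \<omega> :: "'e::euclidean_space alt"
  assumes "linear J" "\<And>v. J (J v) = - v" "\<omega> \<in> alt_forms"
  shows "alt_J J \<omega> \<in> alt_forms"
  by (simp add: alt_J_eq assms alt_forms_pullback)

lemma multilin_minus:
  assumes "multilin \<omega>" shows "\<omega> (map uminus vs) = (-1) ^ length vs * \<omega> vs"
proof -
  have "\<omega> (us @ map uminus vs) = (-1) ^ length vs * \<omega> (us @ vs)" for us
  proof (induction vs arbitrary: us)
    case (Cons v vs)
    show ?case using multilin_scale[OF assms, of us "-1" v] Cons[of "us @ [v]"] by simp
  qed simp
  from this[of "[]"] show ?thesis by simp
qed

lemma alt_J_alt_J:
  fixes \<omega> :: "'e::euclidean_space alt"
  assumes "linear J" "\<And>v. J (J v) = - v" "\<omega> \<in> alt_forms"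
  shows "alt_J J (alt_J J \<omega>) = grade \<omega>"
proof
  fix vs
  have "J \<circ> J = uminus" using assms(2) by auto
  then show "alt_J J (alt_J J \<omega>) vs = grade \<omega> vs"
    by (simp add: alt_J_eq[OF assms(1,2)] assms(3) alt_forms_pullback assms(1) grade_def
      multilin_minus alt_forms_multilin)
qed

lemma alt_J_grade:
  fixes \<omega> :: "'e::euclidean_space alt"
  assumes "linear J" "\<And>v. J (J v) = - v" "\<omega> \<in> alt_forms"
  shows "alt_J J (grade \<omega>) = grade (alt_J J \<omega>)"
  unfolding alt_J_eq[OF assms] alt_J_eq[OF assms(1,2) grade_alt_forms[OF assms(3)]]
  by (simp add: grade_def)

text \<open>J^2 = \<open>grade\<close> and \<open>grade\<close> is an involution commuting with J,
  so the right side is a two-sided inverse on \<open>alt_forms\<close>, where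
  \<open>inv_into\<close> takes its values.\<close>

lemma alt_J_inv_eq:
  fixes \<omega> :: "'e::euclidean_space alt"
  assumes "linear J" "\<And>v. J (J v) = - v" "\<omega> \<in> alt_forms"
  shows "alt_J_inv J \<omega> = grade (alt_J J \<omega>)"
proof -
  note J = alt_J_eq[OF assms(1,2)] alt_J_alt_J[OF assms(1,2)] alt_J_alt_forms[OF assms(1,2)]
  have gg: "grade (grade \<eta>) = \<eta>" for \<eta> :: "'e alt"
    by (simp add: grade_def flip: mult.assoc power_add)
  have "inj_on (alt_J J) alt_forms"
    by (rule inj_on_inverseI[of _ "\<lambda>\<eta>. grade (alt_J J \<eta>)"]) (simp add: J(2) gg)
  moreover have "alt_J J (grade (alt_J J \<omega>)) = \<omega>"
  proof -
    have "alt_J J (grade (alt_J J \<omega>)) = grade (alt_J J (alt_J J \<omega>))"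
      using J(3)[OF assms(3)] by (rule alt_J_grade[OF assms(1,2)])
    then show ?thesis by (simp add: J(2) assms(3) gg)
  qed
  ultimately show ?thesis
    unfolding alt_J_inv_def
    by (metis inv_into_f_f grade_alt_forms J(3) assms(3))
qed

section \<open>Orthonormal bases and the pairing of forms\<close>

text \<open>The sum in \<open>alt_inner\<close> with the list as a parameter, so that different
  bases can be compared and induction on the list is possible.\<close>

definition alt_pairing :: "'e list \<Rightarrow> 'e alt \<Rightarrow> 'e alt \<Rightarrow> complex" where
  "alt_pairing es \<alpha> \<beta> = (\<Sum>S\<in>Pow {..<length es}. \<alpha> (nths es S) * \<beta> (nths es S))"

lemma alt_pairing_Nil: "alt_pairing [] \<alpha> \<beta> = \<alpha> [] * \<beta> []"
  by (simp add: alt_pairing_def)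

lemma alt_pairing_Cons:
  "alt_pairing (x # xs) \<alpha> \<beta> = alt_pairing xs (contract x \<alpha>) (contract x \<beta>) + alt_pairing xs \<alpha> \<beta>"
  by (simp add: alt_pairing_def sum_Pow_lessThan_Suc nths_insert_0_Suc nths_Suc contract_apply sum.distrib)

lemma alt_pairing_add_right:
  "alt_pairing es \<alpha> (\<lambda>vs. \<beta> vs + \<beta>' vs) = alt_pairing es \<alpha> \<beta> + alt_pairing es \<alpha> \<beta>'"
  by (simp add: alt_pairing_def distrib_left sum.distrib)

lemma alt_pairing_add_left:
  "alt_pairing es (\<lambda>vs. \<beta> vs + \<beta>' vs) \<alpha> = alt_pairing es \<beta> \<alpha> + alt_pairing es \<beta>' \<alpha>"
  by (simp add: alt_pairing_def distrib_right sum.distrib)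

lemma alt_pairing_scale_right: "alt_pairing es \<alpha> (\<lambda>vs. z * \<beta> vs) = z * alt_pairing es \<alpha> \<beta>"
  by (simp add: alt_pairing_def sum_distrib_left algebra_simps)

lemma alt_pairing_scale_left: "alt_pairing es (\<lambda>vs. z * \<alpha> vs) \<beta> = z * alt_pairing es \<alpha> \<beta>"
  by (simp add: alt_pairing_def sum_distrib_left algebra_simps)

lemma alt_pairing_zero_left [simp]: "alt_pairing es (\<lambda>vs. 0) \<beta> = 0"
  by (simp add: alt_pairing_def)

lemma alt_pairing_zero_right [simp]: "alt_pairing es \<alpha> (\<lambda>vs. 0) = 0"
  by (simp add: alt_pairing_def)

lemma contract_swap_pairing:
  assumes "\<alpha> \<in> alt_forms" "\<beta> \<in> alt_forms"
  shows "alt_pairing es (contract x (contract y \<alpha>)) (contract x (contract y \<beta>)) =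
    alt_pairing es (contract y (contract x \<alpha>)) (contract y (contract x \<beta>))"
  unfolding alt_pairing_def contract_apply
  using alt_forms_swap[OF assms(1), of "[]" y x] alt_forms_swap[OF assms(2), of "[]" y x]
  by (intro sum.cong) simp_all

text \<open>Degree-free form of \<open>k \<langle>\<alpha>, \<beta>\<rangle> = \<Sum>\<^sub>e \<langle>\<iota>\<^sub>e \<alpha>, \<iota>\<^sub>e \<beta>\<rangle>\<close>, which reduces the independence of the pairing
  from the orthonormal basis to that of a trace.\<close>

lemma alt_pairing_contract:
  assumes "\<alpha> \<in> alt_forms" "\<beta> \<in> alt_forms"
  shows "alt_pairing es \<alpha> (\<lambda>vs. of_nat (length vs) * \<beta> vs) =
    (\<Sum>e\<leftarrow>es. alt_pairing es (contract e \<alpha>) (contract e \<beta>))"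
  using assms
proof (induction es arbitrary: \<alpha> \<beta>)
  case (Cons x xs)
  have xx: "contract x (contract x \<omega>) = (\<lambda>vs. 0)" if "\<omega> \<in> alt_forms" for \<omega>
    using alt_forms_adjacent[OF that, of "[]"] by (simp add: contract_def)
  have "contract x (\<lambda>vs. of_nat (length vs) * \<beta> vs) =
    (\<lambda>vs. of_nat (length vs) * contract x \<beta> vs + contract x \<beta> vs)"
    by (simp add: contract_def algebra_simps)
  then have "alt_pairing (x # xs) \<alpha> (\<lambda>vs. of_nat (length vs) * \<beta> vs) =
    (\<Sum>e\<leftarrow>xs. alt_pairing xs (contract e (contract x \<alpha>)) (contract e (contract x \<beta>))) +
    alt_pairing xs (contract x \<alpha>) (contract x \<beta>) +
    (\<Sum>e\<leftarrow>xs. alt_pairing xs (contract e \<alpha>) (contract e \<beta>))"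
    by (simp only: alt_pairing_Cons alt_pairing_add_right Cons.IH Cons.prems contract_alt_forms)
  also have "\<dots> = (\<Sum>e\<leftarrow>x # xs. alt_pairing (x # xs) (contract e \<alpha>) (contract e \<beta>))"
    by (simp add: alt_pairing_Cons xx Cons.prems sum_list_addf contract_swap_pairing[of \<alpha> \<beta> xs x])
  finally show ?case .
qed (simp add: alt_pairing_Nil)

lemma contract_alt_forms_deg: "\<omega> \<in> alt_forms_deg (Suc k) \<Longrightarrow> contract v \<omega> \<in> alt_forms_deg k"
  by (simp add: alt_forms_deg_def contract_alt_forms) (simp add: contract_def)

lemma alt_forms_deg_alt: "\<omega> \<in> alt_forms_deg k \<Longrightarrow> \<omega> \<in> alt_forms"
  by (simp add: alt_forms_deg_def)

lemma alt_forms_deg_degree: "\<omega> \<in> alt_forms_deg k \<Longrightarrow> length vs \<noteq> k \<Longrightarrow> \<omega> vs = 0"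
  by (simp add: alt_forms_deg_def)

lemma alt_pairing_deg_0:
  "\<beta> \<in> alt_forms_deg 0 \<Longrightarrow> alt_pairing es \<alpha> \<beta> = \<alpha> [] * \<beta> []"
proof (induction es arbitrary: \<alpha>)
  case (Cons x xs)
  have "contract x \<beta> = (\<lambda>vs. 0)" using Cons.prems by (auto simp: contract_def alt_forms_deg_def)
  then show ?case using Cons by (simp add: alt_pairing_Cons)
qed (simp add: alt_pairing_Nil)

text \<open>Free of any length condition, for the partial lists that occur in Gram-Schmidt.\<close>

definition orthonormal_list :: "('e \<Rightarrow> 'e \<Rightarrow> real) \<Rightarrow> 'e list \<Rightarrow> bool" where
  "orthonormal_list g es \<longleftrightarrow> distinct es \<and> (\<forall>x\<in>set es. \<forall>y\<in>set es. g x y = (if x = y then 1 else 0))"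

lemma orthonormal_basis_iff:
  fixes es :: "'e::euclidean_space list"
  shows "orthonormal_basis g es \<longleftrightarrow> length es = DIM('e) \<and> orthonormal_list g es"
proof -
  have "orthonormal_list g es" if *: "\<forall>i<length es. \<forall>j<length es. g (es ! i) (es ! j) = (if i = j then 1 else 0)"
  proof -
    have "distinct es" unfolding distinct_conv_nth
    proof (intro allI impI)
      fix i j assume "i < length es" "j < length es" "i \<noteq> j"
      then show "es ! i \<noteq> es ! j" using *[rule_format, of i i] *[rule_format, of i j] by auto
    qed
    then show ?thesis
      using * by (auto simp: orthonormal_list_def in_set_conv_nth nth_eq_iff_index_eq)
  qed
  moreover have "g (es ! i) (es ! j) = (if i = j then 1 else 0)"
    if "orthonormal_list g es" "i < length es" "j < length es" for i j
    using that by (simp add: orthonormal_list_def nth_eq_iff_index_eq)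
  ultimately show ?thesis unfolding orthonormal_basis_def by blast
qed

section \<open>Orthonormal expansion, traces and independence of the basis\<close>

locale inner_product =
  fixes g :: "'e::euclidean_space \<Rightarrow> 'e \<Rightarrow> real"
  assumes bilinear: "bilinear g"
    and sym: "g v w = g w v"
    and pos: "v \<noteq> 0 \<Longrightarrow> g v v > 0"
begin

lemma g_lin: "g (u + v) w = g u w + g v w" "g w (u + v) = g w u + g w v"
  "g (u - v) w = g u w - g v w" "g w (u - v) = g w u - g w v"
  "g (r *\<^sub>R u) w = r * g u w" "g w (r *\<^sub>R u) = r * g w u" "g 0 w = 0" "g w 0 = 0"
  "g (- u) w = - g u w" "g w (- u) = - g w u"
  using bilinear bilinear_ladd[of g] bilinear_radd[of g] bilinear_lmul[of g] bilinear_rmul[of g]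
    bilinear_lsub[of g] bilinear_rsub[of g] bilinear_lzero[of g] bilinear_rzero[of g]
    bilinear_lneg[of g] bilinear_rneg[of g] by auto

lemma g_sum: "g (\<Sum>i\<in>A. f i) w = (\<Sum>i\<in>A. g (f i) w)"
  by (induction A rule: infinite_finite_induct) (auto simp: g_lin)

lemma orthogonal_remainder:
  assumes "orthonormal_list g es" "e \<in> set es"
  shows "g (v - (\<Sum>f\<in>set es. g v f *\<^sub>R f)) e = 0"
proof -
  have "(\<Sum>f\<in>set es. g v f * g f e) = (\<Sum>f\<in>set es. if f = e then g v f else 0)"
    using assms by (intro sum.cong) (auto simp: orthonormal_list_def)
  then show ?thesis using assms(2) by (simp add: g_lin g_sum)
qed

text \<open>The remainder lies in the span and is orthogonal to it, hence orthogonal to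
  itself.\<close>

lemma remainder_eq_0:
  assumes "orthonormal_list g es" "v \<in> span (set es)"
  shows "v - (\<Sum>f\<in>set es. g v f *\<^sub>R f) = 0"
proof -
  define u where "u = v - (\<Sum>f\<in>set es. g v f *\<^sub>R f)"
  have "u \<in> span (set es)"
    unfolding u_def by (intro span_diff assms(2) span_sum span_scale span_base)
  moreover have "g u w = 0" if "w \<in> span (set es)" for w
    using that
  proof (induction rule: span_induct_alt)
    case (step c x y)
    then show ?case using orthogonal_remainder[OF assms(1), of x v] by (simp add: g_lin u_def)
  qed (simp add: g_lin)
  ultimately have "g u u = 0" by simp
  then show ?thesis using pos[of u] unfolding u_def by force
qed

lemma short_span_neq_UNIV:
  fixes es :: "'e list"
  assumes "length es < DIM('e)"
  shows "span (set es) \<noteq> UNIV"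
proof
  assume "span (set es) = (UNIV :: 'e set)"
  then have "DIM('e) \<le> card (set es)" using dim_le_card[of UNIV "set es"] by (simp add: dim_UNIV)
  then show False using assms card_length[of es] by simp
qed

lemma orthonormal_basis_span:
  assumes "orthonormal_basis g es"
  shows "span (set es) = UNIV"
proof -
  have on: "orthonormal_list g es" and len: "length es = DIM('e)"
    using assms by (auto simp: orthonormal_basis_iff)
  have "independent (set es)"
  proof (rule independent_if_scalars_zero)
    fix f x assume 0: "(\<Sum>x\<in>set es. f x *\<^sub>R x) = 0" and x: "x \<in> set es"
    have "0 = g (\<Sum>x\<in>set es. f x *\<^sub>R x) x" by (simp add: 0 g_lin)
    also have "\<dots> = (\<Sum>y\<in>set es. if y = x then f y else 0)"
      unfolding g_sum using on x by (intro sum.cong) (auto simp: orthonormal_list_def g_lin)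
    finally show "f x = 0" using x by simp
  qed simp
  moreover have "card (set es) = DIM('e)" using on len by (simp add: orthonormal_list_def distinct_card)
  ultimately show ?thesis using card_ge_dim_independent[of "set es" UNIV] by (auto simp: dim_UNIV)
qed

lemma orthonormal_expand:
  assumes "orthonormal_basis g es"
  shows "(\<Sum>f\<in>set es. g v f *\<^sub>R f) = v"
  using remainder_eq_0[of es v] orthonormal_basis_span[OF assms] assms
  by (simp add: orthonormal_basis_iff)

text \<open>Expand e in the basis fs in the first slot, exchange the sums, and use the symmetry of g
  to read the sum over es as the expansion of f in the second slot.\<close>

lemma trace_independent:
  fixes B :: "'e \<Rightarrow> 'e \<Rightarrow> complex"
  assumes "orthonormal_basis g es" "orthonormal_basis g fs"
    and "\<And>v. linear (\<lambda>u. B u v)" "\<And>u. linear (B u)"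
  shows "(\<Sum>e\<in>set es. B e e) = (\<Sum>f\<in>set fs. B f f)"
proof -
  have "(\<Sum>e\<in>set es. B e e) = (\<Sum>e\<in>set es. B (\<Sum>f\<in>set fs. g e f *\<^sub>R f) e)"
    by (simp add: orthonormal_expand assms)
  also have "\<dots> = (\<Sum>e\<in>set es. \<Sum>f\<in>set fs. g e f *\<^sub>R B f e)"
    by (simp add: linear_sum[OF assms(3)] linear_scale[OF assms(3)])
  also have "\<dots> = (\<Sum>f\<in>set fs. \<Sum>e\<in>set es. g f e *\<^sub>R B f e)"
    by (subst sum.swap) (simp add: sym)
  also have "\<dots> = (\<Sum>f\<in>set fs. B f (\<Sum>e\<in>set es. g f e *\<^sub>R e))"
    by (simp add: linear_sum[OF assms(4)] linear_scale[OF assms(4)])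
  finally show ?thesis by (simp add: orthonormal_expand assms)
qed

text \<open>Induction on the degree: by \<open>alt_pairing_contract\<close> the pairing times k + 1
  is the trace of the bilinear map that pairs the contraction of \<alpha> by u with that of \<beta>
  by v. The trace does not depend on the basis, and the pairings inside it are covered by the
  induction hypothesis.\<close>

lemma alt_pairing_independent:
  assumes "orthonormal_basis g es" "orthonormal_basis g fs" "\<alpha> \<in> alt_forms" "\<beta> \<in> alt_forms_deg k"
  shows "alt_pairing es \<alpha> \<beta> = alt_pairing fs \<alpha> \<beta>"
  using assms(3,4)
proof (induction k arbitrary: \<alpha> \<beta>)
  case (Suc k)
  have \<beta>: "\<beta> \<in> alt_forms" using Suc.prems by (simp add: alt_forms_deg_def)
  \<comment> \<open>Homogeneity of \<beta> turns the length into a nonzero constant that can be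
    cancelled at the end.\<close>
  have deg: "(\<lambda>vs. of_nat (length vs) * \<beta> vs) = (\<lambda>vs. of_nat (Suc k) * \<beta> vs)"
  proof
    fix vs show "of_nat (length vs) * \<beta> vs = of_nat (Suc k) * \<beta> vs"
      using alt_forms_deg_degree[OF Suc.prems(2), of vs] by (cases "length vs = Suc k") auto
  qed
  have pairing: "of_nat (Suc k) * alt_pairing bs \<alpha> \<beta> = (\<Sum>e\<in>set bs. alt_pairing bs (contract e \<alpha>) (contract e \<beta>))"
    if "orthonormal_basis g bs" for bs
  proof -
    have "distinct bs" using that by (simp add: orthonormal_basis_iff orthonormal_list_def)
    then show ?thesis
      using alt_pairing_contract[OF Suc.prems(1) \<beta>, of bs] unfolding deg alt_pairing_scale_right
      by (simp add: sum_list_distinct_conv_sum_set)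
  qed
  let ?B = "\<lambda>u v. alt_pairing fs (contract u \<alpha>) (contract v \<beta>)"
  have "linear (\<lambda>u. ?B u v)" "linear (?B u)" for u v
    using \<beta> Suc.prems(1)
    by (auto intro!: linearI simp: contract_add contract_scaleR alt_forms_multilin alt_pairing_add_left
      alt_pairing_add_right alt_pairing_scale_left alt_pairing_scale_right scaleR_conv_of_real)
  then have "(\<Sum>e\<in>set es. ?B e e) = (\<Sum>f\<in>set fs. ?B f f)"
    by (intro trace_independent assms)
  moreover have "alt_pairing es (contract e \<alpha>) (contract e \<beta>) = ?B e e" for e
    by (intro Suc.IH contract_alt_forms contract_alt_forms_deg Suc.prems)
  ultimately have "of_nat (Suc k) * alt_pairing es \<alpha> \<beta> = of_nat (Suc k) * alt_pairing fs \<alpha> \<beta>"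
    using pairing assms(1,2) by simp
  then show ?case by (simp del: of_nat_Suc)
qed (simp add: alt_pairing_deg_0)

end

section \<open>The Hodge operator of a Hermitian vector space\<close>

text \<open>The Kaehler form of the Hermitian structure. Its powers produce the volume form without
  a choice of basis.\<close>

definition fundamental_form :: "('e \<Rightarrow> 'e \<Rightarrow> real) \<Rightarrow> ('e \<Rightarrow> 'e) \<Rightarrow> 'e alt" where
  "fundamental_form g J = (\<lambda>vs. case vs of [u, v] \<Rightarrow> complex_of_real (g (J u) v) | _ \<Rightarrow> 0)"

primrec fundamental_power :: "('e \<Rightarrow> 'e \<Rightarrow> real) \<Rightarrow> ('e \<Rightarrow> 'e) \<Rightarrow> nat \<Rightarrow> 'e alt" where
  "fundamental_power g J 0 = unit_form"
| "fundamental_power g J (Suc j) = wedge (fundamental_form g J) (fundamental_power g J j)"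

definition J_list :: "('e \<Rightarrow> 'e) \<Rightarrow> 'e list \<Rightarrow> 'e list" where
  "J_list J vs = concat (map (\<lambda>v. [v, J v]) vs)"

lemma J_list_simps [simp]:
  "J_list J [] = []" "J_list J (v # vs) = v # J v # J_list J vs"
  "J_list J (us @ vs) = J_list J us @ J_list J vs"
  "length (J_list J vs) = 2 * length vs"
proof -
  show "length (J_list J vs) = 2 * length vs" by (induction vs) (auto simp: J_list_def)
qed (simp_all add: J_list_def)

lemma set_J_list: "set (J_list J vs) = set vs \<union> J ` set vs"
  by (induction vs) auto

lemma unit_form_deg: "unit_form \<in> alt_forms_deg 0"
  by (simp add: alt_forms_deg_def unit_form_alt_forms) (simp add: unit_form_def)

lemma wedge_deg:
  assumes "\<alpha> \<in> alt_forms_deg a" "\<beta> \<in> alt_forms_deg b"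
  shows "wedge \<alpha> \<beta> \<in> alt_forms_deg (a + b)"
proof -
  have "wedge \<alpha> \<beta> vs = 0" if "length vs \<noteq> a + b" for vs
    unfolding wedge_def
  proof (rule sum.neutral, rule ballI)
    fix S assume "S \<in> Pow {..<length vs}"
    then have S: "S \<subseteq> {..<length vs}" by simp
    have "card ({..<length vs} - S) = length vs - card S" "card S \<le> length vs"
      using card_Diff_subset[OF finite_subset[OF S] S] card_mono[OF _ S] by auto
    then have "length (nths vs S) \<noteq> a \<or> length (nths vs ({..<length vs} - S)) \<noteq> b"
      using that by (auto simp: length_nths_lessThan S)
    then have "\<alpha> (nths vs S) = 0 \<or> \<beta> (nths vs ({..<length vs} - S)) = 0"
      using alt_forms_deg_degree assms by blast
    then show "shuffle_sign (length vs) S * \<alpha> (nths vs S) * \<beta> (nths vs ({..<length vs} - S)) = 0"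
      by auto
  qed
  then show ?thesis
    using assms by (simp add: alt_forms_deg_def wedge_alt_forms)
qed

text \<open>The prefix us takes up the heads of the list during the induction. If the head belongs
  to the complement, it first has to be moved across the \<open>card U\<close> entries selected from
  the tail.\<close>

lemma shuffle_alt_forms:
  assumes "\<omega> \<in> alt_forms" "T \<subseteq> {..<length vs}"
  shows "\<omega> (us @ nths vs T @ nths vs ({..<length vs} - T)) = shuffle_sign (length vs) T * \<omega> (us @ vs)"
  using assms(2)
proof (induction vs arbitrary: us T)
  case Nil
  then show ?case by (simp add: shuffle_sign_def)
next
  case (Cons x xs)
  have "\<exists>U\<subseteq>{..<length xs}. T = insert 0 (Suc ` U) \<or> T = Suc ` U"
  proof (intro exI conjI)
    let ?U = "{i. Suc i \<in> T}"
    show "?U \<subseteq> {..<length xs}" using Cons.prems by auto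
    have "Suc ` ?U = T - {0}" by (auto simp: image_iff) (metis not0_implies_Suc)
    then show "T = insert 0 (Suc ` ?U) \<or> T = Suc ` ?U" by auto
  qed
  then obtain U where U: "U \<subseteq> {..<length xs}" "T = insert 0 (Suc ` U) \<or> T = Suc ` U" by blast
  note IH = Cons.IH[OF U(1), of "us @ [x]"]
  from U(2) show ?case
  proof
    assume T: "T = insert 0 (Suc ` U)"
    show ?thesis
      using IH by (simp add: T shuffle_sign_insert_0_Suc lessThan_diff_insert_0_Suc nths_insert_0_Suc nths_Suc)
  next
    assume T: "T = Suc ` U"
    have "\<omega> (us @ nths xs U @ x # nths xs ({..<length xs} - U)) =
      (-1) ^ card U * \<omega> (us @ x # nths xs U @ nths xs ({..<length xs} - U))"
      using alt_forms_move[OF assms(1)] by (simp add: length_nths_lessThan[OF U(1)])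
    then show ?thesis
      using IH by (simp add: T shuffle_sign_Suc[OF U(1)] lessThan_diff_Suc nths_insert_0_Suc nths_Suc)
  qed
qed

lemma shuffle_sign_square: "shuffle_sign n S * shuffle_sign n S = 1"
  by (simp add: shuffle_sign_def flip: power_add)

lemma alt_pairing_commute: "alt_pairing es \<alpha> \<beta> = alt_pairing es \<beta> \<alpha>"
  by (simp add: alt_pairing_def mult.commute)

section \<open>Hermitian vector spaces: adapted bases, volume form and star\<close>

locale hermitian_space = inner_product g
  for g :: "'e::euclidean_space \<Rightarrow> 'e \<Rightarrow> real" +
  fixes J :: "'e \<Rightarrow> 'e" and m :: nat
  assumes linear_J: "linear J"
    and J_J: "J (J v) = - v"
    and g_J_J: "g (J v) (J w) = g v w"
    and DIM: "DIM('e) = 2 * m"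
begin

abbreviation "\<omega> \<equiv> fundamental_form g J"

lemma g_J_skew: "g (J v) w = - g v (J w)"
  using g_J_J[of "J v" w] by (simp add: J_J g_lin)

lemma g_J_self: "g (J v) v = 0"
  using g_J_skew[of v v] sym[of v "J v"] by simp

lemma g_self_J: "g v (J v) = 0"
  using g_J_self[of v] sym[of v "J v"] by simp

lemma contract_fundamental: "contract u \<omega> = covector_form (\<lambda>v. complex_of_real (g (J u) v))"
  by (auto simp: contract_def fundamental_form_def covector_form_def split: list.split)

lemma grade_fundamental: "grade \<omega> = \<omega>"
  by (auto simp: grade_def fundamental_form_def split: list.split)

lemma fundamental_deg: "\<omega> \<in> alt_forms_deg 2"
proof -
  have "linear (\<lambda>v. \<omega> (us @ v # ws))" for us ws
  proof (cases us)
    case Nil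
    have "linear (\<lambda>v. complex_of_real (g (J v) w))" for w
      by (rule linearI) (simp_all add: linear_add[OF linear_J] linear_scale[OF linear_J] g_lin scaleR_conv_of_real)
    then show ?thesis
      by (cases ws rule: remdups_adj.cases) (auto simp: Nil fundamental_form_def linear_iff)
  next
    case (Cons u us')
    have "linear (\<lambda>v. complex_of_real (g (J u) v))"
      by (rule linearI) (simp_all add: g_lin scaleR_conv_of_real)
    then have "multilin (covector_form (\<lambda>v. complex_of_real (g (J u) v)))"
      by (intro alt_forms_multilin covector_alt_forms)
    then have "multilin (contract u \<omega>)" by (simp add: contract_fundamental)
    from multilinD[OF this, of us' ws] show ?thesis by (simp add: Cons contract_apply)
  qed
  then have "multilin \<omega>" by (simp add: multilin_def)
  moreover have "\<omega> (us @ v # v # ws) = 0" for us v ws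
    using g_J_self[of v] by (cases us) (auto simp: fundamental_form_def split: list.split)
  ultimately have "\<omega> \<in> alt_forms" by (rule alt_formsI)
  then show ?thesis
    by (auto simp: alt_forms_deg_def fundamental_form_def split: list.split)
qed

lemma fundamental_power_deg: "fundamental_power g J j \<in> alt_forms_deg (2 * j)"
proof (induction j)
  case (Suc j)
  show ?case using wedge_deg[OF fundamental_deg Suc] by simp
qed (simp add: unit_form_deg)

text \<open>On an adapted orthonormal list, \<omega> sees only the pairs v, J v and takes the value
  1 on each. Every pair can be the one fed to \<omega>; moving a pair costs no sign, and the rest
  contributes c by assumption.\<close>

lemma wedge_fundamental_J_list:
  assumes "orthonormal_list g (J_list J vs)"
    and "\<And>us v ws. vs = us @ v # ws \<Longrightarrow> \<beta> (J_list J (us @ ws)) = c"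
  shows "wedge \<omega> \<beta> (J_list J vs) = of_nat (length vs) * c"
  using assms
proof (induction vs arbitrary: \<beta>)
  case Nil
  then show ?case by (simp add: fundamental_form_def)
next
  case (Cons u vs)
  let ?ws = "J_list J vs"
  have on: "orthonormal_list g (u # J u # ?ws)" using Cons.prems(1) by simp
  have covector_0: "wedge (covector_form \<xi>) \<eta> ?ws = 0" if "\<And>w. w \<in> set ?ws \<Longrightarrow> \<xi> w = 0" for \<xi> \<eta>
    using that by (simp add: wedge_covector_sum)
  have "g (J u) w = 0" "g (J (J u)) w = 0" if "w \<in> set ?ws" for w
    using that on by (auto simp: orthonormal_list_def J_J g_lin)
  moreover have "g (J u) (J u) = 1" using on by (simp add: orthonormal_list_def g_J_J)
  \<comment> \<open>Of the terms obtained by contracting with u and J u, those with exactly one of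
    the two in \<omega> contain a covector that vanishes on the remaining list.\<close>
  ultimately have "wedge \<omega> \<beta> (J_list J (u # vs)) = \<beta> ?ws + wedge \<omega> (contract (J u) (contract u \<beta>)) ?ws"
    by (simp add: wedge_Cons[of \<omega>] contract_fundamental grade_fundamental wedge_covector_Cons covector_0)
  moreover have "\<beta> ?ws = c" using Cons.prems(2)[of "[]" u vs] by simp
  moreover have "wedge \<omega> (contract (J u) (contract u \<beta>)) ?ws = of_nat (length vs) * c"
  proof (rule Cons.IH)
    show "orthonormal_list g ?ws" using on by (simp add: orthonormal_list_def)
    fix us v ws assume "vs = us @ v # ws"
    then show "contract (J u) (contract u \<beta>) (J_list J (us @ ws)) = c"
      using Cons.prems(2)[of "u # us" v ws] by (simp add: contract_apply)
  qed
  ultimately show ?case by (simp add: algebra_simps)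
qed

lemma fundamental_power_J_list:
  "orthonormal_list g (J_list J vs) \<Longrightarrow> length vs = j \<Longrightarrow> fundamental_power g J j (J_list J vs) = fact j"
proof (induction j arbitrary: vs)
  case (Suc j)
  have "wedge \<omega> (fundamental_power g J j) (J_list J vs) = of_nat (length vs) * fact j"
  proof (rule wedge_fundamental_J_list[OF Suc.prems(1)])
    fix us v ws assume vs: "vs = us @ v # ws"
    show "fundamental_power g J j (J_list J (us @ ws)) = fact j"
      by (rule Suc.IH) (use Suc.prems vs in \<open>auto simp: orthonormal_list_def\<close>)
  qed
  then show ?case using Suc.prems(2) by simp
qed (simp add: unit_form_def)

text \<open>Gram-Schmidt in pairs: the entries of \<open>J_list J vs\<close> are permuted by J up to
  sign, so a unit vector w orthogonal to them has J w orthogonal to them as well, and w is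
  orthogonal to J w by skewness.\<close>

lemma J_orthonormal_list_exists: "j \<le> m \<Longrightarrow> \<exists>vs. length vs = j \<and> orthonormal_list g (J_list J vs)"
proof (induction j)
  case (Suc j)
  then obtain vs where vs: "length vs = j" "orthonormal_list g (J_list J vs)" by auto
  have "span (set (J_list J vs)) \<noteq> UNIV"
    by (rule short_span_neq_UNIV) (use vs Suc.prems DIM in auto)
  then obtain b where b: "b \<notin> span (set (J_list J vs))" by auto
  define u where "u = b - (\<Sum>f\<in>set (J_list J vs). g b f *\<^sub>R f)"
  define w where "w = (1 / sqrt (g u u)) *\<^sub>R u"
  have "(\<Sum>f\<in>set (J_list J vs). g b f *\<^sub>R f) \<in> span (set (J_list J vs))"
    by (intro span_sum span_scale span_base)
  then have "u \<noteq> 0" using b by (auto simp: u_def)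
  then have u_pos: "g u u > 0" by (rule pos)
  then have ww: "g w w = 1" by (simp add: w_def g_lin)
  have w_perp: "g w e = 0" if "e \<in> set (J_list J vs)" for e
    using orthogonal_remainder[OF vs(2) that, of b] by (simp add: w_def u_def g_lin)
  have Jw_perp: "g (J w) e = 0" if e: "e \<in> set (J_list J vs)" for e
  proof -
    have "J e \<in> set (J_list J vs) \<or> - J e \<in> set (J_list J vs)"
      using e by (auto simp: set_J_list J_J)
    then have "g w (J e) = 0" using w_perp[of "J e"] w_perp[of "- J e"] by (auto simp: g_lin)
    then show ?thesis by (simp add: g_J_skew)
  qed
  have perp': "g e w = 0" "g e (J w) = 0" if "e \<in> set (J_list J vs)" for e
    using w_perp[OF that] Jw_perp[OF that] by (simp_all add: sym[of e])
  have JJ: "g (J w) (J w) = 1" by (simp add: g_J_J ww)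
  have "w \<notin> set (J_list J vs)" "J w \<notin> set (J_list J vs)" "w \<noteq> J w"
    using w_perp[of w] Jw_perp[of "J w"] ww JJ g_J_self[of w] by auto
  then have "orthonormal_list g (J_list J (w # vs))"
    using vs(2) w_perp Jw_perp perp' ww JJ g_J_self[of w] g_self_J[of w]
    by (auto simp: orthonormal_list_def)
  then show ?case using vs(1) by (intro exI[of _ "w # vs"]) simp
qed (auto simp: orthonormal_list_def)

lemma orthonormal_basis_J_list: "orthonormal_basis g (J_list J vs) \<longleftrightarrow> length vs = m \<and> orthonormal_list g (J_list J vs)"
  by (auto simp: orthonormal_basis_iff DIM)

lemma J_basis_exists: "\<exists>vs. orthonormal_basis g (J_list J vs)"
  using J_orthonormal_list_exists[of m] by (auto simp: orthonormal_basis_J_list)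

text \<open>Among the sublists of es only es itself has the length on which a form of top degree can
  be nonzero.\<close>

lemma alt_forms_deg_top_eqI:
  assumes "\<alpha> \<in> alt_forms_deg DIM('e)" "\<beta> \<in> alt_forms_deg DIM('e)"
    and "orthonormal_basis g es" "\<alpha> es = \<beta> es"
  shows "\<alpha> = \<beta>"
proof (rule alt_forms_eqI[OF _ _ orthonormal_basis_span[OF assms(3)]])
  fix S assume S: "S \<subseteq> {..<length es}"
  have len: "length es = DIM('e)" using assms(3) by (simp add: orthonormal_basis_iff)
  show "\<alpha> (nths es S) = \<beta> (nths es S)"
  proof (cases "S = {..<length es}")
    case True
    have "nths es {..<length es} = es" by (rule nths_all) simp
    then show ?thesis using True assms(4) by simp
  next
    case False
    then have "card S < card {..<length es}" using S by (intro psubset_card_mono) auto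
    then show ?thesis
      using assms(1,2)[THEN alt_forms_deg_degree, of "nths es S"] by (simp add: length_nths_lessThan[OF S] len)
  qed
qed (use assms in \<open>auto simp: alt_forms_deg_def\<close>)

text \<open>Since \<open>\<omega>\<^sup>m / m!\<close> takes the value 1 on every basis adapted to \<open>J\<close>, all adapted bases have the
  same orientation, which makes \<open>volume_form\<close> well-defined.\<close>

lemma volume_form_eq: "volume_form g J = (\<lambda>vs. fundamental_power g J m vs / fact m)"
  and volume_form_deg: "volume_form g J \<in> alt_forms_deg DIM('e)"
  and volume_form_J_list: "orthonormal_basis g (J_list J vs) \<Longrightarrow> volume_form g J (J_list J vs) = 1"
proof -
  let ?\<tau> = "\<lambda>vs. fundamental_power g J m vs / fact m"
  have deg: "?\<tau> \<in> alt_forms_deg DIM('e)"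
    using fundamental_power_deg[of m] alt_forms_scale[of "fundamental_power g J m" "1 / fact m"]
    by (simp add: alt_forms_deg_def DIM)
  have one: "?\<tau> (J_list J vs) = 1" if "orthonormal_basis g (J_list J vs)" for vs
    using that fundamental_power_J_list[of vs m] by (simp add: orthonormal_basis_J_list)
  show eq: "volume_form g J = ?\<tau>"
    unfolding volume_form_def J_list_def[symmetric]
  proof (rule the_equality)
    fix \<tau>
    assume \<tau>: "\<tau> \<in> alt_forms_deg DIM('e) \<and> (\<forall>vs. orthonormal_basis g (J_list J vs) \<longrightarrow> \<tau> (J_list J vs) = 1)"
    obtain vs where vs: "orthonormal_basis g (J_list J vs)" using J_basis_exists by blast
    show "\<tau> = ?\<tau>"
      by (rule alt_forms_deg_top_eqI[OF _ deg vs]) (use \<tau> vs one in auto)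
  qed (use deg one in blast)
  show "volume_form g J \<in> alt_forms_deg DIM('e)" using deg by (simp add: eq)
  show "volume_form g J (J_list J vs) = 1" if "orthonormal_basis g (J_list J vs)"
    using one[OF that] by (simp add: eq)
qed

lemma volume_form_alt: "volume_form g J \<in> alt_forms"
  using volume_form_deg by (rule alt_forms_deg_alt)

lemma volume_form_neq_0:
  assumes "orthonormal_basis g es" shows "volume_form g J es \<noteq> 0"
proof
  assume 0: "volume_form g J es = 0"
  have "(\<lambda>vs. 0) \<in> alt_forms_deg DIM('e)" by (simp add: alt_forms_deg_def alt_forms_zero)
  from alt_forms_deg_top_eqI[OF volume_form_deg this assms] 0 have "volume_form g J = (\<lambda>vs. 0)" by simp
  then show False using J_basis_exists volume_form_J_list by (metis zero_neq_one)
qed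

text \<open>For S different from T, either S is a proper subset of T and the list is too short, or
  an element of S outside T makes a basis vector occur twice.\<close>

lemma volume_form_complement:
  assumes "orthonormal_basis g es" "S \<subseteq> {..<length es}" "T \<subseteq> {..<length es}"
  shows "volume_form g J (nths es S @ nths es ({..<length es} - T)) =
    (if S = T then shuffle_sign (length es) T * volume_form g J es else 0)"
proof (cases "S = T")
  case True
  then show ?thesis using shuffle_alt_forms[OF volume_form_alt assms(3), of "[]"] by simp
next
  case False
  have es: "distinct es" "length es = DIM('e)"
    using assms(1) by (auto simp: orthonormal_basis_iff orthonormal_list_def)
  show ?thesis
  proof (cases "S \<subseteq> T")
    case True
    then have "card S < card T" using False finite_subset[OF assms(3)] by (intro psubset_card_mono) auto
    moreover have "card ({..<length es} - T) = length es - card T" "card T \<le> length es"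
      using card_Diff_subset[OF finite_subset[OF assms(3)] assms(3)] card_mono[OF _ assms(3)] by auto
    ultimately have "length (nths es S @ nths es ({..<length es} - T)) \<noteq> DIM('e)"
      using assms(2) by (simp add: length_nths_lessThan es(2))
    then show ?thesis using False alt_forms_deg_degree[OF volume_form_deg] by simp
  next
    case S: False
    then obtain i where i: "i \<in> S" "i \<notin> T" by auto
    then have "es ! i \<in> set (nths es S) \<inter> set (nths es ({..<length es} - T))"
      using assms(2) by (auto simp: set_nths)
    then have "\<not> distinct (nths es S @ nths es ({..<length es} - T))" by auto
    then show ?thesis using False alt_forms_not_distinct[OF volume_form_alt] by simp
  qed
qed

text \<open>The explicit candidate for the Hodge dual: the sum over all S of the coefficient of
  \<beta> at S times the volume form with the corresponding basis vectors inserted first. It is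
  alternating by construction.\<close>

definition star :: "'e list \<Rightarrow> 'e alt \<Rightarrow> 'e alt" where
  "star es \<beta> = (\<lambda>ws. alt_pairing es \<beta> (\<lambda>us. volume_form g J (us @ ws)))"

lemma star_alt_forms: "star es \<beta> \<in> alt_forms"
  unfolding star_def alt_pairing_def
  by (intro alt_forms_sum alt_forms_scale alt_forms_prepend volume_form_alt)

lemma star_complement:
  assumes "orthonormal_basis g es" "T \<subseteq> {..<length es}"
  shows "star es \<beta> (nths es ({..<length es} - T)) = shuffle_sign (length es) T * \<beta> (nths es T) * volume_form g J es"
proof -
  have "star es \<beta> (nths es ({..<length es} - T)) = (\<Sum>S\<in>Pow {..<length es}. if S = T then
     \<beta> (nths es S) * (shuffle_sign (length es) T * volume_form g J es) else 0)"
    unfolding star_def alt_pairing_def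
    by (intro sum.cong refl) (use assms in \<open>auto simp: volume_form_complement\<close>)
  then show ?thesis using assms(2) by simp
qed

lemma alt_inner_eq: "\<exists>es. orthonormal_basis g es \<and> (\<forall>\<alpha> \<beta>. alt_inner g \<alpha> \<beta> = alt_pairing es \<alpha> \<beta>)"
proof (intro exI conjI allI)
  show *: "orthonormal_basis g (SOME es. orthonormal_basis g es)"
    using J_basis_exists by (metis someI)
  show "alt_inner g \<alpha> \<beta> = alt_pairing (SOME es. orthonormal_basis g es) \<alpha> \<beta>" for \<alpha> \<beta>
    using * by (simp add: alt_inner_def alt_pairing_def Let_def orthonormal_basis_iff)
qed

text \<open>One basis, the one behind \<open>alt_inner\<close>, serves for all \<beta> of any
  mixture of degrees; additivity and homogeneity of \<open>alt_hodge\<close> follow from this order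
  of the quantifiers.\<close>

lemma alt_hodge_star: "\<exists>es. orthonormal_basis g es \<and> (\<forall>\<beta>. alt_hodge g J \<beta> = star es \<beta>)"
proof -
  obtain es where es: "orthonormal_basis g es" and inner: "\<And>\<alpha> \<beta>. alt_inner g \<alpha> \<beta> = alt_pairing es \<alpha> \<beta>"
    using alt_inner_eq by blast
  let ?\<tau> = "volume_form g J" and ?n = "length es"
  have len: "?n = DIM('e)" using es by (simp add: orthonormal_basis_iff)
  have "alt_hodge g J \<beta> = star es \<beta>" for \<beta>
    unfolding alt_hodge_def
  proof (rule the_equality)
    have "wedge \<alpha> (star es \<beta>) vs = alt_inner g \<alpha> \<beta> * ?\<tau> vs"
      if \<alpha>: "\<alpha> \<in> alt_forms" and vs: "length vs = DIM('e)" for \<alpha> vs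
    proof -
      have "wedge \<alpha> (star es \<beta>) es = (\<Sum>S\<in>Pow {..<?n}. \<alpha> (nths es S) * \<beta> (nths es S) * ?\<tau> es)"
        unfolding wedge_def
        by (intro sum.cong refl) (simp add: star_complement[OF es] algebra_simps shuffle_sign_square
            flip: mult.assoc[of "shuffle_sign _ _" "shuffle_sign _ _"])
      also have "\<dots> = alt_inner g \<alpha> \<beta> * ?\<tau> es"
        by (simp add: inner alt_pairing_def sum_distrib_right)
      finally have at_es: "wedge \<alpha> (star es \<beta>) es = alt_inner g \<alpha> \<beta> * ?\<tau> es" .
      \<comment> \<open>The wedge product may have components in other degrees; they are cut off so
        that a comparison at the single list es suffices.\<close>
      have "(\<lambda>vs. if length vs = DIM('e) then wedge \<alpha> (star es \<beta>) vs else 0) =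
        (\<lambda>vs. alt_inner g \<alpha> \<beta> * ?\<tau> vs)"
        by (rule alt_forms_deg_top_eqI[OF alt_forms_degree_part _ es])
          (use \<alpha> star_alt_forms volume_form_deg at_es len in
            \<open>auto simp: wedge_alt_forms alt_forms_deg_def alt_forms_scale\<close>)
      from fun_cong[OF this, of vs] vs show ?thesis by simp
    qed
    then show "star es \<beta> \<in> alt_forms \<and> (\<forall>\<alpha>\<in>alt_forms. \<forall>vs. length vs = DIM('e) \<longrightarrow>
        wedge \<alpha> (star es \<beta>) vs = alt_inner g \<alpha> \<beta> * ?\<tau> vs)"
      using star_alt_forms by blast
    fix \<gamma>
    assume \<gamma>: "\<gamma> \<in> alt_forms \<and> (\<forall>\<alpha>\<in>alt_forms. \<forall>vs. length vs = DIM('e) \<longrightarrow>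
        wedge \<alpha> \<gamma> vs = alt_inner g \<alpha> \<beta> * ?\<tau> vs)"
    have \<gamma>_es: "\<gamma> (nths es ({..<?n} - T)) = shuffle_sign ?n T * \<beta> (nths es T) * ?\<tau> es"
      if T: "T \<subseteq> {..<?n}" for T
    proof -
      \<comment> \<open>A test form that vanishes on all sublists of es except the one at T. Wedging
        with it isolates the value of \<gamma> on the complementary sublist.\<close>
      define \<alpha> where "\<alpha> us = ?\<tau> (us @ nths es ({..<?n} - T))" for us
      have \<alpha>_es: "\<alpha> (nths es S) = (if S = T then shuffle_sign ?n T * ?\<tau> es else 0)" if "S \<in> Pow {..<?n}" for S
        using volume_form_complement[OF es _ T] that by (simp add: \<alpha>_def)
      have "\<alpha> \<in> alt_forms" unfolding \<alpha>_def by (intro alt_forms_append volume_form_alt)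
      then have "wedge \<alpha> \<gamma> es = alt_pairing es \<alpha> \<beta> * ?\<tau> es"
        using \<gamma> len inner by simp
      moreover have "wedge \<alpha> \<gamma> es = (\<Sum>S\<in>Pow {..<?n}. if S = T then
          shuffle_sign ?n T * (shuffle_sign ?n T * ?\<tau> es) * \<gamma> (nths es ({..<?n} - T)) else 0)"
        unfolding wedge_def by (intro sum.cong refl) (auto simp: \<alpha>_es)
      moreover have "alt_pairing es \<alpha> \<beta> = (\<Sum>S\<in>Pow {..<?n}. if S = T then
          shuffle_sign ?n T * ?\<tau> es * \<beta> (nths es T) else 0)"
        unfolding alt_pairing_def by (intro sum.cong refl) (auto simp: \<alpha>_es)
      ultimately have "?\<tau> es * \<gamma> (nths es ({..<?n} - T)) =
          ?\<tau> es * (shuffle_sign ?n T * \<beta> (nths es T) * ?\<tau> es)"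
        using T by (simp add: algebra_simps shuffle_sign_square flip: mult.assoc[of "shuffle_sign _ _" "shuffle_sign _ _"])
      then show ?thesis using volume_form_neq_0[OF es] by simp
    qed
    show "\<gamma> = star es \<beta>"
    proof (rule alt_forms_eqI[OF _ star_alt_forms orthonormal_basis_span[OF es]])
      fix S assume "S \<subseteq> {..<?n}"
      then have "S = {..<?n} - ({..<?n} - S)" by auto
      moreover have "\<gamma> (nths es ({..<?n} - ({..<?n} - S))) = star es \<beta> (nths es ({..<?n} - ({..<?n} - S)))"
        by (subst \<gamma>_es, simp) (subst star_complement[OF es], auto)
      ultimately show "\<gamma> (nths es S) = star es \<beta> (nths es S)" by simp
    qed (use \<gamma> in blast)
  qed
  then show ?thesis using es by blast
qed

text \<open>The value of the star at ws is a pairing of \<beta> with a contracted volume form, so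
  for homogeneous \<beta> any orthonormal basis may replace the chosen one.\<close>

lemma alt_hodge_eq:
  assumes "orthonormal_basis g es" "\<beta> \<in> alt_forms_deg k"
  shows "alt_hodge g J \<beta> = star es \<beta>"
proof -
  obtain fs where fs: "orthonormal_basis g fs" "alt_hodge g J \<beta> = star fs \<beta>"
    using alt_hodge_star by blast
  have "star fs \<beta> ws = star es \<beta> ws" for ws
    unfolding star_def alt_pairing_commute[of _ \<beta>]
    by (rule alt_pairing_independent[OF fs(1) assms(1) alt_forms_append[OF volume_form_alt] assms(2)])
  then show ?thesis using fs by auto
qed

lemma alt_hodge_alt_forms: "alt_hodge g J \<beta> \<in> alt_forms"
  using alt_hodge_star star_alt_forms by metis

lemma alt_hodge_add: "alt_hodge g J (\<lambda>vs. \<alpha> vs + \<beta> vs) = (\<lambda>vs. alt_hodge g J \<alpha> vs + alt_hodge g J \<beta> vs)"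
proof -
  obtain es where "\<And>\<beta>. alt_hodge g J \<beta> = star es \<beta>" using alt_hodge_star by blast
  then show ?thesis by (simp add: star_def alt_pairing_add_left)
qed

lemma alt_hodge_scale: "alt_hodge g J (\<lambda>vs. z * \<beta> vs) = (\<lambda>vs. z * alt_hodge g J \<beta> vs)"
proof -
  obtain es where "\<And>\<beta>. alt_hodge g J \<beta> = star es \<beta>" using alt_hodge_star by blast
  then show ?thesis by (simp add: star_def alt_pairing_scale_left)
qed

lemma alt_hodge_deg:
  assumes "\<beta> \<in> alt_forms_deg k" "k \<le> DIM('e)"
  shows "alt_hodge g J \<beta> \<in> alt_forms_deg (DIM('e) - k)"
proof -
  obtain es where es: "\<And>\<beta>. alt_hodge g J \<beta> = star es \<beta>" using alt_hodge_star by blast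
  have "star es \<beta> ws = 0" if "length ws \<noteq> DIM('e) - k" for ws
    unfolding star_def alt_pairing_def
  proof (rule sum.neutral, rule ballI)
    fix S assume "S \<in> Pow {..<length es}"
    have "length (nths es S) \<noteq> k \<or> length (nths es S @ ws) \<noteq> DIM('e)" using that assms(2) by auto
    then have "\<beta> (nths es S) = 0 \<or> volume_form g J (nths es S @ ws) = 0"
      using alt_forms_deg_degree[OF assms(1)] alt_forms_deg_degree[OF volume_form_deg] by blast
    then show "\<beta> (nths es S) * volume_form g J (nths es S @ ws) = 0" by auto
  qed
  then show ?thesis using es star_alt_forms by (simp add: alt_forms_deg_def)
qed

text \<open>On a sublist e_T the double star multiplies \<beta> by the shuffle signs of T and of its
  complement. Their product is -1 to the power |T| (2m - |T|), which has the parity of |T|.\<close>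

lemma alt_hodge_alt_hodge:
  assumes "\<beta> \<in> alt_forms_deg k" "k \<le> DIM('e)"
  shows "alt_hodge g J (alt_hodge g J \<beta>) = grade \<beta>"
proof -
  obtain vs where vs: "orthonormal_basis g (J_list J vs)" using J_basis_exists by blast
  define es where "es = J_list J vs"
  let ?n = "length es" and ?\<tau> = "volume_form g J"
  have es: "orthonormal_basis g es" "?\<tau> es = 1" using vs volume_form_J_list by (auto simp: es_def)
  have len: "?n = 2 * m" using es(1) DIM by (simp add: orthonormal_basis_iff)
  have star: "alt_hodge g J \<beta> = star es \<beta>" by (rule alt_hodge_eq[OF es(1) assms(1)])
  have starstar: "alt_hodge g J (star es \<beta>) = star es (star es \<beta>)"
    using alt_hodge_eq[OF es(1) alt_hodge_deg[OF assms]] by (simp add: star)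
  have "star es (star es \<beta>) (nths es T) = grade \<beta> (nths es T)" if T: "T \<subseteq> {..<?n}" for T
  proof -
    let ?C = "{..<?n} - T"
    have TC: "T = {..<?n} - ?C" using T by auto
    have "star es (star es \<beta>) (nths es T) = shuffle_sign ?n ?C * star es \<beta> (nths es ?C)"
      using star_complement[OF es(1), of ?C "star es \<beta>"] TC es(2) by simp
    also have "\<dots> = shuffle_sign ?n ?C * shuffle_sign ?n T * \<beta> (nths es T)"
      using star_complement[OF es(1) T, of \<beta>] es(2) by simp
    \<comment> \<open>Both signs are values of the volume form, on the two orders of the blocks for
      T and its complement; the adapted basis has volume 1.\<close>
    also have "shuffle_sign ?n ?C = (-1) ^ (card ?C * card T) * shuffle_sign ?n T"
      using alt_forms_block_swap[OF volume_form_alt, of "nths es ?C" "nths es T"] TC T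
        volume_form_complement[OF es(1) T T] volume_form_complement[OF es(1), of ?C ?C] es(2)
      by (simp add: length_nths_lessThan)
    finally have "star es (star es \<beta>) (nths es T) = (-1) ^ (card ?C * card T) * \<beta> (nths es T)"
      using shuffle_sign_square[of ?n T] by (simp add: mult.assoc)
    moreover have "card ?C = 2 * m - card T" "card T \<le> 2 * m"
      using card_Diff_subset[OF finite_subset[OF T] T] card_mono[OF _ T] len by auto
    then have "even (card ?C * card T) \<longleftrightarrow> even (card T)" by auto
    then have "(-1 :: complex) ^ (card ?C * card T) = (-1) ^ card T"
      by (simp add: minus_one_power_iff)
    ultimately show ?thesis by (simp add: grade_def length_nths_lessThan[OF T])
  qed
  then show ?thesis
    unfolding star starstar
    by (intro alt_forms_eqI[OF star_alt_forms _ orthonormal_basis_span[OF es(1)]] grade_alt_forms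
        alt_forms_deg_alt[OF assms(1)])
qed

end

text \<open>D carries orthonormal bases to orthonormal bases and adapted ones to adapted ones, so it
  pulls back the volume form, and the star formulas agree term by term. Used with D the derivative
  of a transition map, and with D = J.\<close>

lemma alt_hodge_pullback:
  fixes g g' :: "'e::euclidean_space \<Rightarrow> 'e \<Rightarrow> real"
  assumes "hermitian_space g J m" "hermitian_space g' J' m" "linear D"
    and "\<And>v w. g' (D v) (D w) = g v w" "\<And>v. J' (D v) = D (J v)" "\<beta> \<in> alt_forms_deg k"
  shows "alt_hodge g J (\<lambda>vs. \<beta> (map D vs)) = (\<lambda>ws. alt_hodge g' J' \<beta> (map D ws))"
proof -
  interpret H: hermitian_space g J m by fact
  interpret H': hermitian_space g' J' m by fact
  obtain vs where vs: "orthonormal_basis g (J_list J vs)" using H.J_basis_exists by blast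
  define es where "es = J_list J vs"
  have map_D: "orthonormal_basis g' (map D es)" if "orthonormal_basis g es" for es
    using that assms(4) by (simp add: orthonormal_basis_def)
  have map_J_list: "map D (J_list J us) = J_list J' (map D us)" for us
    by (induction us) (auto simp: assms(5))
  have pull: "(\<lambda>vs. \<eta> (map D vs)) \<in> alt_forms_deg j" if "\<eta> \<in> alt_forms_deg j" for \<eta> j
    using that alt_forms_pullback[OF _ assms(3)] by (auto simp: alt_forms_deg_def)
  have es: "orthonormal_basis g es" "orthonormal_basis g' (map D es)"
    using vs map_D by (auto simp: es_def)
  have "volume_form g J = (\<lambda>vs. volume_form g' J' (map D vs))"
    by (rule H.alt_forms_deg_top_eqI[OF H.volume_form_deg pull[OF H'.volume_form_deg] es(1)])
      (use vs es(2) in \<open>simp add: es_def H.volume_form_J_list map_J_list H'.volume_form_J_list\<close>)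
  then show ?thesis
    unfolding H.alt_hodge_eq[OF es(1) pull[OF assms(6)]] H'.alt_hodge_eq[OF es(2) assms(6)]
      H.star_def H'.star_def alt_pairing_def
    by (simp add: nths_map)
qed

section \<open>Smooth functions and smooth families of forms\<close>

lemma frechet_derivative_eq: "(f has_derivative F) (at x) \<Longrightarrow> frechet_derivative f (at x) = F"
  by (rule frechet_derivative_at[symmetric])

lemma frechet_derivative_cong_open:
  assumes "open S" "x \<in> S" "\<And>y. y \<in> S \<Longrightarrow> f y = g y"
  shows "frechet_derivative f (at x) = frechet_derivative g (at x)"
proof -
  have "(f has_derivative F) (at x) \<longleftrightarrow> (g has_derivative F) (at x)" for F
    using has_derivative_transform_within_open[of f F x UNIV S g]
      has_derivative_transform_within_open[of g F x UNIV S f] assms by auto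
  then show ?thesis by (simp add: frechet_derivative_def)
qed

lemma Ck_on_cong:
  assumes "open S" "\<And>y. y \<in> S \<Longrightarrow> f y = g y" "Ck_on k f S"
  shows "Ck_on k g S"
  using assms(2,3)
proof (induction k arbitrary: f g)
  case (Suc k)
  have "g differentiable (at x)" if "x \<in> S" for x
  proof -
    have "f differentiable (at x)" using Suc.prems that by simp
    then show ?thesis
      unfolding differentiable_def
      using has_derivative_transform_within_open[of f _ x UNIV S g] assms(1) that Suc.prems(1) by blast
  qed
  moreover have "Ck_on k (\<lambda>x. frechet_derivative g (at x) v) S" for v
    by (rule Suc.IH[of "\<lambda>x. frechet_derivative f (at x) v"])
      (use Suc.prems frechet_derivative_cong_open[OF assms(1), of _ f g] in auto)
  ultimately show ?case by simp
qed (use continuous_on_cong in force)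

text \<open>Any explicit derivative F may stand in for \<open>frechet_derivative\<close>; openness
  of S allows the exchange inside \<open>Ck_on\<close>.\<close>

lemma Ck_on_SucI:
  assumes "open S" "\<And>x. x \<in> S \<Longrightarrow> (f has_derivative F x) (at x)" "\<And>v. Ck_on k (\<lambda>x. F x v) S"
  shows "Ck_on (Suc k) f S"
proof -
  have "Ck_on k (\<lambda>x. frechet_derivative f (at x) v) S" for v
    by (rule Ck_on_cong[OF assms(1) _ assms(3)[of v]]) (simp add: frechet_derivative_eq[OF assms(2)])
  then show ?thesis using assms(2) by (auto simp: differentiable_def)
qed

lemma Ck_on_SucD:
  assumes "Ck_on (Suc k) f S" "x \<in> S"
  shows "(f has_derivative frechet_derivative f (at x)) (at x)"
  using assms by (simp add: frechet_derivative_works)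

lemma Ck_on_lower: "Ck_on (Suc k) f S \<Longrightarrow> Ck_on k f S"
proof (induction k arbitrary: f)
  case 0
  then show ?case by (auto intro!: continuous_at_imp_continuous_on differentiable_imp_continuous_within)
next
  case (Suc k)
  then show ?case by (metis Ck_on.simps(2))
qed

lemma Ck_on_const: "Ck_on k (\<lambda>x. c) S"
  by (induction k arbitrary: c) auto

lemma Ck_on_add:
  assumes "open S"
  shows "Ck_on k f S \<Longrightarrow> Ck_on k g S \<Longrightarrow> Ck_on k (\<lambda>x. f x + g x) S"
proof (induction k arbitrary: f g)
  case (Suc k)
  show ?case
    by (rule Ck_on_SucI[OF assms has_derivative_add[OF Ck_on_SucD[OF Suc.prems(1)] Ck_on_SucD[OF Suc.prems(2)]]])
      (use Suc in auto)
qed (auto intro: continuous_intros)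

lemma Ck_on_bounded_bilinear:
  assumes "open S" "bounded_bilinear op"
  shows "Ck_on k f S \<Longrightarrow> Ck_on k g S \<Longrightarrow> Ck_on k (\<lambda>x. op (f x) (g x)) S"
proof (induction k arbitrary: f g)
  case 0
  then show ?case using bounded_bilinear.continuous_on[OF assms(2)] by auto
next
  case (Suc k)
  show ?case
  proof (rule Ck_on_SucI[OF assms(1)])
    fix x assume "x \<in> S"
    then show "((\<lambda>x. op (f x) (g x)) has_derivative
        (\<lambda>h. op (f x) (frechet_derivative g (at x) h) + op (frechet_derivative f (at x) h) (g x))) (at x)"
      by (intro bounded_bilinear.FDERIV[OF assms(2)] Ck_on_SucD[OF Suc.prems(1)] Ck_on_SucD[OF Suc.prems(2)])
  next
    fix v
    show "Ck_on k (\<lambda>x. op (f x) (frechet_derivative g (at x) v) + op (frechet_derivative f (at x) v) (g x)) S"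
      by (intro Ck_on_add[OF assms(1)] Suc.IH Suc.prems[THEN Ck_on_lower]) (use Suc.prems in auto)
  qed
qed

text \<open>The exponent is arbitrary because differentiation lowers it by one. The case of interest
  is -1/2, for normalising vectors.\<close>

lemma Ck_on_powr:
  fixes f :: "'e::real_normed_vector \<Rightarrow> real"
  assumes "open S" "\<And>x. x \<in> S \<Longrightarrow> f x > 0"
  shows "Ck_on k f S \<Longrightarrow> Ck_on k (\<lambda>x. f x powr a) S"
proof (induction k arbitrary: a)
  case 0
  then show ?case using assms(2) by (auto intro!: continuous_on_powr continuous_on_const) (metis less_irrefl)
next
  case (Suc k)
  show ?case
  proof (rule Ck_on_SucI[OF assms(1)])
    fix x assume x: "x \<in> S"
    show "((\<lambda>x. f x powr a) has_derivative
        (\<lambda>h. frechet_derivative f (at x) h * (a * f x powr (a - 1)))) (at x)"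
      by (rule DERIV_compose_FDERIV[OF has_real_derivative_powr[OF assms(2)[OF x]] Ck_on_SucD[OF Suc.prems x]])
  next
    fix v
    show "Ck_on k (\<lambda>x. frechet_derivative f (at x) v * (a * f x powr (a - 1))) S"
      by (intro Ck_on_bounded_bilinear[OF assms(1) bounded_bilinear_mult] Ck_on_const Suc.IH
          Suc.prems[THEN Ck_on_lower]) (use Suc.prems in auto)
  qed
qed

lemma smooth_on_cong: "open S \<Longrightarrow> (\<And>y. y \<in> S \<Longrightarrow> f y = g y) \<Longrightarrow> smooth_on f S \<longleftrightarrow> smooth_on g S"
  unfolding smooth_on_def using Ck_on_cong[of S f g] Ck_on_cong[of S g f] by metis

lemma smooth_on_const: "smooth_on (\<lambda>x. c) S"
  by (simp add: smooth_on_def Ck_on_const)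

lemma smooth_on_add: "open S \<Longrightarrow> smooth_on f S \<Longrightarrow> smooth_on g S \<Longrightarrow> smooth_on (\<lambda>x. f x + g x) S"
  by (simp add: smooth_on_def Ck_on_add)

lemma smooth_on_bounded_bilinear:
  "open S \<Longrightarrow> bounded_bilinear op \<Longrightarrow> smooth_on f S \<Longrightarrow> smooth_on g S \<Longrightarrow> smooth_on (\<lambda>x. op (f x) (g x)) S"
  by (simp add: smooth_on_def Ck_on_bounded_bilinear)

lemmas smooth_on_scaleR = smooth_on_bounded_bilinear[OF _ bounded_bilinear_scaleR]
lemmas smooth_on_inner = smooth_on_bounded_bilinear[OF _ bounded_bilinear_inner]

lemma smooth_on_mult:
  fixes f g :: "'e::real_normed_vector \<Rightarrow> 'b::real_normed_algebra"
  shows "open S \<Longrightarrow> smooth_on f S \<Longrightarrow> smooth_on g S \<Longrightarrow> smooth_on (\<lambda>x. f x * g x) S"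
  by (rule smooth_on_bounded_bilinear[OF _ bounded_bilinear_mult])

lemma smooth_on_of_real: "open S \<Longrightarrow> smooth_on f S \<Longrightarrow> smooth_on (\<lambda>x. complex_of_real (f x)) S"
  using smooth_on_scaleR[of S f "\<lambda>x. 1 :: complex"] by (simp add: smooth_on_const scaleR_conv_of_real)

lemma smooth_on_diff:
  "open S \<Longrightarrow> smooth_on f S \<Longrightarrow> smooth_on g S \<Longrightarrow> smooth_on (\<lambda>x. f x - g x) S"
  using smooth_on_add[of S f "\<lambda>x. (-1) *\<^sub>R g x"] smooth_on_scaleR[of S "\<lambda>x. -1" g] by (simp add: smooth_on_const)

lemma smooth_on_sum:
  "open S \<Longrightarrow> (\<And>i. i \<in> A \<Longrightarrow> smooth_on (f i) S) \<Longrightarrow> smooth_on (\<lambda>x. \<Sum>i\<in>A. f i x) S"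
  by (induction A rule: infinite_finite_induct) (auto intro: smooth_on_const smooth_on_add)

lemma smooth_on_powr:
  fixes f :: "'e::real_normed_vector \<Rightarrow> real"
  shows "open S \<Longrightarrow> (\<And>x. x \<in> S \<Longrightarrow> f x > 0) \<Longrightarrow> smooth_on f S \<Longrightarrow> smooth_on (\<lambda>x. f x powr a) S"
  by (simp add: smooth_on_def Ck_on_powr)

lemma smooth_on_has_derivative:
  "smooth_on f S \<Longrightarrow> x \<in> S \<Longrightarrow> (f has_derivative frechet_derivative f (at x)) (at x)"
  unfolding smooth_on_def using Ck_on_SucD by blast

lemma smooth_on_frechet_derivative:
  "smooth_on f S \<Longrightarrow> smooth_on (\<lambda>x. frechet_derivative f (at x) v) S"
  unfolding smooth_on_def using Ck_on.simps(2) by blast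

text \<open>The moving arguments are expanded in the standard basis one after the other; us collects
  the basis vectors already substituted.\<close>

lemma smooth_on_multilin_apply:
  fixes \<omega> :: "'e::euclidean_space \<Rightarrow> 'e alt"
  assumes "open S" "\<And>y. y \<in> S \<Longrightarrow> multilin (\<omega> y)" "\<And>vs. smooth_on (\<lambda>y. \<omega> y vs) S"
    and "\<And>f. f \<in> set fs \<Longrightarrow> smooth_on f S"
  shows "smooth_on (\<lambda>y. \<omega> y (map (\<lambda>f. f y) fs)) S"
proof -
  have "smooth_on (\<lambda>y. \<omega> y (us @ map (\<lambda>f. f y) fs)) S" for us
    using assms(4)
  proof (induction fs arbitrary: us)
    case Nil
    then show ?case using assms(3) by simp
  next
    case (Cons f fs)
    have "smooth_on (\<lambda>y. \<Sum>b\<in>Basis. (f y \<bullet> b) *\<^sub>R \<omega> y ((us @ [b]) @ map (\<lambda>f. f y) fs)) S"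
      by (intro smooth_on_sum smooth_on_scaleR smooth_on_inner smooth_on_const Cons.IH assms(1))
        (use Cons.prems in auto)
    moreover have "\<omega> y (us @ map (\<lambda>f. f y) (f # fs)) =
      (\<Sum>b\<in>Basis. (f y \<bullet> b) *\<^sub>R \<omega> y ((us @ [b]) @ map (\<lambda>f. f y) fs))" if "y \<in> S" for y
    proof -
      have "\<omega> y (us @ map (\<lambda>f. f y) (f # fs)) = \<omega> y (us @ (\<Sum>b\<in>Basis. (f y \<bullet> b) *\<^sub>R b) # map (\<lambda>f. f y) fs)"
        by (simp add: euclidean_representation)
      then show ?thesis
        by (simp add: multilin_sum multilin_scale assms(2) that scaleR_conv_of_real)
    qed
    ultimately show ?case by (simp cong: smooth_on_cong[OF assms(1)])
  qed
  from this[of "[]"] show ?thesis by simp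
qed

lemma smooth_on_metric_apply:
  fixes g :: "'e::euclidean_space \<Rightarrow> 'e \<Rightarrow> 'e \<Rightarrow> real"
  assumes "open S" "\<And>y. y \<in> S \<Longrightarrow> bilinear (g y)" "\<And>v w. smooth_on (\<lambda>y. g y v w) S"
    and "smooth_on f S" "smooth_on h S"
  shows "smooth_on (\<lambda>y. g y (f y) (h y)) S"
proof -
  have "smooth_on (\<lambda>y. \<Sum>b\<in>Basis. \<Sum>c\<in>Basis. (f y \<bullet> b) * ((h y \<bullet> c) * g y b c)) S"
    by (intro smooth_on_sum smooth_on_mult smooth_on_inner smooth_on_const assms)
  moreover have "g y (f y) (h y) = (\<Sum>b\<in>Basis. \<Sum>c\<in>Basis. (f y \<bullet> b) * ((h y \<bullet> c) * g y b c))" if "y \<in> S" for y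
  proof -
    have "g y (\<Sum>b\<in>Basis. (f y \<bullet> b) *\<^sub>R b) (\<Sum>c\<in>Basis. (h y \<bullet> c) *\<^sub>R c) =
      (\<Sum>(b, c)\<in>Basis \<times> Basis. g y ((f y \<bullet> b) *\<^sub>R b) ((h y \<bullet> c) *\<^sub>R c))"
      by (rule bilinear_sum[OF assms(2)[OF that]])
    then show ?thesis
      by (simp add: euclidean_representation sum.cartesian_product bilinear_lmul[OF assms(2)[OF that]]
          bilinear_rmul[OF assms(2)[OF that]] mult.left_commute)
  qed
  ultimately show ?thesis by (simp cong: smooth_on_cong[OF assms(1)])
qed

text \<open>Gram-Schmidt with the base point as a parameter; the frame is a list of vector-valued
  functions. The clause on spans keeps b outside the span of the earlier vectors, so u never
  vanishes and its length may be divided out smoothly.\<close>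

lemma smooth_orthonormal_list:
  fixes g :: "'e::euclidean_space \<Rightarrow> 'e \<Rightarrow> 'e \<Rightarrow> real"
  assumes "open S" "\<And>y. y \<in> S \<Longrightarrow> inner_product (g y)" "\<And>v w. smooth_on (\<lambda>y. g y v w) S"
    and "independent (set bs)" "distinct bs"
  shows "\<exists>fs. length fs = length bs \<and> (\<forall>f\<in>set fs. smooth_on f S) \<and>
    (\<forall>y\<in>S. orthonormal_list (g y) (map (\<lambda>f. f y) fs) \<and> set (map (\<lambda>f. f y) fs) \<subseteq> span (set bs))"
  using assms(4,5)
proof (induction bs rule: rev_induct)
  case Nil
  then show ?case by (simp add: orthonormal_list_def)
next
  case (snoc b bs)
  have "independent (set bs)" using snoc.prems(1) independent_mono by (metis set_append Un_upper1)
  then obtain fs where fs: "length fs = length bs" "\<And>f. f \<in> set fs \<Longrightarrow> smooth_on f S"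
      "\<And>y. y \<in> S \<Longrightarrow> orthonormal_list (g y) (map (\<lambda>f. f y) fs)"
      "\<And>y. y \<in> S \<Longrightarrow> set (map (\<lambda>f. f y) fs) \<subseteq> span (set bs)"
    using snoc by auto
  have bilinear: "bilinear (g y)" if "y \<in> S" for y
    using assms(2)[OF that] by (rule inner_product.bilinear)
  note smooth_g = smooth_on_metric_apply[OF assms(1) bilinear assms(3)]
  define u where "u y = b - (\<Sum>f\<leftarrow>fs. g y b (f y) *\<^sub>R f y)" for y
  define w where "w y = (g y (u y) (u y)) powr (- 1 / 2) *\<^sub>R u y" for y
  have "smooth_on (\<lambda>y. \<Sum>f\<leftarrow>fs. g y b (f y) *\<^sub>R f y) S"
    using fs(2)
  proof (induction fs)
    case (Cons f fs)
    then show ?case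
      by (auto intro!: smooth_on_add smooth_on_scaleR smooth_g smooth_on_const assms(1))
  qed (simp add: smooth_on_const)
  then have smooth_u: "smooth_on u S"
    unfolding u_def by (intro smooth_on_diff smooth_on_const assms(1))
  have b: "b \<notin> span (set bs)"
    using snoc.prems by (auto simp: independent_insert)
  have u: "u y \<noteq> 0" "u y \<in> span (set (bs @ [b]))" "\<And>f. f \<in> set fs \<Longrightarrow> g y (u y) (f y) = 0" if y: "y \<in> S" for y
  proof -
    let ?es = "map (\<lambda>f. f y) fs"
    have u_eq: "u y = b - (\<Sum>e\<in>set ?es. g y b e *\<^sub>R e)"
      using sum_list_distinct_conv_sum_set[of ?es "\<lambda>e. g y b e *\<^sub>R e"] fs(3)[OF y]
      by (simp add: u_def orthonormal_list_def o_def)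
    have "(\<Sum>e\<in>set ?es. g y b e *\<^sub>R e) \<in> span (set bs)"
      using fs(4)[OF y] by (intro span_sum span_scale) auto
    then have sum: "(\<Sum>e\<in>set ?es. g y b e *\<^sub>R e) \<in> span (set bs)" .
    then show "u y \<noteq> 0" using b unfolding u_eq by (metis eq_iff_diff_eq_0)
    have "(\<Sum>e\<in>set ?es. g y b e *\<^sub>R e) \<in> span (set (bs @ [b]))"
      using sum span_mono[of "set bs" "set (bs @ [b])"] by auto
    then show "u y \<in> span (set (bs @ [b]))" unfolding u_eq by (rule span_diff[OF span_base, rotated]) simp
    show "g y (u y) (f y) = 0" if "f \<in> set fs" for f
      unfolding u_eq by (rule inner_product.orthogonal_remainder[OF assms(2)[OF y] fs(3)[OF y]]) (use that in auto)
  qed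
  have u_pos: "g y (u y) (u y) > 0" if "y \<in> S" for y
    using inner_product.pos[OF assms(2)[OF that] u(1)[OF that]] .
  have smooth_w: "smooth_on w S"
    unfolding w_def by (intro smooth_on_scaleR smooth_on_powr smooth_g smooth_u assms(1) u_pos)
  have on: "orthonormal_list (g y) (map (\<lambda>f. f y) (fs @ [w]))" if y: "y \<in> S" for y
  proof -
    interpret inner_product "g y" by (rule assms(2)[OF y])
    \<comment> \<open>The factor \<open>powr 1\<close> is the squared length of u, written so that
      the exponents add up to 0.\<close>
    have "g y (w y) (w y) = (g y (u y) (u y)) powr (- 1 / 2) * ((g y (u y) (u y)) powr (- 1 / 2) * (g y (u y) (u y)) powr 1)"
      using u_pos[OF y] by (simp add: w_def g_lin)
    also have "\<dots> = 1" using u_pos[OF y] unfolding powr_add[symmetric] by simp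
    finally have ww: "g y (w y) (w y) = 1" .
    have perp: "g y (w y) (f y) = 0" "g y (f y) (w y) = 0" if "f \<in> set fs" for f
      using u(3)[OF y that] sym[of "f y" "w y"] by (simp_all add: w_def g_lin)
    have "f y \<noteq> w y" if "f \<in> set fs" for f
      using perp(1)[OF that] ww by auto
    then show ?thesis using fs(3)[OF y] ww perp by (force simp: orthonormal_list_def)
  qed
  have "set (map (\<lambda>f. f y) (fs @ [w])) \<subseteq> span (set (bs @ [b]))" if "y \<in> S" for y
    using fs(4)[OF that] u(2)[OF that] span_mono[of "set bs" "set (bs @ [b])"]
    by (auto simp: w_def intro: span_scale)
  then show ?case
    using fs(1,2) smooth_w on by (intro exI[of _ "fs @ [w]"]) auto
qed

lemma smooth_orthonormal_frame:
  fixes g :: "'e::euclidean_space \<Rightarrow> 'e \<Rightarrow> 'e \<Rightarrow> real"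
  assumes "open S" "\<And>y. y \<in> S \<Longrightarrow> inner_product (g y)" "\<And>v w. smooth_on (\<lambda>y. g y v w) S"
  obtains fs where "\<And>f. f \<in> set fs \<Longrightarrow> smooth_on f S"
    "\<And>y. y \<in> S \<Longrightarrow> orthonormal_basis (g y) (map (\<lambda>f. f y) fs)"
proof -
  obtain bs :: "'e list" where bs: "set bs = Basis" "distinct bs"
    using finite_distinct_list[OF finite_Basis] by blast
  then have "length bs = DIM('e)" using distinct_card by metis
  then show thesis
    using smooth_orthonormal_list[OF assms, of bs] bs independent_Basis that
    unfolding orthonormal_basis_iff by fastforce
qed

lemma smooth_on_wedge:
  assumes "open S" "\<And>us. smooth_on (\<lambda>y. \<alpha> y us) S" "\<And>us. smooth_on (\<lambda>y. \<beta> y us) S"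
  shows "smooth_on (\<lambda>y. wedge (\<alpha> y) (\<beta> y) vs) S"
  unfolding wedge_def by (intro smooth_on_sum smooth_on_mult smooth_on_const assms)

lemma smooth_on_alt_J:
  fixes \<omega> :: "'e::euclidean_space \<Rightarrow> 'e alt"
  assumes "open S" "\<And>y. y \<in> S \<Longrightarrow> linear (J y)" "\<And>y v. y \<in> S \<Longrightarrow> J y (J y v) = - v"
    and "\<And>v. smooth_on (\<lambda>y. J y v) S"
    and "\<And>y. y \<in> S \<Longrightarrow> \<omega> y \<in> alt_forms" "\<And>vs. smooth_on (\<lambda>y. \<omega> y vs) S"
  shows "smooth_on (\<lambda>y. alt_J (J y) (\<omega> y) vs) S"
proof -
  have "smooth_on (\<lambda>y. \<omega> y (map (\<lambda>f. f y) (map (\<lambda>v y. J y v) vs))) S"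
    by (rule smooth_on_multilin_apply) (use assms in \<open>auto simp: alt_forms_multilin\<close>)
  moreover have "alt_J (J y) (\<omega> y) vs = \<omega> y (map (\<lambda>f. f y) (map (\<lambda>v y. J y v) vs))" if "y \<in> S" for y
    using alt_J_eq[of "J y" "\<omega> y"] assms that by (simp add: o_def)
  ultimately show ?thesis by (simp cong: smooth_on_cong[OF assms(1)])
qed

lemma smooth_on_volume_form:
  fixes g :: "'e::euclidean_space \<Rightarrow> 'e \<Rightarrow> 'e \<Rightarrow> real"
  assumes "open S" "\<And>y. y \<in> S \<Longrightarrow> hermitian_space (g y) (J y) m"
    and "\<And>v w. smooth_on (\<lambda>y. g y v w) S" "\<And>v. smooth_on (\<lambda>y. J y v) S"
  shows "smooth_on (\<lambda>y. volume_form (g y) (J y) vs) S"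
proof -
  have bilinear: "bilinear (g y)" if "y \<in> S" for y
    using assms(2)[OF that] inner_product.bilinear hermitian_space.axioms(1) by blast
  have fundamental: "smooth_on (\<lambda>y. fundamental_form (g y) (J y) us) S" for us
    unfolding fundamental_form_def
    by (cases us rule: remdups_adj.cases; cases "tl (tl us)")
      (auto intro!: smooth_on_const smooth_on_of_real smooth_on_metric_apply assms bilinear)
  have "smooth_on (\<lambda>y. fundamental_power (g y) (J y) j us) S" for j us
    by (induction j arbitrary: us) (auto intro!: smooth_on_const smooth_on_wedge assms(1) fundamental)
  then have "smooth_on (\<lambda>y. (1 / fact m) * fundamental_power (g y) (J y) m vs) S"
    by (intro smooth_on_mult smooth_on_const assms(1))
  moreover have "volume_form (g y) (J y) vs = (1 / fact m) * fundamental_power (g y) (J y) m vs" if "y \<in> S" for y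
    using hermitian_space.volume_form_eq[OF assms(2)[OF that]] by simp
  ultimately show ?thesis by (simp cong: smooth_on_cong[OF assms(1)])
qed

text \<open>By \<open>alt_hodge_eq\<close> the star can be computed in a smooth orthonormal frame,
  where it is a finite sum of products of smooth functions.\<close>

lemma smooth_on_alt_hodge:
  fixes g :: "'e::euclidean_space \<Rightarrow> 'e \<Rightarrow> 'e \<Rightarrow> real"
  assumes "open S" "\<And>y. y \<in> S \<Longrightarrow> hermitian_space (g y) (J y) m"
    and "\<And>v w. smooth_on (\<lambda>y. g y v w) S" "\<And>v. smooth_on (\<lambda>y. J y v) S"
    and "\<And>y. y \<in> S \<Longrightarrow> \<beta> y \<in> alt_forms_deg k" "\<And>vs. smooth_on (\<lambda>y. \<beta> y vs) S"
  shows "smooth_on (\<lambda>y. alt_hodge (g y) (J y) (\<beta> y) ws) S"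
proof -
  obtain fs where fs: "\<And>f. f \<in> set fs \<Longrightarrow> smooth_on f S"
      "\<And>y. y \<in> S \<Longrightarrow> orthonormal_basis (g y) (map (\<lambda>f. f y) fs)"
    using smooth_orthonormal_frame[OF assms(1) _ assms(3), of "\<lambda>v w. v" "\<lambda>v w. w"] assms(2) hermitian_space.axioms(1) by blast
  have \<beta>: "smooth_on (\<lambda>y. \<beta> y (map (\<lambda>f. f y) (nths fs S'))) S" for S'
    by (rule smooth_on_multilin_apply[OF assms(1) _ assms(6)])
      (use fs(1) assms(5) in \<open>auto dest!: in_set_nthsD intro: alt_forms_multilin alt_forms_deg_alt\<close>)
  have "smooth_on (\<lambda>y. volume_form (g y) (J y) (map (\<lambda>f. f y) (nths fs S' @ map (\<lambda>w y. w) ws))) S" for S'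
    by (rule smooth_on_multilin_apply[OF assms(1) _ smooth_on_volume_form[OF assms(1-4)]])
      (use fs(1) hermitian_space.volume_form_alt[OF assms(2)] in
        \<open>auto dest!: in_set_nthsD intro: alt_forms_multilin smooth_on_const\<close>)
  then have vol: "smooth_on (\<lambda>y. volume_form (g y) (J y) (map (\<lambda>f. f y) (nths fs S') @ ws)) S" for S'
    by (simp add: o_def)
  have "smooth_on (\<lambda>y. \<Sum>S'\<in>Pow {..<length fs}. \<beta> y (map (\<lambda>f. f y) (nths fs S')) *
      volume_form (g y) (J y) (map (\<lambda>f. f y) (nths fs S') @ ws)) S"
    by (intro smooth_on_sum smooth_on_mult \<beta> vol assms(1))
  moreover have "alt_hodge (g y) (J y) (\<beta> y) ws = (\<Sum>S'\<in>Pow {..<length fs}. \<beta> y (map (\<lambda>f. f y) (nths fs S')) *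
      volume_form (g y) (J y) (map (\<lambda>f. f y) (nths fs S') @ ws))" if "y \<in> S" for y
    unfolding hermitian_space.alt_hodge_eq[OF assms(2)[OF that] fs(2)[OF that] assms(5)[OF that]]
      hermitian_space.star_def[OF assms(2)[OF that]] alt_pairing_def
    by (simp add: nths_map)
  ultimately show ?thesis by (simp cong: smooth_on_cong[OF assms(1)])
qed

section \<open>The exterior derivative in coordinates\<close>

lemma frechet_derivative_alt_forms_deg:
  fixes \<omega> :: "'e::euclidean_space \<Rightarrow> 'e alt"
  assumes "open S" "y \<in> S" "\<And>z. z \<in> S \<Longrightarrow> \<omega> z \<in> alt_forms_deg k" "\<And>vs. smooth_on (\<lambda>z. \<omega> z vs) S"
  shows "(\<lambda>us. frechet_derivative (\<lambda>z. \<omega> z us) (at y) v) \<in> alt_forms_deg k"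
proof -
  let ?B = "\<lambda>us. frechet_derivative (\<lambda>z. \<omega> z us) (at y)"
  have D: "((\<lambda>z. \<omega> z us) has_derivative ?B us) (at y)" for us
    by (rule smooth_on_has_derivative[OF assms(4,2)])
  have alt: "multilin (\<omega> z)" if "z \<in> S" for z
    using assms(3)[OF that] by (simp add: alt_forms_deg_def alt_forms_multilin)
  have zero: "?B us v = 0" if "\<And>z. z \<in> S \<Longrightarrow> \<omega> z us = 0" for us
    using frechet_derivative_cong_open[OF assms(1,2), of "\<lambda>z. \<omega> z us" "\<lambda>z. 0"] that by simp
  have "multilin (\<lambda>us. ?B us v)"
    unfolding multilin_def
  proof (intro allI linearI)
    fix us ws v1 v2 r
    have "?B (us @ (v1 + v2) # ws) = frechet_derivative (\<lambda>z. \<omega> z (us @ v1 # ws) + \<omega> z (us @ v2 # ws)) (at y)"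
      by (rule frechet_derivative_cong_open[OF assms(1,2)]) (simp add: multilin_add alt)
    also have "\<dots> = (\<lambda>v. ?B (us @ v1 # ws) v + ?B (us @ v2 # ws) v)"
      by (rule frechet_derivative_eq[OF has_derivative_add[OF D D]])
    finally show "?B (us @ (v1 + v2) # ws) v = ?B (us @ v1 # ws) v + ?B (us @ v2 # ws) v" by simp
    have "?B (us @ (r *\<^sub>R v1) # ws) = frechet_derivative (\<lambda>z. r *\<^sub>R \<omega> z (us @ v1 # ws)) (at y)"
      by (rule frechet_derivative_cong_open[OF assms(1,2)]) (simp add: multilin_scale alt scaleR_conv_of_real)
    also have "\<dots> = (\<lambda>v. r *\<^sub>R ?B (us @ v1 # ws) v)"
      by (rule frechet_derivative_eq[OF has_derivative_scaleR_right[OF D]])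
    finally show "?B (us @ (r *\<^sub>R v1) # ws) v = r *\<^sub>R ?B (us @ v1 # ws) v" by simp
  qed
  then have "(\<lambda>us. ?B us v) \<in> alt_forms"
    by (rule alt_formsI) (intro zero alt_forms_adjacent alt_forms_deg_alt[OF assms(3)])
  then show ?thesis
    unfolding alt_forms_deg_def using zero assms(3) by (auto simp: alt_forms_deg_def)
qed

text \<open>Expanding the direction of differentiation in the standard basis gives the sum over b of
  dx_b wedge the partial derivative of \<omega> along b. Each summand is alternating of degree k +
  1.\<close>

lemma exterior_derivative_alt_forms_deg:
  fixes \<omega> :: "'e::euclidean_space \<Rightarrow> 'e alt"
  assumes "open S" "y \<in> S" "\<And>z. z \<in> S \<Longrightarrow> \<omega> z \<in> alt_forms_deg k" "\<And>vs. smooth_on (\<lambda>z. \<omega> z vs) S"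
  shows "(\<lambda>vs. \<Sum>i<length vs. (-1) ^ i *
     frechet_derivative (\<lambda>z. \<omega> z (take i vs @ drop (Suc i) vs)) (at y) (vs ! i)) \<in> alt_forms_deg (Suc k)"
proof -
  let ?B = "\<lambda>us. frechet_derivative (\<lambda>z. \<omega> z us) (at y)"
  define \<xi> where "\<xi> b = (\<lambda>v. complex_of_real (v \<bullet> b))" for b :: 'e
  have D: "linear (?B us)" for us
    using smooth_on_has_derivative[OF assms(4,2)] has_derivative_linear by blast
  have expand: "?B us v = (\<Sum>b\<in>Basis. \<xi> b v * ?B us b)" for us v
  proof -
    have "?B us (\<Sum>b\<in>Basis. (v \<bullet> b) *\<^sub>R b) = (\<Sum>b\<in>Basis. \<xi> b v * ?B us b)"
      by (simp add: linear_sum[OF D] linear_scale[OF D] \<xi>_def scaleR_conv_of_real)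
    then show ?thesis by (simp add: euclidean_representation)
  qed
  have "linear (\<xi> b)" for b
    unfolding \<xi>_def by (rule linearI) (simp_all add: inner_left_distrib scaleR_conv_of_real)
  then have \<xi>: "covector_form (\<xi> b) \<in> alt_forms_deg 1" for b
    using covector_alt_forms[of "\<xi> b"] by (auto simp: alt_forms_deg_def covector_form_def split: list.split)
  have "(\<lambda>vs. \<Sum>b\<in>Basis. wedge (covector_form (\<xi> b)) (\<lambda>us. ?B us b) vs) \<in> alt_forms_deg (1 + k)"
    using wedge_deg[OF \<xi> frechet_derivative_alt_forms_deg[OF assms]]
    by (auto simp: alt_forms_deg_def intro!: alt_forms_sum)
  moreover have "(\<Sum>b\<in>Basis. wedge (covector_form (\<xi> b)) (\<lambda>us. ?B us b) vs) =
      (\<Sum>i<length vs. (-1) ^ i * ?B (take i vs @ drop (Suc i) vs) (vs ! i))" for vs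
    unfolding wedge_covector_sum
    by (subst sum.swap) (simp add: expand[of _ "vs ! _"] sum_distrib_left mult.assoc)
  ultimately show ?thesis by simp
qed

section \<open>Forms on almost Hermitian manifolds\<close>

context hermitian_space
begin

lemma alt_forms_deg_above_eq_0:
  fixes \<beta> :: "'e alt"
  assumes "\<beta> \<in> alt_forms_deg k" "DIM('e) < k"
  shows "\<beta> = (\<lambda>vs. 0)"
proof -
  obtain vs where es: "orthonormal_basis g (J_list J vs)" using J_basis_exists by blast
  show ?thesis
  proof (rule alt_forms_eqI[OF alt_forms_deg_alt[OF assms(1)] alt_forms_zero orthonormal_basis_span[OF es]])
    fix S assume S: "S \<subseteq> {..<length (J_list J vs)}"
    have "length (nths (J_list J vs) S) \<le> DIM('e)"
      using card_mono[OF _ S] es unfolding length_nths_lessThan[OF S] by (simp add: orthonormal_basis_iff)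
    then show "\<beta> (nths (J_list J vs) S) = 0"
      using alt_forms_deg_degree[OF assms(1)] assms(2) by force
  qed
qed

text \<open>Up to the top degree the double star is \<plusminus>1; above it there are no nonzero
  forms. The second case occurs when d has been applied to a form of top degree.\<close>

lemma alt_hodge_eq_0D:
  assumes "\<beta> \<in> alt_forms_deg k" "alt_hodge g J \<beta> = (\<lambda>vs. 0)"
  shows "\<beta> = (\<lambda>vs. 0)"
proof (cases "k \<le> DIM('e)")
  case True
  have "grade \<beta> = (\<lambda>vs. 0)"
    using alt_hodge_alt_hodge[OF assms(1) True] alt_hodge_scale[of 0 "\<lambda>vs. 0"] by (simp add: assms(2))
  then show ?thesis by (simp add: grade_def fun_eq_iff)
qed (use alt_forms_deg_above_eq_0[OF assms(1)] in simp)

lemma alt_hodge_alt_J: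
  assumes "\<beta> \<in> alt_forms_deg k"
  shows "alt_hodge g J (alt_J J \<beta>) = alt_J J (alt_hodge g J \<beta>)"
  using alt_hodge_pullback[OF hermitian_space_axioms hermitian_space_axioms linear_J g_J_J refl assms]
  by (simp add: alt_J_eq[OF linear_J J_J] alt_forms_deg_alt[OF assms] alt_hodge_alt_forms)

end

lemma grade_deg: "\<omega> \<in> alt_forms_deg k \<Longrightarrow> grade \<omega> = (\<lambda>vs. (-1) ^ k * \<omega> vs)"
proof
  fix vs assume "\<omega> \<in> alt_forms_deg k"
  then show "grade \<omega> vs = (-1) ^ k * \<omega> vs"
    using alt_forms_deg_degree[of \<omega> k vs] by (cases "length vs = k") (auto simp: grade_def)
qed

lemma cscale_0 [simp]: "cscale z 0 = 0" "cscale 0 \<alpha> = 0"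
  by (simp_all add: cscale_def zero_fun_def)

lemma cscale_cscale: "cscale z (cscale w \<alpha>) = cscale (z * w) \<alpha>"
  by (simp add: cscale_def mult.assoc)

lemma cscale_1 [simp]: "cscale 1 \<alpha> = \<alpha>"
  by (simp add: cscale_def)

lemma cscale_eq_0_iff [simp]: "cscale z \<alpha> = 0 \<longleftrightarrow> z = 0 \<or> \<alpha> = 0"
  by (auto simp: cscale_def zero_fun_def fun_eq_iff)

lemma on_charts_apply: "c \<in> atlas M \<Longrightarrow> y \<in> chart_image c \<Longrightarrow> on_charts M \<alpha> c y = \<alpha> c y"
  by (simp add: on_charts_def)

lemma on_charts_idem [simp]: "on_charts M (on_charts M \<alpha>) = on_charts M \<alpha>"
  by (simp add: on_charts_def fun_eq_iff)

lemma on_charts_eqI: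
  assumes "on_charts M \<alpha> = \<alpha>" "on_charts M \<beta> = \<beta>"
    and "\<And>c y. c \<in> atlas M \<Longrightarrow> y \<in> chart_image c \<Longrightarrow> \<alpha> c y = \<beta> c y"
  shows "\<alpha> = \<beta>"
proof (intro ext)
  fix c y vs
  have "on_charts M \<alpha> c y vs = on_charts M \<beta> c y vs" using assms(3) by (simp add: on_charts_def)
  then show "\<alpha> c y vs = \<beta> c y vs" using assms(1,2) by simp
qed

text \<open>Families of forms on the chart images without any compatibility on the overlaps: the exterior
  derivative preserves them for trivial reasons, so its naturality is not needed.\<close>

definition local_forms :: "('a, 'e::euclidean_space) almost_hermitian \<Rightarrow> nat \<Rightarrow> ('a, 'e) form set" where
  "local_forms M k = {\<alpha>. on_charts M \<alpha> = \<alpha> \<and>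
     (\<forall>c\<in>atlas M. (\<forall>y\<in>chart_image c. \<alpha> c y \<in> alt_forms_deg k) \<and>
        (\<forall>vs. smooth_on (\<lambda>y. \<alpha> c y vs) (chart_image c)))}"

text \<open>Complex linearity together with the degrees of source and target. It is stable under
  composition, so facts about composites such as d J d J come from those about d and J.\<close>

definition form_map :: "('a, 'e::euclidean_space) almost_hermitian \<Rightarrow> nat \<Rightarrow> nat \<Rightarrow>
    (('a, 'e) form \<Rightarrow> ('a, 'e) form) \<Rightarrow> bool" where
  "form_map M k l L \<longleftrightarrow> (\<forall>\<alpha>\<in>local_forms M k. L \<alpha> \<in> local_forms M l \<and> (\<forall>z. L (cscale z \<alpha>) = cscale z (L \<alpha>)) \<and>
     (\<forall>\<beta>\<in>local_forms M k. L (\<alpha> + \<beta>) = L \<alpha> + L \<beta>))"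

lemma form_mapD:
  assumes "form_map M k l L" "\<alpha> \<in> local_forms M k"
  shows "L \<alpha> \<in> local_forms M l" "L (cscale z \<alpha>) = cscale z (L \<alpha>)"
    "\<beta> \<in> local_forms M k \<Longrightarrow> L (\<alpha> + \<beta>) = L \<alpha> + L \<beta>"
  using assms by (auto simp: form_map_def)

lemma form_map_comp:
  assumes "form_map M k l L" "form_map M l j K"
  shows "form_map M k j (\<lambda>\<alpha>. K (L \<alpha>))"
  using assms by (simp add: form_map_def)

section \<open>Linear operators on forms over an almost Hermitian manifold\<close>

locale hermitian_manifold =
  fixes M :: "('a, 'e::euclidean_space) almost_hermitian" and m :: nat
  assumes manifold: "almost_hermitian_manifold M"
    and DIM: "DIM('e) = 2 * m"
begin

lemma chart_open: "c \<in> atlas M \<Longrightarrow> open (chart_image c)"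
  using manifold by (simp add: almost_hermitian_manifold_def smooth_manifold_def smooth_atlas_def)

lemma hermitian:
  assumes "c \<in> atlas M" "y \<in> chart_image c"
  shows "hermitian_space (metric M c y) (acs M c y) m"
proof -
  note defs = almost_hermitian_manifold_def almost_complex_structure_def riemannian_metric_def
  have "bilinear (metric M c y)" "\<And>v w. metric M c y v w = metric M c y w v"
    "\<And>v. v \<noteq> 0 \<Longrightarrow> metric M c y v v > 0" "linear (acs M c y)" "\<And>v. acs M c y (acs M c y v) = - v"
    "\<And>v w. metric M c y (acs M c y v) (acs M c y w) = metric M c y v w"
    using manifold assms unfolding defs by blast+
  then show ?thesis
    by (simp add: hermitian_space_def hermitian_space_axioms_def inner_product_def DIM)
qed

lemma smooth_metric: "c \<in> atlas M \<Longrightarrow> smooth_on (\<lambda>y. metric M c y v w) (chart_image c)"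
  and smooth_acs: "c \<in> atlas M \<Longrightarrow> smooth_on (\<lambda>y. acs M c y v) (chart_image c)"
  using manifold
  by (simp_all add: almost_hermitian_manifold_def riemannian_metric_def almost_complex_structure_def)

lemmas linear_acs = hermitian_space.linear_J[OF hermitian]
lemmas acs_acs = hermitian_space.J_J[OF hermitian]

lemma overlapE:
  assumes "c \<in> atlas M" "c' \<in> atlas M" "y \<in> overlap c c'"
  shows "y \<in> chart_image c" "transition c c' y \<in> chart_image c'" "linear (trans_deriv c c' y)"
    "acs M c' (transition c c' y) (trans_deriv c c' y v) = trans_deriv c c' y (acs M c y v)"
    "metric M c' (transition c c' y) (trans_deriv c c' y v) (trans_deriv c c' y w) = metric M c y v w"
proof -
  have atlas: "smooth_atlas (mtop M) (atlas M)"
    using manifold by (simp add: almost_hermitian_manifold_def smooth_manifold_def)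
  obtain p where p: "p \<in> fst c" "p \<in> fst c'" "y = snd c p"
    using assms(3) by (auto simp: overlap_def)
  have "openin (mtop M) (fst c)"
    "homeomorphic_map (subtopology (mtop M) (fst c)) (top_of_set (chart_image c)) (snd c)"
    using atlas assms(1) by (auto simp: smooth_atlas_def)
  \<comment> \<open>\<open>transition\<close> is built from \<open>inv_into\<close>; injectivity of
    the chart identifies its value at the image of p.\<close>
  then have "inj_on (snd c) (fst c)"
    using homeomorphic_imp_injective_map[of "subtopology (mtop M) (fst c)"] openin_subset[of "mtop M" "fst c"]
    by (simp add: topspace_subtopology Int_absorb1)
  then have "transition c c' y = snd c' p" using p by (simp add: transition_def)
  then show "y \<in> chart_image c" "transition c c' y \<in> chart_image c'" using p by (auto simp: chart_image_def)
  have "smooth_on (transition c c') (overlap c c')" using atlas assms by (simp add: smooth_atlas_def)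
  then show "linear (trans_deriv c c' y)"
    unfolding trans_deriv_def using smooth_on_has_derivative[OF _ assms(3)] has_derivative_linear by blast
  show "acs M c' (transition c c' y) (trans_deriv c c' y v) = trans_deriv c c' y (acs M c y v)"
    "metric M c' (transition c c' y) (trans_deriv c c' y v) (trans_deriv c c' y w) = metric M c y v w"
    using manifold assms
    by (simp_all add: almost_hermitian_manifold_def riemannian_metric_def almost_complex_structure_def)
qed

lemma local_formsD:
  assumes "\<alpha> \<in> local_forms M k"
  shows "on_charts M \<alpha> = \<alpha>"
    "c \<in> atlas M \<Longrightarrow> y \<in> chart_image c \<Longrightarrow> \<alpha> c y \<in> alt_forms_deg k"
    "c \<in> atlas M \<Longrightarrow> y \<in> chart_image c \<Longrightarrow> \<alpha> c y \<in> alt_forms"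
    "c \<in> atlas M \<Longrightarrow> smooth_on (\<lambda>y. \<alpha> c y vs) (chart_image c)"
  using assms unfolding local_forms_def by (blast intro: alt_forms_deg_alt)+

lemma local_forms_on_charts:
  assumes "\<And>c y. c \<in> atlas M \<Longrightarrow> y \<in> chart_image c \<Longrightarrow> \<alpha> c y \<in> alt_forms_deg k"
    and "\<And>c vs. c \<in> atlas M \<Longrightarrow> smooth_on (\<lambda>y. \<alpha> c y vs) (chart_image c)"
  shows "on_charts M \<alpha> \<in> local_forms M k"
proof -
  have "smooth_on (\<lambda>y. on_charts M \<alpha> c y vs) (chart_image c)" if "c \<in> atlas M" for c vs
    using assms(2)[OF that, of vs] that
    by (simp add: smooth_on_cong[OF chart_open[OF that], of "\<lambda>y. on_charts M \<alpha> c y vs"] on_charts_apply)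
  then show ?thesis using assms(1) by (simp add: local_forms_def on_charts_apply)
qed

lemma on_charts_add: "on_charts M (\<alpha> + \<beta>) = on_charts M \<alpha> + on_charts M \<beta>"
  by (simp add: on_charts_def fun_eq_iff)

lemma on_charts_cscale: "on_charts M (cscale z \<alpha>) = cscale z (on_charts M \<alpha>)"
  by (simp add: on_charts_def cscale_def fun_eq_iff)

lemma local_forms_add:
  assumes "\<alpha> \<in> local_forms M k" "\<beta> \<in> local_forms M k"
  shows "\<alpha> + \<beta> \<in> local_forms M k"
proof -
  have "on_charts M (\<alpha> + \<beta>) \<in> local_forms M k"
    using local_formsD[OF assms(1)] local_formsD[OF assms(2)]
    by (intro local_forms_on_charts)
      (auto simp: alt_forms_deg_def plus_fun_def intro!: alt_forms_add smooth_on_add chart_open)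
  then show ?thesis by (simp add: on_charts_add local_formsD(1)[OF assms(1)] local_formsD(1)[OF assms(2)])
qed

lemma local_forms_cscale:
  assumes "\<alpha> \<in> local_forms M k"
  shows "cscale z \<alpha> \<in> local_forms M k"
proof -
  have "on_charts M (cscale z \<alpha>) \<in> local_forms M k"
    using local_formsD[OF assms]
    by (intro local_forms_on_charts)
      (auto simp: alt_forms_deg_def cscale_def intro!: alt_forms_scale smooth_on_mult smooth_on_const chart_open)
  then show ?thesis by (simp add: on_charts_cscale local_formsD(1)[OF assms])
qed

lemma form_map_pointwise:
  assumes "\<And>\<alpha>. L \<alpha> = on_charts M (\<lambda>c y. T c y (\<alpha> c y))"
    and deg: "\<And>\<omega> c y. c \<in> atlas M \<Longrightarrow> y \<in> chart_image c \<Longrightarrow> \<omega> \<in> alt_forms_deg k \<Longrightarrow> T c y \<omega> \<in> alt_forms_deg l"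
    and smooth: "\<And>\<alpha> c vs. c \<in> atlas M \<Longrightarrow> \<alpha> \<in> local_forms M k \<Longrightarrow> smooth_on (\<lambda>y. T c y (\<alpha> c y) vs) (chart_image c)"
    and scale: "\<And>\<omega> z c y. c \<in> atlas M \<Longrightarrow> y \<in> chart_image c \<Longrightarrow> \<omega> \<in> alt_forms_deg k \<Longrightarrow>
      T c y (\<lambda>vs. z * \<omega> vs) = (\<lambda>vs. z * T c y \<omega> vs)"
    and add: "\<And>\<omega> \<eta> c y. c \<in> atlas M \<Longrightarrow> y \<in> chart_image c \<Longrightarrow> \<omega> \<in> alt_forms_deg k \<Longrightarrow> \<eta> \<in> alt_forms_deg k \<Longrightarrow>
      T c y (\<lambda>vs. \<omega> vs + \<eta> vs) = (\<lambda>vs. T c y \<omega> vs + T c y \<eta> vs)"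
  shows "form_map M k l L"
  unfolding form_map_def
proof (intro ballI conjI allI)
  fix \<alpha> \<beta> z assume \<alpha>: "\<alpha> \<in> local_forms M k"
  show "L \<alpha> \<in> local_forms M l"
    unfolding assms(1) by (intro local_forms_on_charts deg smooth \<alpha> local_formsD(2)[OF \<alpha>])
  show "L (cscale z \<alpha>) = cscale z (L \<alpha>)"
    unfolding assms(1) on_charts_cscale[symmetric] 
    by (rule on_charts_eqI[OF on_charts_idem on_charts_idem])
      (simp add: on_charts_apply cscale_def scale local_formsD(2)[OF \<alpha>])
  assume \<beta>: "\<beta> \<in> local_forms M k"
  show "L (\<alpha> + \<beta>) = L \<alpha> + L \<beta>"
    unfolding assms(1) on_charts_add[symmetric]
    by (rule on_charts_eqI[OF on_charts_idem on_charts_idem])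
      (simp add: on_charts_apply plus_fun_def add local_formsD(2)[OF \<alpha>] local_formsD(2)[OF \<beta>])
qed

lemma form_map_J: "form_map M k k (J_form M)"
proof (rule form_map_pointwise[of _ "\<lambda>c y. alt_J (acs M c y)"])
  fix c y and \<omega> \<eta> :: "'e alt" and z
  assume cy: "c \<in> atlas M" "y \<in> chart_image c"
  note J = alt_J_eq[OF linear_acs[OF cy] acs_acs[OF cy]]
  assume \<omega>: "\<omega> \<in> alt_forms_deg k"
  show "alt_J (acs M c y) \<omega> \<in> alt_forms_deg k"
    using \<omega> alt_J_alt_forms[OF linear_acs[OF cy] acs_acs[OF cy], of \<omega>]
    by (simp add: alt_forms_deg_def J)
  show "alt_J (acs M c y) (\<lambda>vs. z * \<omega> vs) = (\<lambda>vs. z * alt_J (acs M c y) \<omega> vs)"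
    using \<omega> by (simp add: J alt_forms_deg_alt alt_forms_scale)
  assume "\<eta> \<in> alt_forms_deg k"
  then show "alt_J (acs M c y) (\<lambda>vs. \<omega> vs + \<eta> vs) = (\<lambda>vs. alt_J (acs M c y) \<omega> vs + alt_J (acs M c y) \<eta> vs)"
    using \<omega> by (simp add: J alt_forms_deg_alt alt_forms_add)
next
  fix c \<alpha> vs assume "c \<in> atlas M" "\<alpha> \<in> local_forms M k"
  then show "smooth_on (\<lambda>y. alt_J (acs M c y) (\<alpha> c y) vs) (chart_image c)"
    by (intro smooth_on_alt_J chart_open linear_acs acs_acs smooth_acs local_formsD(3,4))
qed (simp add: J_form_def)

lemma form_map_hodge:
  assumes "k \<le> 2 * m"
  shows "form_map M k (2 * m - k) (hodge M)"
proof (rule form_map_pointwise[of _ "\<lambda>c y. alt_hodge (metric M c y) (acs M c y)"])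
  fix c y and \<omega> \<eta> :: "'e alt" and z
  assume cy: "c \<in> atlas M" "y \<in> chart_image c"
  interpret hermitian_space "metric M c y" "acs M c y" m by (rule hermitian[OF cy])
  show "alt_hodge (metric M c y) (acs M c y) \<omega> \<in> alt_forms_deg (2 * m - k)" if "\<omega> \<in> alt_forms_deg k"
    using alt_hodge_deg[OF that] assms by (simp add: DIM)
  show "alt_hodge (metric M c y) (acs M c y) (\<lambda>vs. z * \<omega> vs) = (\<lambda>vs. z * alt_hodge (metric M c y) (acs M c y) \<omega> vs)"
    by (rule alt_hodge_scale)
  show "alt_hodge (metric M c y) (acs M c y) (\<lambda>vs. \<omega> vs + \<eta> vs) =
      (\<lambda>vs. alt_hodge (metric M c y) (acs M c y) \<omega> vs + alt_hodge (metric M c y) (acs M c y) \<eta> vs)"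
    by (rule alt_hodge_add)
next
  fix c \<alpha> vs assume "c \<in> atlas M" "\<alpha> \<in> local_forms M k"
  then show "smooth_on (\<lambda>y. alt_hodge (metric M c y) (acs M c y) (\<alpha> c y) vs) (chart_image c)"
    by (intro smooth_on_alt_hodge[OF _ hermitian] chart_open smooth_metric smooth_acs local_formsD(2,4))
qed (simp add: hodge_def)

lemma form_map_ext_d: "form_map M k (Suc k) (ext_d M)"
  unfolding form_map_def
proof (intro ballI conjI allI)
  fix \<alpha> \<beta> z assume \<alpha>: "\<alpha> \<in> local_forms M k"
  show "ext_d M \<alpha> \<in> local_forms M (Suc k)"
    unfolding ext_d_def
  proof (rule local_forms_on_charts)
    fix c vs assume c: "c \<in> atlas M"
    show "smooth_on (\<lambda>y. \<Sum>i<length vs. (-1) ^ i * frechet_derivative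
       (\<lambda>z. \<alpha> c z (take i vs @ drop (Suc i) vs)) (at y) (vs ! i)) (chart_image c)"
      by (intro smooth_on_sum smooth_on_mult smooth_on_const smooth_on_frechet_derivative
          local_formsD(4)[OF \<alpha>] chart_open c)
    fix y assume y: "y \<in> chart_image c"
    show "(\<lambda>vs. \<Sum>i<length vs. (-1) ^ i * frechet_derivative
       (\<lambda>z. \<alpha> c z (take i vs @ drop (Suc i) vs)) (at y) (vs ! i)) \<in> alt_forms_deg (Suc k)"
      by (rule exterior_derivative_alt_forms_deg[OF chart_open[OF c] y local_formsD(2)[OF \<alpha> c] local_formsD(4)[OF \<alpha> c]])
  qed
  have D: "((\<lambda>y. \<gamma> c y us) has_derivative frechet_derivative (\<lambda>y. \<gamma> c y us) (at y)) (at y)"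
    if "\<gamma> \<in> local_forms M k" "c \<in> atlas M" "y \<in> chart_image c" for \<gamma> c y us
    using smooth_on_has_derivative[OF local_formsD(4)[OF that(1,2)] that(3)] .
  have scale: "frechet_derivative (\<lambda>y. cscale z \<alpha> c y us) (at y) = (\<lambda>v. z * frechet_derivative (\<lambda>y. \<alpha> c y us) (at y) v)"
    if "c \<in> atlas M" "y \<in> chart_image c" for c y us
    unfolding cscale_def by (rule frechet_derivative_eq[OF has_derivative_mult_right[OF D[OF \<alpha> that]]])
  show "ext_d M (cscale z \<alpha>) = cscale z (ext_d M \<alpha>)"
    unfolding ext_d_def on_charts_cscale[symmetric]
    by (rule on_charts_eqI[OF on_charts_idem on_charts_idem])
      (simp add: on_charts_apply scale, simp add: cscale_def sum_distrib_left mult.left_commute)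
  assume \<beta>: "\<beta> \<in> local_forms M k"
  have add: "frechet_derivative (\<lambda>y. (\<alpha> + \<beta>) c y us) (at y) =
      (\<lambda>v. frechet_derivative (\<lambda>y. \<alpha> c y us) (at y) v + frechet_derivative (\<lambda>y. \<beta> c y us) (at y) v)"
    if "c \<in> atlas M" "y \<in> chart_image c" for c y us
    unfolding plus_fun_def by (rule frechet_derivative_eq[OF has_derivative_add[OF D[OF \<alpha> that] D[OF \<beta> that]]])
  show "ext_d M (\<alpha> + \<beta>) = ext_d M \<alpha> + ext_d M \<beta>"
    unfolding ext_d_def on_charts_add[symmetric]
    by (rule on_charts_eqI[OF on_charts_idem on_charts_idem])
      (simp add: on_charts_apply add del: plus_fun_apply, simp add: fun_eq_iff distrib_left sum.distrib)
qed

lemma J_form_J_form: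
  assumes "\<alpha> \<in> local_forms M k"
  shows "J_form M (J_form M \<alpha>) = cscale ((-1) ^ k) \<alpha>"
proof (rule on_charts_eqI)
  fix c y assume cy: "c \<in> atlas M" "y \<in> chart_image c"
  show "J_form M (J_form M \<alpha>) c y = cscale ((-1) ^ k) \<alpha> c y"
    using alt_J_alt_J[OF linear_acs[OF cy] acs_acs[OF cy] local_formsD(3)[OF assms cy]]
      grade_deg[OF local_formsD(2)[OF assms cy]]
    by (simp add: J_form_def on_charts_apply cy cscale_def)
qed (simp_all add: J_form_def on_charts_cscale local_formsD(1)[OF assms])

lemma J_form_inv_eq:
  assumes "\<alpha> \<in> local_forms M k"
  shows "J_form_inv M \<alpha> = cscale ((-1) ^ k) (J_form M \<alpha>)"
proof (rule on_charts_eqI)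
  fix c y assume cy: "c \<in> atlas M" "y \<in> chart_image c"
  have "alt_J (acs M c y) (\<alpha> c y) \<in> alt_forms_deg k"
    using local_formsD(2)[OF form_mapD(1)[OF form_map_J assms] cy] by (simp add: J_form_def on_charts_apply cy)
  then show "J_form_inv M \<alpha> c y = cscale ((-1) ^ k) (J_form M \<alpha>) c y"
    using alt_J_inv_eq[OF linear_acs[OF cy] acs_acs[OF cy] local_formsD(3)[OF assms cy]]
    by (simp add: J_form_def J_form_inv_def on_charts_apply cy cscale_def grade_deg)
qed (simp_all add: J_form_def J_form_inv_def on_charts_cscale)

lemma hodge_hodge:
  assumes "\<alpha> \<in> local_forms M k" "k \<le> 2 * m"
  shows "hodge M (hodge M \<alpha>) = cscale ((-1) ^ k) \<alpha>"
proof (rule on_charts_eqI)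
  fix c y assume cy: "c \<in> atlas M" "y \<in> chart_image c"
  interpret hermitian_space "metric M c y" "acs M c y" m by (rule hermitian[OF cy])
  show "hodge M (hodge M \<alpha>) c y = cscale ((-1) ^ k) \<alpha> c y"
    using alt_hodge_alt_hodge[OF local_formsD(2)[OF assms(1) cy]] grade_deg[OF local_formsD(2)[OF assms(1) cy]]
      assms(2) by (simp add: hodge_def on_charts_apply cy cscale_def DIM)
qed (simp_all add: hodge_def on_charts_cscale local_formsD(1)[OF assms(1)])

lemma hodge_J_form:
  assumes "\<alpha> \<in> local_forms M k"
  shows "hodge M (J_form M \<alpha>) = J_form M (hodge M \<alpha>)"
proof (rule on_charts_eqI)
  fix c y assume cy: "c \<in> atlas M" "y \<in> chart_image c"
  interpret hermitian_space "metric M c y" "acs M c y" m by (rule hermitian[OF cy])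
  show "hodge M (J_form M \<alpha>) c y = J_form M (hodge M \<alpha>) c y"
    using alt_hodge_alt_J[OF local_formsD(2)[OF assms cy]]
    by (simp add: hodge_def J_form_def on_charts_apply cy)
qed (simp_all add: hodge_def J_form_def)

lemma hodge_eq_0_iff:
  assumes "\<alpha> \<in> local_forms M k"
  shows "hodge M \<alpha> = 0 \<longleftrightarrow> \<alpha> = 0"
proof
  assume 0: "hodge M \<alpha> = 0"
  show "\<alpha> = 0"
  proof (rule on_charts_eqI)
    fix c y assume cy: "c \<in> atlas M" "y \<in> chart_image c"
    have "alt_hodge (metric M c y) (acs M c y) (\<alpha> c y) = (\<lambda>vs. 0)"
      using fun_cong[OF fun_cong[OF 0, of c], of y] cy by (simp add: hodge_def on_charts_apply zero_fun_def)
    from hermitian_space.alt_hodge_eq_0D[OF hermitian[OF cy] local_formsD(2)[OF assms cy] this]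
    show "\<alpha> c y = 0 c y" by (simp add: zero_fun_def)
  qed (simp_all add: local_formsD(1)[OF assms], simp add: on_charts_def zero_fun_def fun_eq_iff)
next
  assume \<alpha>: "\<alpha> = 0"
  show "hodge M \<alpha> = 0"
  proof (rule on_charts_eqI)
    fix c y assume cy: "c \<in> atlas M" "y \<in> chart_image c"
    show "hodge M \<alpha> c y = 0 c y"
      using hermitian_space.alt_hodge_scale[OF hermitian[OF cy], of 0 "\<lambda>vs. 0"] cy
      by (simp add: \<alpha> hodge_def on_charts_apply zero_fun_def)
  qed (simp_all add: hodge_def, simp add: on_charts_def zero_fun_def fun_eq_iff)
qed

section \<open>Compatibility with changes of charts\<close>

lemma forms_local: "forms M k \<subseteq> local_forms M k"
  by (auto simp: forms_def local_forms_def)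

lemma formsI:
  assumes "\<alpha> \<in> local_forms M k"
    and "\<And>c c' y vs. \<lbrakk>c \<in> atlas M; c' \<in> atlas M; y \<in> overlap c c'\<rbrakk> \<Longrightarrow>
        \<alpha> c' (transition c c' y) (map (trans_deriv c c' y) vs) = \<alpha> c y vs"
  shows "\<alpha> \<in> forms M k"
  using assms by (auto simp: forms_def local_forms_def)

lemma forms_transition:
  "\<lbrakk>\<alpha> \<in> forms M k; c \<in> atlas M; c' \<in> atlas M; y \<in> overlap c c'\<rbrakk> \<Longrightarrow>
    \<alpha> c' (transition c c' y) (map (trans_deriv c c' y) vs) = \<alpha> c y vs"
  by (simp add: forms_def)

lemma forms_subspace: "complex_subspace (forms M k)"
  unfolding complex_subspace_def
proof (intro conjI ballI allI)
  have "0 \<in> local_forms M k"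
    by (auto simp: local_forms_def alt_forms_deg_def on_charts_def zero_fun_def smooth_on_const
        alt_forms_zero fun_eq_iff)
  then show "0 \<in> forms M k" by (rule formsI) simp
  fix \<alpha> \<beta> z assume \<alpha>: "\<alpha> \<in> forms M k"
  show "cscale z \<alpha> \<in> forms M k"
    by (rule formsI) (use \<alpha> forms_local forms_transition[OF \<alpha>] in \<open>auto intro: local_forms_cscale, simp add: cscale_def\<close>)
  assume \<beta>: "\<beta> \<in> forms M k"
  show "\<alpha> + \<beta> \<in> forms M k"
    by (rule formsI)
      (use \<alpha> \<beta> forms_local forms_transition[OF \<alpha>] forms_transition[OF \<beta>] in \<open>auto intro: local_forms_add\<close>)
qed

text \<open>As J is a pullback, the claim is that the derivative of the transition map intertwines
  the two almost complex structures.\<close>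

lemma J_form_forms:
  assumes "\<alpha> \<in> forms M k"
  shows "J_form M \<alpha> \<in> forms M k"
proof (rule formsI)
  have \<alpha>: "\<alpha> \<in> local_forms M k" using assms forms_local by blast
  then show "J_form M \<alpha> \<in> local_forms M k" by (rule form_mapD(1)[OF form_map_J])
  fix c c' y vs assume o: "c \<in> atlas M" "c' \<in> atlas M" "y \<in> overlap c c'"
  have J: "J_form M \<alpha> c y vs = \<alpha> c y (map (acs M c y) vs)"
    if "c \<in> atlas M" "y \<in> chart_image c" for c y vs
    using that by (simp add: J_form_def on_charts_apply
        alt_J_eq[OF linear_acs[OF that] acs_acs[OF that] local_formsD(3)[OF \<alpha> that]])
  show "J_form M \<alpha> c' (transition c c' y) (map (trans_deriv c c' y) vs) = J_form M \<alpha> c y vs"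
    using forms_transition[OF assms o, of "map (acs M c y) vs"]
    by (simp add: J o overlapE[OF o] o_def)
qed

lemma hodge_forms:
  assumes "\<alpha> \<in> forms M k" "k \<le> 2 * m"
  shows "hodge M \<alpha> \<in> forms M (2 * m - k)"
proof (rule formsI)
  have \<alpha>: "\<alpha> \<in> local_forms M k" using assms forms_local by blast
  then show "hodge M \<alpha> \<in> local_forms M (2 * m - k)" by (rule form_mapD(1)[OF form_map_hodge[OF assms(2)]])
  fix c c' y vs assume o: "c \<in> atlas M" "c' \<in> atlas M" "y \<in> overlap c c'"
  let ?y' = "transition c c' y" and ?D = "trans_deriv c c' y"
  have "\<alpha> c y = (\<lambda>vs. \<alpha> c' ?y' (map ?D vs))" using forms_transition[OF assms(1) o] by auto
  then have "alt_hodge (metric M c y) (acs M c y) (\<alpha> c y) =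
      (\<lambda>ws. alt_hodge (metric M c' ?y') (acs M c' ?y') (\<alpha> c' ?y') (map ?D ws))"
    using alt_hodge_pullback[OF hermitian[OF o(1) overlapE(1)[OF o]] hermitian[OF o(2) overlapE(2)[OF o]]
        overlapE(3,5,4)[OF o] local_formsD(2)[OF \<alpha> o(2) overlapE(2)[OF o]]] by simp
  then show "hodge M \<alpha> c' ?y' (map ?D vs) = hodge M \<alpha> c y vs"
    by (simp add: hodge_def on_charts_apply o overlapE[OF o])
qed

section \<open>The harmonic spaces as kernels, and the isomorphisms\<close>

abbreviation "d \<equiv> ext_d M"
abbreviation "J \<equiv> J_form M"

lemma J_eq_0_iff: "\<alpha> \<in> local_forms M k \<Longrightarrow> J \<alpha> = 0 \<longleftrightarrow> \<alpha> = 0"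
proof
  assume \<alpha>: "\<alpha> \<in> local_forms M k"
  have "J 0 = 0" using form_mapD(2)[OF form_map_J \<alpha>, of 0] by simp
  then show "J \<alpha> = 0 \<Longrightarrow> \<alpha> = 0" "\<alpha> = 0 \<Longrightarrow> J \<alpha> = 0" using J_form_J_form[OF \<alpha>] by auto
qed

text \<open>The exponent is k + 1 because the inverse of J acts on d J \<alpha>, which has degree k
  + 1.\<close>

lemma d_c_eq: "\<alpha> \<in> local_forms M k \<Longrightarrow> d_c M \<alpha> = cscale ((-1) ^ Suc k) (J (d (J \<alpha>)))"
  unfolding d_c_def o_def
  by (intro J_form_inv_eq form_mapD(1)[OF form_map_ext_d] form_mapD(1)[OF form_map_J])

lemma d_c_eq_0_iff: "\<alpha> \<in> local_forms M k \<Longrightarrow> d_c M \<alpha> = 0 \<longleftrightarrow> d (J \<alpha>) = 0"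
  using J_eq_0_iff[OF form_mapD(1)[OF form_map_ext_d form_mapD(1)[OF form_map_J]]]
  by (simp add: d_c_eq)

lemma d_d_c_eq_0_iff: "\<alpha> \<in> local_forms M k \<Longrightarrow> d (d_c M \<alpha>) = 0 \<longleftrightarrow> d (J (d (J \<alpha>))) = 0"
  using form_mapD(2)[OF form_map_ext_d form_mapD(1)[OF form_map_comp[OF form_map_comp[OF form_map_J form_map_ext_d] form_map_J]]]
  by (simp add: d_c_eq)

lemma form_map_d_c: "form_map M k (Suc k) (d_c M)"
proof -
  have JdJ: "form_map M k (Suc k) (\<lambda>\<alpha>. J (d (J \<alpha>)))"
    by (intro form_map_comp[OF form_map_comp[OF form_map_J form_map_ext_d] form_map_J])
  have "d_c M (cscale z \<alpha>) = cscale z (d_c M \<alpha>)" if "\<alpha> \<in> local_forms M k" for \<alpha> z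
    unfolding d_c_eq[OF that] d_c_eq[OF local_forms_cscale[OF that]] form_mapD(2)[OF JdJ that]
    by (simp add: cscale_cscale mult.commute)
  moreover have "d_c M (\<alpha> + \<beta>) = d_c M \<alpha> + d_c M \<beta>"
    if "\<alpha> \<in> local_forms M k" "\<beta> \<in> local_forms M k" for \<alpha> \<beta>
    unfolding d_c_eq[OF that(1)] d_c_eq[OF that(2)] d_c_eq[OF local_forms_add[OF that]] form_mapD(3)[OF JdJ that]
    by (simp add: cscale_def fun_eq_iff distrib_left)
  moreover have "d_c M \<alpha> \<in> local_forms M (Suc k)" if "\<alpha> \<in> local_forms M k" for \<alpha>
    unfolding d_c_eq[OF that] by (intro local_forms_cscale form_mapD(1)[OF JdJ that])
  ultimately show ?thesis by (simp add: form_map_def)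
qed

lemma star_adjoint_eq_0_iff:
  assumes "k \<le> 2 * m" "form_map M (2 * m - k) l P" "\<alpha> \<in> local_forms M k"
  shows "star_adjoint M P \<alpha> = 0 \<longleftrightarrow> P (hodge M \<alpha>) = 0"
  unfolding star_adjoint_def
  using hodge_eq_0_iff[OF form_mapD(1)[OF assms(2) form_mapD(1)[OF form_map_hodge[OF assms(1)] assms(3)]]]
  by simp

lemma harmonic_eqs:
  assumes "k \<le> 2 * m"
  shows "harmonic_d_plus_dc M k = {\<alpha> \<in> forms M k. d \<alpha> = 0 \<and> d (J \<alpha>) = 0 \<and> d (J (d (J (hodge M \<alpha>)))) = 0}"
    and "harmonic_dc_plus_d M k = {\<alpha> \<in> forms M k. d \<alpha> = 0 \<and> d (J \<alpha>) = 0 \<and> d (J (d (hodge M \<alpha>))) = 0}"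
    and "harmonic_d_dc M k = {\<alpha> \<in> forms M k. d (hodge M \<alpha>) = 0 \<and> d (J (hodge M \<alpha>)) = 0 \<and> d (J (d (J \<alpha>))) = 0}"
    and "harmonic_dc_d M k = {\<alpha> \<in> forms M k. d (hodge M \<alpha>) = 0 \<and> d (J (hodge M \<alpha>)) = 0 \<and> d (J (d \<alpha>)) = 0}"
proof -
  have *: "d_c M \<alpha> = 0 \<longleftrightarrow> d (J \<alpha>) = 0" "d (d_c M \<alpha>) = 0 \<longleftrightarrow> d (J (d (J \<alpha>))) = 0"
    "d_c M (d \<alpha>) = 0 \<longleftrightarrow> d (J (d \<alpha>)) = 0"
    "star_adjoint M d \<alpha> = 0 \<longleftrightarrow> d (hodge M \<alpha>) = 0"
    "star_adjoint M (d_c M) \<alpha> = 0 \<longleftrightarrow> d (J (hodge M \<alpha>)) = 0"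
    "star_adjoint M (d \<circ> d_c M) \<alpha> = 0 \<longleftrightarrow> d (J (d (J (hodge M \<alpha>)))) = 0"
    "star_adjoint M (d_c M \<circ> d) \<alpha> = 0 \<longleftrightarrow> d (J (d (hodge M \<alpha>))) = 0"
    if "\<alpha> \<in> forms M k" for \<alpha>
  proof -
    have \<alpha>: "\<alpha> \<in> local_forms M k" using that forms_local by blast
    note h = form_mapD(1)[OF form_map_hodge[OF assms] \<alpha>]
    note dd = form_map_ext_d[of "2 * m - k"] form_map_d_c[of "2 * m - k"]
    have comp: "form_map M (2 * m - k) (Suc (Suc (2 * m - k))) (d \<circ> d_c M)"
      "form_map M (2 * m - k) (Suc (Suc (2 * m - k))) (d_c M \<circ> d)"
      unfolding o_def
      by (rule form_map_comp[OF form_map_d_c form_map_ext_d], rule form_map_comp[OF form_map_ext_d form_map_d_c])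
    show "d_c M \<alpha> = 0 \<longleftrightarrow> d (J \<alpha>) = 0" "d (d_c M \<alpha>) = 0 \<longleftrightarrow> d (J (d (J \<alpha>))) = 0"
      "d_c M (d \<alpha>) = 0 \<longleftrightarrow> d (J (d \<alpha>)) = 0"
      using d_c_eq_0_iff[OF \<alpha>] d_d_c_eq_0_iff[OF \<alpha>] d_c_eq_0_iff[OF form_mapD(1)[OF form_map_ext_d \<alpha>]] by auto
    show "star_adjoint M d \<alpha> = 0 \<longleftrightarrow> d (hodge M \<alpha>) = 0"
      "star_adjoint M (d_c M) \<alpha> = 0 \<longleftrightarrow> d (J (hodge M \<alpha>)) = 0"
      "star_adjoint M (d \<circ> d_c M) \<alpha> = 0 \<longleftrightarrow> d (J (d (J (hodge M \<alpha>)))) = 0"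
      "star_adjoint M (d_c M \<circ> d) \<alpha> = 0 \<longleftrightarrow> d (J (d (hodge M \<alpha>))) = 0"
      using star_adjoint_eq_0_iff[OF assms dd(1) \<alpha>] star_adjoint_eq_0_iff[OF assms dd(2) \<alpha>]
        star_adjoint_eq_0_iff[OF assms comp(1) \<alpha>] star_adjoint_eq_0_iff[OF assms comp(2) \<alpha>]
        d_c_eq_0_iff[OF h] d_d_c_eq_0_iff[OF h] d_c_eq_0_iff[OF form_mapD(1)[OF form_map_ext_d h]] by auto
  qed
  show "harmonic_d_plus_dc M k = {\<alpha> \<in> forms M k. d \<alpha> = 0 \<and> d (J \<alpha>) = 0 \<and> d (J (d (J (hodge M \<alpha>)))) = 0}"
    "harmonic_dc_plus_d M k = {\<alpha> \<in> forms M k. d \<alpha> = 0 \<and> d (J \<alpha>) = 0 \<and> d (J (d (hodge M \<alpha>))) = 0}"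
    "harmonic_d_dc M k = {\<alpha> \<in> forms M k. d (hodge M \<alpha>) = 0 \<and> d (J (hodge M \<alpha>)) = 0 \<and> d (J (d (J \<alpha>))) = 0}"
    "harmonic_dc_d M k = {\<alpha> \<in> forms M k. d (hodge M \<alpha>) = 0 \<and> d (J (hodge M \<alpha>)) = 0 \<and> d (J (d \<alpha>)) = 0}"
    unfolding harmonic_d_plus_dc_def harmonic_dc_plus_d_def harmonic_d_dc_def harmonic_dc_d_def
    by (auto simp: *)
qed

lemma kernel_subspace:
  assumes "complex_subspace V" "V \<subseteq> local_forms M k" "form_map M k l L"
  shows "complex_subspace {\<alpha> \<in> V. L \<alpha> = 0}"
proof -
  have "L 0 = 0"
    using assms form_mapD(2)[OF assms(3), of 0 0] by (auto simp: complex_subspace_def)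
  then show ?thesis
    using assms by (auto simp: complex_subspace_def subset_iff form_mapD[OF assms(3)])
qed

text \<open>The conditions defining one harmonic space take values in forms of different degrees,
  hence the separate target degrees.\<close>

lemma kernel3_subspace:
  assumes "form_map M k l1 L1" "form_map M k l2 L2" "form_map M k l3 L3"
  shows "complex_subspace {\<alpha> \<in> forms M k. L1 \<alpha> = 0 \<and> L2 \<alpha> = 0 \<and> L3 \<alpha> = 0}"
proof -
  have "complex_subspace {\<alpha> \<in> {\<alpha> \<in> {\<alpha> \<in> forms M k. L1 \<alpha> = 0}. L2 \<alpha> = 0}. L3 \<alpha> = 0}"
    by (intro kernel_subspace[OF kernel_subspace[OF kernel_subspace[OF forms_subspace forms_local assms(1)] _ assms(2)] _ assms(3)])
      (use forms_local in auto)
  moreover have "{\<alpha> \<in> {\<alpha> \<in> {\<alpha> \<in> forms M k. L1 \<alpha> = 0}. L2 \<alpha> = 0}. L3 \<alpha> = 0} =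
      {\<alpha> \<in> forms M k. L1 \<alpha> = 0 \<and> L2 \<alpha> = 0 \<and> L3 \<alpha> = 0}" by auto
  ultimately show ?thesis by simp
qed

lemma harmonic_subspace:
  assumes "k \<le> 2 * m"
  shows "complex_subspace (harmonic_d_plus_dc M k)" "complex_subspace (harmonic_dc_plus_d M k)"
    "complex_subspace (harmonic_d_dc M k)" "complex_subspace (harmonic_dc_d M k)"
proof -
  note h = form_map_hodge[OF assms]
  note dJ = form_map_comp[OF form_map_J form_map_ext_d]
  note dJd = form_map_comp[OF form_map_ext_d dJ]
  note dJdJ = form_map_comp[OF form_map_J dJd]
  show "complex_subspace (harmonic_d_plus_dc M k)" "complex_subspace (harmonic_dc_plus_d M k)"
    "complex_subspace (harmonic_d_dc M k)" "complex_subspace (harmonic_dc_d M k)"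
    unfolding harmonic_eqs[OF assms]
    by (rule kernel3_subspace[OF form_map_ext_d dJ form_map_comp[OF h dJdJ]],
      rule kernel3_subspace[OF form_map_ext_d dJ form_map_comp[OF h dJd]],
      rule kernel3_subspace[OF form_map_comp[OF h form_map_ext_d] form_map_comp[OF h dJ] dJdJ],
      rule kernel3_subspace[OF form_map_comp[OF h form_map_ext_d] form_map_comp[OF h dJ] dJd])
qed

text \<open>The inverse is s times f. Thus mapping each space into the other already gives
  bijectivity.\<close>

lemma involution_iso:
  assumes "complex_subspace V" "complex_subspace W" "f ` V \<subseteq> W" "f ` W \<subseteq> V"
    and "V \<subseteq> local_forms M k" "W \<subseteq> local_forms M l" "form_map M k l f" "form_map M l k f"
    and "s * s = 1" "\<And>\<alpha>. \<alpha> \<in> V \<union> W \<Longrightarrow> f (f \<alpha>) = cscale s \<alpha>"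
  shows "complex_linear_iso V W f"
proof -
  have "bij_betw f V W"
  proof (rule bij_betw_byWitness[of _ "\<lambda>\<beta>. cscale s (f \<beta>)"])
    show "\<forall>\<alpha>\<in>V. cscale s (f (f \<alpha>)) = \<alpha>"
      using assms(9,10) by (simp add: cscale_cscale)
    show "\<forall>\<beta>\<in>W. f (cscale s (f \<beta>)) = \<beta>"
      using assms(4-6,9,10) form_mapD(2)[OF assms(7)] by (auto simp: cscale_cscale subset_iff)
    show "f ` V \<subseteq> W" "(\<lambda>\<beta>. cscale s (f \<beta>)) ` W \<subseteq> V"
      using assms(1,3,4) by (auto simp: complex_subspace_def)
  qed
  then show ?thesis
    using assms(1,2,5) form_mapD[OF assms(7)] by (auto simp: complex_linear_iso_def subset_iff)
qed

text \<open>Serves to pull the signs of J^2 and of the double star out of the kernel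
  conditions.\<close>

lemma operator_scale:
  assumes "\<alpha> \<in> local_forms M k"
  shows "d (cscale z \<alpha>) = cscale z (d \<alpha>)" "d (J (cscale z \<alpha>)) = cscale z (d (J \<alpha>))"
    "d (J (d (cscale z \<alpha>))) = cscale z (d (J (d \<alpha>)))"
    "d (J (d (J (cscale z \<alpha>)))) = cscale z (d (J (d (J \<alpha>))))"
proof -
  note dJ = form_map_comp[OF form_map_J form_map_ext_d]
  note dJd = form_map_comp[OF form_map_ext_d dJ]
  show "d (cscale z \<alpha>) = cscale z (d \<alpha>)" "d (J (cscale z \<alpha>)) = cscale z (d (J \<alpha>))"
    "d (J (d (cscale z \<alpha>))) = cscale z (d (J (d \<alpha>)))"
    "d (J (d (J (cscale z \<alpha>)))) = cscale z (d (J (d (J \<alpha>))))"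
    using form_mapD(2)[OF form_map_ext_d assms] form_mapD(2)[OF dJ assms] form_mapD(2)[OF dJd assms]
      form_mapD(2)[OF form_map_comp[OF form_map_J dJd] assms] by auto
qed

lemma harmonic_forms:
  "harmonic_d_plus_dc M k \<subseteq> local_forms M k" "harmonic_dc_plus_d M k \<subseteq> local_forms M k"
  "harmonic_d_dc M k \<subseteq> local_forms M k" "harmonic_dc_d M k \<subseteq> local_forms M k"
  using forms_local
  by (auto simp: harmonic_d_plus_dc_def harmonic_dc_plus_d_def harmonic_d_dc_def harmonic_dc_d_def)

text \<open>Since J^2 = \<plusminus>1, substituting J \<alpha> for \<alpha> exchanges the kernel of
  d with that of d J, and the kernel of d J d with that of d J d J. On the Hodge dual the same
  happens because J commutes with the star.\<close>

lemma J_harmonic: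
  assumes "k \<le> 2 * m"
  shows "J ` harmonic_d_plus_dc M k \<subseteq> harmonic_dc_plus_d M k" "J ` harmonic_dc_plus_d M k \<subseteq> harmonic_d_plus_dc M k"
    "J ` harmonic_d_dc M k \<subseteq> harmonic_dc_d M k" "J ` harmonic_dc_d M k \<subseteq> harmonic_d_dc M k"
proof -
  have "hodge M (J \<alpha>) = J (hodge M \<alpha>)" "J (J \<alpha>) = cscale ((-1) ^ k) \<alpha>"
    "J (J (hodge M \<alpha>)) = cscale ((-1) ^ (2 * m - k)) (hodge M \<alpha>)"
    "d (cscale z \<alpha>) = cscale z (d \<alpha>)" "d (J (d (cscale z \<alpha>))) = cscale z (d (J (d \<alpha>)))"
    "d (cscale z (hodge M \<alpha>)) = cscale z (d (hodge M \<alpha>))"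
    "d (J (d (cscale z (hodge M \<alpha>)))) = cscale z (d (J (d (hodge M \<alpha>))))"
    "J \<alpha> \<in> forms M k"
    if "\<alpha> \<in> forms M k" for \<alpha> z
  proof -
    have \<alpha>: "\<alpha> \<in> local_forms M k" using that forms_local by blast
    have h: "hodge M \<alpha> \<in> local_forms M (2 * m - k)" by (rule form_mapD(1)[OF form_map_hodge[OF assms] \<alpha>])
    show "hodge M (J \<alpha>) = J (hodge M \<alpha>)" "J (J \<alpha>) = cscale ((-1) ^ k) \<alpha>"
      "J (J (hodge M \<alpha>)) = cscale ((-1) ^ (2 * m - k)) (hodge M \<alpha>)"
      "d (cscale z \<alpha>) = cscale z (d \<alpha>)" "d (J (d (cscale z \<alpha>))) = cscale z (d (J (d \<alpha>)))"
      "d (cscale z (hodge M \<alpha>)) = cscale z (d (hodge M \<alpha>))"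
      "d (J (d (cscale z (hodge M \<alpha>)))) = cscale z (d (J (d (hodge M \<alpha>))))"
      "J \<alpha> \<in> forms M k"
      by (rule hodge_J_form[OF \<alpha>] J_form_J_form[OF \<alpha>] J_form_J_form[OF h] operator_scale[OF \<alpha>]
          operator_scale[OF h] J_form_forms[OF that])+
  qed
  then show "J ` harmonic_d_plus_dc M k \<subseteq> harmonic_dc_plus_d M k"
    "J ` harmonic_dc_plus_d M k \<subseteq> harmonic_d_plus_dc M k"
    "J ` harmonic_d_dc M k \<subseteq> harmonic_dc_d M k" "J ` harmonic_dc_d M k \<subseteq> harmonic_d_dc M k"
    unfolding harmonic_eqs[OF assms] by auto
qed

text \<open>The star only exchanges the roles of \<alpha> and its dual: a condition on one becomes,
  up to a sign, the same condition on the other.\<close>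

lemma hodge_harmonic:
  assumes "k \<le> 2 * m"
  shows "hodge M ` harmonic_d_plus_dc M k \<subseteq> harmonic_d_dc M (2 * m - k)"
    "hodge M ` harmonic_dc_plus_d M k \<subseteq> harmonic_dc_d M (2 * m - k)"
    "hodge M ` harmonic_d_dc M k \<subseteq> harmonic_d_plus_dc M (2 * m - k)"
    "hodge M ` harmonic_dc_d M k \<subseteq> harmonic_dc_plus_d M (2 * m - k)"
proof -
  have "hodge M (hodge M \<alpha>) = cscale ((-1) ^ k) \<alpha>"
    "d (cscale z \<alpha>) = cscale z (d \<alpha>)" "d (J (cscale z \<alpha>)) = cscale z (d (J \<alpha>))"
    "d (J (d (cscale z \<alpha>))) = cscale z (d (J (d \<alpha>)))"
    "d (J (d (J (cscale z \<alpha>)))) = cscale z (d (J (d (J \<alpha>))))"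
    "hodge M \<alpha> \<in> forms M (2 * m - k)"
    if "\<alpha> \<in> forms M k" for \<alpha> z
  proof -
    have \<alpha>: "\<alpha> \<in> local_forms M k" using that forms_local by blast
    show "hodge M (hodge M \<alpha>) = cscale ((-1) ^ k) \<alpha>"
      "d (cscale z \<alpha>) = cscale z (d \<alpha>)" "d (J (cscale z \<alpha>)) = cscale z (d (J \<alpha>))"
      "d (J (d (cscale z \<alpha>))) = cscale z (d (J (d \<alpha>)))"
      "d (J (d (J (cscale z \<alpha>)))) = cscale z (d (J (d (J \<alpha>))))"
      "hodge M \<alpha> \<in> forms M (2 * m - k)"
      by (rule hodge_hodge[OF \<alpha> assms] operator_scale[OF \<alpha>] hodge_forms[OF that assms])+
  qed
  then show "hodge M ` harmonic_d_plus_dc M k \<subseteq> harmonic_d_dc M (2 * m - k)"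
    "hodge M ` harmonic_dc_plus_d M k \<subseteq> harmonic_dc_d M (2 * m - k)"
    "hodge M ` harmonic_d_dc M k \<subseteq> harmonic_d_plus_dc M (2 * m - k)"
    "hodge M ` harmonic_dc_d M k \<subseteq> harmonic_dc_plus_d M (2 * m - k)"
    unfolding harmonic_eqs[OF assms] harmonic_eqs[OF diff_le_self] by auto
qed

lemma J_iso:
  assumes "complex_subspace V" "complex_subspace W" "J ` V \<subseteq> W" "J ` W \<subseteq> V"
    and "V \<subseteq> local_forms M k" "W \<subseteq> local_forms M k"
  shows "complex_linear_iso V W J"
proof (rule involution_iso[OF assms form_map_J form_map_J])
  show "J (J \<alpha>) = cscale ((-1) ^ k) \<alpha>" if "\<alpha> \<in> V \<union> W" for \<alpha>
    using that assms(5,6) by (intro J_form_J_form) auto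
qed (simp flip: power_add)

lemma hodge_iso:
  assumes "complex_subspace V" "complex_subspace W" "hodge M ` V \<subseteq> W" "hodge M ` W \<subseteq> V"
    and "V \<subseteq> local_forms M k" "W \<subseteq> local_forms M (2 * m - k)" "k \<le> 2 * m"
  shows "complex_linear_iso V W (hodge M)"
proof (rule involution_iso[OF assms(1-6) form_map_hodge[OF assms(7)]])
  show "form_map M (2 * m - k) k (hodge M)"
    using form_map_hodge[of "2 * m - k"] assms(7) by simp
  \<comment> \<open>The degrees k and 2m - k have the same parity, so one scalar s works on both
    spaces.\<close>
  have "(-1 :: complex) ^ (2 * m - k) = (-1) ^ k"
    using assms(7) by (simp add: minus_one_power_iff)
  then show "hodge M (hodge M \<alpha>) = cscale ((-1) ^ k) \<alpha>" if "\<alpha> \<in> V \<union> W" for \<alpha>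
    using that assms(5-7) hodge_hodge[of \<alpha> k] hodge_hodge[of \<alpha> "2 * m - k"] by auto
qed (simp flip: power_add)

end

theorem proposition4p5:
  fixes M :: "('a, 'e::euclidean_space) almost_hermitian" and m k :: nat
  assumes "almost_hermitian_manifold M"
    and "DIM('e) = 2 * m"
    and "compact_space (mtop M)"
    and "k \<le> 2 * m"
  shows "complex_linear_iso (harmonic_d_plus_dc M k) (harmonic_dc_plus_d M k) (J_form M) \<and>
    complex_linear_iso (harmonic_d_plus_dc M k) (harmonic_d_dc M (2 * m - k)) (hodge M) \<and>
    complex_linear_iso (harmonic_dc_plus_d M k) (harmonic_dc_d M (2 * m - k)) (hodge M) \<and>
    complex_linear_iso (harmonic_d_dc M (2 * m - k)) (harmonic_dc_d M (2 * m - k)) (J_form M) \<and>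
    (\<forall>\<alpha>\<in>harmonic_d_plus_dc M k. hodge M (J_form M \<alpha>) = J_form M (hodge M \<alpha>))"
proof -
  interpret hermitian_manifold M m by unfold_locales (fact assms)+
  note subspaces = harmonic_subspace[OF assms(4)] harmonic_subspace[of "2 * m - k", OF diff_le_self]
  \<comment> \<open>The inclusions in degree 2m - k lead to degree 2m - (2m - k), which is k because
    k \<le> 2m.\<close>
  have converse: "hodge M ` harmonic_d_dc M (2 * m - k) \<subseteq> harmonic_d_plus_dc M k"
    "hodge M ` harmonic_dc_d M (2 * m - k) \<subseteq> harmonic_dc_plus_d M k"
    using hodge_harmonic(3,4)[of "2 * m - k"] assms(4) by auto
  show ?thesis
  proof (intro conjI ballI)
    show "complex_linear_iso (harmonic_d_plus_dc M k) (harmonic_dc_plus_d M k) J"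
      by (intro J_iso[OF _ _ _ _ harmonic_forms(1,2)] subspaces J_harmonic assms(4))
    show "complex_linear_iso (harmonic_d_plus_dc M k) (harmonic_d_dc M (2 * m - k)) (hodge M)"
      by (intro hodge_iso[OF _ _ _ _ harmonic_forms(1,3)] subspaces hodge_harmonic converse assms(4))
    show "complex_linear_iso (harmonic_dc_plus_d M k) (harmonic_dc_d M (2 * m - k)) (hodge M)"
      by (intro hodge_iso[OF _ _ _ _ harmonic_forms(2,4)] subspaces hodge_harmonic converse assms(4))
    show "complex_linear_iso (harmonic_d_dc M (2 * m - k)) (harmonic_dc_d M (2 * m - k)) J"
      by (intro J_iso[OF _ _ _ _ harmonic_forms(3,4)] subspaces J_harmonic diff_le_self)
    show "hodge M (J \<alpha>) = J (hodge M \<alpha>)" if "\<alpha> \<in> harmonic_d_plus_dc M k" for \<alpha>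
      using that harmonic_forms(1) by (intro hodge_J_form) blast
  qed
qed

end
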